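(* Let $b_0$ be a $1$-periodic function with Faber–Schauder expansion $b_0=\sum_{i\ge 1}z_i\psi_i$ and suppose that there is $\beta\in(0,\infty)$ with $\llbracket b_0\rrbracket_\beta=\sup_{i\ge1}2^{\beta\ell(i)}|z_i|<\infty$. Let $$b^{R,S}=S\sum_{i\in\mathcal I_R}Z_i\psi_i ,$$ where $Z=(Z_i)_{i\ge1}$ is a centred Gaussian sequence with covariance matrix $A=(A_{ii'})$, $R$ is a random variable in $\{0,1,2,\dots\}$, $S$ is a positive random variable, and $Z,R,S$ are independent. Suppose that one of the following holds: (A) for some fixed $\alpha>0$, $A_{ii}=2^{-2\alpha\ell(i)}$ for all $i$ and $A_{ii'}=0$ for $i\ne i'$; (B) there are constants $0<c_1<c_2$ and $c_3>0$ with $3c_3<c_1$ such that for all $i,i'$: $c_12^{-\ell(i)}\le A_{ii}\le c_22^{-\ell(i)}$, and $|A_{ii'}|\le c_32^{-1.5(\ell(i)+\ell(i'))}$ if $i\neq i'$; in this case put $\alpha=\tfrac12$. Suppose further that there are positive constants $c_1',c_2'$ such that for all integers $r\ge1$ $$\mathrm P(R>r)\le\exp(-c_1'2^rr),\qquad \mathrm P(R=r)\ge\exp(-c_2'2^rr),$$ and that there are constants $0<p_1<p_2$, $q>0$, $C>1$ with $p_1>q|\alpha-\beta|$ such that $$\mathrm P\big(S\in[x^{p_1},x^{p_2}]\big)\ge\exp(-x^q)\quad\text{for all }x\ge C.$$ Let $\{\varepsilon_n\}_{n=1}^\infty$ be a sequence of positive numbers that converges to zero. Then there is a constant $C_1>0$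 such that for any $C_2>0$ there are measurable sets $\mathcal B_n\subseteq L^2(\mathbb T)$ such that for every $a>0$ there is a positive constant $C_3$ such that for $n$ sufficiently large $$\log \mathrm P\big(\|b^{R,S}-b_0\|_\infty<\varepsilon_n\big)\ge-C_1\varepsilon_n^{-1/\beta}|\log\varepsilon_n|,$$ $$\log \mathrm P\big(b^{R,S}\notin\mathcal B_n\big)\le-C_2\varepsilon_n^{-1/\beta}|\log\varepsilon_n|,$$ $$\log N\big(a\varepsilon_n,\{b\in\mathcal B_n:\|b-b_0\|_2\le\varepsilon_n\},\|\cdot\|_\infty\big)\le C_3\varepsilon_n^{-1/\beta}|\log\varepsilon_n|.$$
   Context: $L^2(\mathbb T)$ is the space of $1$-periodic measurable functions $b:\mathbb R\to\mathbb R$ with $\|b\|_2^2=\int_0^1b(x)^2\,dx<\infty$; $\|\cdot\|_\infty$ is the sup-norm. Faber–Schauder basis: let $\Lambda(x)=2x\,\mathbf 1_{[0,1/2)}(x)+2(1-x)\mathbf 1_{[1/2,1]}(x)$. For $j\ge0$, $k=1,\dots,2^j$ put $\psi_{j,k}(x)=\Lambda(2^jx-k+1)$, and $\psi_1(x)=\big(\psi_{0,1}(x-\tfrac12)+\psi_{0,1}(x+\tfrac12)\big)\mathbf 1_{[0,1]}(x)$; functions on $[0,1]$ are extended $1$-periodically. The double index $(j,k)$ is identified with the single index $i=2^j+k$, so that $\psi_i=\psi_{j,k}$ for $i\ge2$. The level is $\ell(i)=0$ for $i\in\{1,2\}$ and $\ell(i)=j$ for $i\in\{2^j+1,\dots,2^{j+1}\}$,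 $j\ge1$. For $r\in\{0,1,\dots\}$, $\mathcal I_r=\{i:\ell(i)\le r\}=\{1,\dots,2^{r+1}\}$. The covering number $N(\varepsilon,A,\rho)$ of a set $A$ for a semimetric $\rho$ is the minimal number of $\rho$-balls of radius $\varepsilon$ needed to cover $A$. *)

theory Defs
  imports "HOL-Probability.Probability"
begin

section \<open>The Faber--Schauder system\<close>

definition hat :: "real \<Rightarrow> real" where
  "hat x = 2 * x * indicator {0..<1/2} x + 2 * (1 - x) * indicator {1/2..1} x"

text \<open>Indices are the naturals \<open>i \<ge> 1\<close>; the value at index 0 plays no role. The level is
  uniform in \<open>i\<close>: it is the \<open>j\<close> with \<open>2 ^ j < i \<le> 2 ^ (j + 1)\<close>, and it is 0 at \<open>i = 1\<close>.\<close>

definition level :: "nat \<Rightarrow> nat" where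
  "level i = (LEAST j. i \<le> 2 ^ (j + 1))"

definition levels_upto :: "nat \<Rightarrow> nat set" where
  "levels_upto r = {i. 1 \<le> i \<and> level i \<le> r}"

text \<open>The functions on \<open>[0,1]\<close>. Here \<open>hat\<close> is zero outside \<open>[0,1]\<close>, so that the two shifted
  copies for \<open>i = 1\<close> do not overlap.\<close>

definition schauder_jk :: "nat \<Rightarrow> nat \<Rightarrow> real \<Rightarrow> real" where
  "schauder_jk j k x = hat (2 ^ j * x - real k + 1)"

definition schauder_unit :: "nat \<Rightarrow> real \<Rightarrow> real" where
  "schauder_unit i x =
     (if i = 1 then (schauder_jk 0 1 (x - 1/2) + schauder_jk 0 1 (x + 1/2)) * indicator {0..1} x
      else schauder_jk (level i) (i - 2 ^ level i) x)"

text \<open>The 1-periodic extension; it is consistent since the functions on \<open>[0,1]\<close> agree at 0 and 1.\<close>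

definition schauder :: "nat \<Rightarrow> real \<Rightarrow> real" where
  "schauder i x = schauder_unit i (frac x)"

lemma level_1: "level 1 = 0"
  unfolding level_def by (rule Least_equality) auto

lemma level_eq:
  assumes "2 ^ j < i" "i \<le> 2 ^ (j + 1)"
  shows "level i = j"
  unfolding level_def
proof (rule Least_equality)
  fix y assume "i \<le> 2 ^ (y + 1)"
  with assms(1) have "(2::nat) ^ j < 2 ^ (y + 1)" by linarith
  then have "j < y + 1" using power_less_imp_less_exp[of "2::nat" j "y + 1"] by simp
  then show "j \<le> y" by simp
qed (rule assms)

lemma level_double_index:
  assumes "1 \<le> k" "k \<le> 2 ^ j"
  shows "level (2 ^ j + k) = j"
  using assms by (intro level_eq) auto

lemma levels_upto_eq: "levels_upto r = {1..2 ^ (r + 1)}"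
proof -
  have *: "level i \<le> r \<longleftrightarrow> i \<le> 2 ^ (r + 1)" for i
  proof
    have "i < 2 ^ i" by (rule less_exp)
    also have "(2::nat) ^ i \<le> 2 ^ (i + 1)" by simp
    finally have "i \<le> 2 ^ (level i + 1)"
      unfolding level_def by (intro LeastI[of "\<lambda>j. i \<le> 2 ^ (j + 1)" i]) simp
    moreover assume "level i \<le> r"
    then have "(2::nat) ^ (level i + 1) \<le> 2 ^ (r + 1)" by (intro power_increasing) auto
    ultimately show "i \<le> 2 ^ (r + 1)" by linarith
  qed (simp add: level_def Least_le)
  show ?thesis unfolding levels_upto_def * by auto
qed

lemma schauder_double_index:
  assumes "1 \<le> k" "k \<le> 2 ^ j" "0 \<le> x" "x < 1"
  shows "schauder (2 ^ j + k) x = schauder_jk j k x"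
proof -
  have "2 ^ j + k \<noteq> 1" using assms(1) one_le_power[of "2::nat" j] by linarith
  then show ?thesis
    using assms by (simp add: schauder_def schauder_unit_def level_double_index frac_eq)
qed

lemma schauder_unit_0_eq_1:
  assumes "1 \<le> i"
  shows "schauder_unit i 0 = schauder_unit i 1"
proof (cases "i = 1")
  case True
  then show ?thesis by (simp add: schauder_unit_def schauder_jk_def hat_def)
next
  case False
  define j k where "j = level i" and "k = i - 2 ^ j"
  have "i \<in> levels_upto j" using assms by (simp add: levels_upto_def j_def)
  then have "i \<le> 2 ^ j + 2 ^ j" by (simp add: levels_upto_eq)
  moreover have "2 ^ j < i"
  proof (cases j)
    case 0
    then show ?thesis using assms False by simp
  next
    case (Suc r)
    then have "i \<notin> levels_upto r" by (simp add: levels_upto_def j_def)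
    then show ?thesis using assms Suc by (simp add: levels_upto_eq)
  qed
  ultimately have "1 \<le> k" and k: "k \<le> 2 ^ j" by (auto simp: k_def)
  moreover from k have "real k \<le> 2 ^ j"
    by (metis of_nat_le_iff of_nat_numeral of_nat_power)
  moreover have "hat y = 0" if "y \<le> 0 \<or> 1 \<le> y" for y
    using that by (auto simp: hat_def indicator_def)
  ultimately have "schauder_jk j k 0 = 0" "schauder_jk j k 1 = 0"
    by (auto simp: schauder_jk_def)
  then show ?thesis using False by (simp add: schauder_unit_def j_def k_def)
qed

definition coeff_sup :: "real \<Rightarrow> (nat \<Rightarrow> real) \<Rightarrow> ereal" where
  "coeff_sup \<beta> z = (SUP i\<in>{1..}. ereal (2 powr (\<beta> * real (level i)) * \<bar>z i\<bar>))"


section \<open>The space \<open>L\<^sup>2\<close> of the circle\<close>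

definition L2T :: "(real \<Rightarrow> real) set" where
  "L2T = {b. (\<forall>x. b (x + 1) = b x) \<and> b \<in> borel_measurable borel \<and>
             set_integrable lborel {0..1} (\<lambda>x. (b x)\<^sup>2)}"

definition norm2 :: "(real \<Rightarrow> real) \<Rightarrow> real" where
  "norm2 b = sqrt (LINT x:{0..1}|lborel. (b x)\<^sup>2)"

text \<open>The Borel sigma-algebra of \<open>L2T\<close> under the seminorm \<open>norm2\<close>.\<close>

definition L2T_borel :: "(real \<Rightarrow> real) measure" where
  "L2T_borel = sigma L2T
     {U. U \<subseteq> L2T \<and>
         (\<forall>b\<in>U. \<exists>e>0. \<forall>b'\<in>L2T. norm2 (\<lambda>x. b' x - b x) < e \<longrightarrow> b' \<in> U)}"

definition sup_norm :: "(real \<Rightarrow> real) \<Rightarrow> ereal" where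
  "sup_norm f = (SUP x. ereal \<bar>f x\<bar>)"

text \<open>The sup-norm on \<open>L2T\<close> must not depend on the representative: sets in \<open>L2T_borel\<close> are closed
  under changes on null sets, so that no such nonempty set has a finite covering number for the
  pointwise supremum. For continuous functions the two norms coincide.\<close>

definition L2T_sup_norm :: "(real \<Rightarrow> real) \<Rightarrow> ereal" where
  "L2T_sup_norm f = esssup lborel (\<lambda>x. ereal \<bar>f x\<bar>)"

lemma L2T_sup_norm_continuous:
  assumes "continuous_on UNIV f"
  shows "L2T_sup_norm f = sup_norm f"
proof (rule antisym)
  have meas: "(\<lambda>x. ereal \<bar>f x\<bar>) \<in> borel_measurable lborel"
    using borel_measurable_continuous_onI[OF assms] by simp
  show "L2T_sup_norm f \<le> sup_norm f"
    unfolding L2T_sup_norm_def sup_norm_def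
    by (intro esssup_I meas AE_I2 SUP_upper) simp
  show "sup_norm f \<le> L2T_sup_norm f"
    unfolding sup_norm_def
  proof (rule SUP_least, rule ccontr)
    fix x assume "\<not> ereal \<bar>f x\<bar> \<le> L2T_sup_norm f"
    then obtain c where c: "L2T_sup_norm f < c" "c < ereal \<bar>f x\<bar>"
      using dense[of "L2T_sup_norm f" "ereal \<bar>f x\<bar>"] by (auto simp: not_le)
    let ?U = "{y. c < ereal \<bar>f y\<bar>}"
    have "AE y in lborel. ereal \<bar>f y\<bar> \<le> L2T_sup_norm f"
      unfolding L2T_sup_norm_def by (rule esssup_AE)
    then have ae: "AE y in lborel. y \<notin> ?U"
      by eventually_elim (use c in auto)
    have "open ?U"
      using assms by (intro open_Collect_less continuous_intros)
    then have "?U \<in> sets lborel" by simp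
    with ae have "?U \<in> null_sets lborel" by (simp only: AE_iff_null_sets)
    then have "negligible ?U"
      by (simp add: negligible_iff_null_sets null_sets_completionI)
    with \<open>open ?U\<close> have "?U = {}" using open_not_negligible by blast
    then show False using c by auto
  qed
qed


section \<open>Covering numbers and the extended logarithm\<close>

definition covering_number ::
    "'a set \<Rightarrow> ('a \<Rightarrow> 'a \<Rightarrow> ereal) \<Rightarrow> ereal \<Rightarrow> 'a set \<Rightarrow> enat" where
  "covering_number X \<rho> e A =
     Inf {enat (card F) | F. finite F \<and> F \<subseteq> X \<and> A \<subseteq> (\<Union>c\<in>F. {x\<in>X. \<rho> c x < e})}"

text \<open>The logarithm with \<open>log 0 = -\<infinity>\<close>, in contrast to \<open>ln 0 = 0\<close> on the reals.\<close>

definition elog :: "ereal \<Rightarrow> ereal" where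
  "elog x = (if x \<le> 0 then -\<infinity> else if x = \<infinity> then \<infinity> else ereal (ln (real_of_ereal x)))"


section \<open>Gaussian sequences and independence\<close>

text \<open>Centred normal laws include the point mass at 0.\<close>

definition centred_normal :: "'w measure \<Rightarrow> ('w \<Rightarrow> real) \<Rightarrow> bool" where
  "centred_normal M X \<longleftrightarrow>
     (AE w in M. X w = 0) \<or> (\<exists>\<sigma>>0. distributed M lborel X (normal_density 0 \<sigma>))"

definition covariance :: "'w measure \<Rightarrow> ('w \<Rightarrow> real) \<Rightarrow> ('w \<Rightarrow> real) \<Rightarrow> real" where
  "covariance M X Y =
     (LINT w|M. (X w - (LINT v|M. X v)) * (Y w - (LINT v|M. Y v)))"

definition centred_gaussian_seq ::
    "'w measure \<Rightarrow> (nat \<Rightarrow> 'w \<Rightarrow> real) \<Rightarrow> (nat \<Rightarrow> nat \<Rightarrow> real) \<Rightarrow> bool" where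
  "centred_gaussian_seq M Z A \<longleftrightarrow>
     (\<forall>i\<ge>1. Z i \<in> borel_measurable M) \<and>
     (\<forall>I c. finite I \<and> I \<subseteq> {1..} \<longrightarrow> centred_normal M (\<lambda>w. \<Sum>i\<in>I. c i * Z i w)) \<and>
     (\<forall>i\<ge>1. \<forall>i'\<ge>1. covariance M (Z i) (Z i') = A i i')"

text \<open>The library's \<open>indep_vars\<close> requires a common codomain type; this is the same
  notion for three variables with values in different types.\<close>

definition generated_events :: "'w measure \<Rightarrow> 'a measure \<Rightarrow> ('w \<Rightarrow> 'a) \<Rightarrow> 'w set set" where
  "generated_events M N X = {X -` B \<inter> space M | B. B \<in> sets N}"

definition indep_vars3 ::
    "'w measure \<Rightarrow> 'a measure \<Rightarrow> ('w \<Rightarrow> 'a) \<Rightarrow> 'b measure \<Rightarrow> ('w \<Rightarrow> 'b) \<Rightarrow>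
     'c measure \<Rightarrow> ('w \<Rightarrow> 'c) \<Rightarrow> bool" where
  "indep_vars3 M N1 X1 N2 X2 N3 X3 \<longleftrightarrow>
     X1 \<in> measurable M N1 \<and> X2 \<in> measurable M N2 \<and> X3 \<in> measurable M N3 \<and>
     prob_space.indep_sets M
       (\<lambda>j::nat. if j = 1 then generated_events M N1 X1
                 else if j = 2 then generated_events M N2 X2
                 else generated_events M N3 X3) {1, 2, 3}"

definition random_series ::
    "(nat \<Rightarrow> 'w \<Rightarrow> real) \<Rightarrow> ('w \<Rightarrow> nat) \<Rightarrow> ('w \<Rightarrow> real) \<Rightarrow> 'w \<Rightarrow> real \<Rightarrow> real" where
  "random_series Z R S w x = S w * (\<Sum>i\<in>levels_upto (R w). Z i w * schauder i x)"

end

theory Submission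
  imports Defs
begin

text \<open>
  Fix a resolution level \<open>r\<close> with \<open>2 ^ r\<close> of the order of \<open>\<epsilon> powr (- 1 / \<beta>)\<close>. Then \<open>2 ^ r * r\<close> is of the
  order of \<open>\<epsilon> powr (- 1 / \<beta>) * \<bar>ln \<epsilon>\<bar>\<close>, so in all three inequalities the scale to be compared with
  is \<open>exp (- const * 2 ^ r * r)\<close>. There are about \<open>2 ^ r\<close> coefficients up to level \<open>r\<close>, so that a factor
  that is a power of \<open>2 ^ r\<close> may be lost for each coefficient.

  \<^emph>\<open>Small ball probability.\<close> Restrict to \<open>R = r\<close>, an event of the admissible probability
  \<open>exp (- c2' * 2 ^ r * r)\<close>. The series of \<open>b0\<close> beyond level \<open>r\<close> is of the order \<open>2 powr (- \<beta> * r)\<close> in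
  sup-norm, because at each point at most one function of each level is nonzero (\<open>schauder_tail\<close>); so
  it suffices that \<open>S * Z i\<close> is polynomially (in \<open>2 ^ r\<close>) close to \<open>z i\<close> up to level \<open>r\<close>. Take
  \<open>S\<close> of size at least \<open>2 powr (r * \<bar>\<alpha> - \<beta>\<bar>)\<close>: the condition \<open>p1 > q * \<bar>\<alpha> - \<beta>\<bar>\<close> ensures that this has probability
  at least \<open>exp (- const * 2 ^ r)\<close>, and after division by such a scale the target coefficients are at
  most a constant times the standard deviations of the Gaussian ones (\<open>gaussian_coeff_box\<close>).

  What remains is a lower bound for the probability that a finite Gaussian vector with possibly
  correlated coordinates falls in a small cube around a given point
  (\<open>gaussian_box_lower_bound\<close>). A linear change of coordinates turns the vector into one with
  orthonormal coordinates. These are independent, since their joint characteristic function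
  factorises (\<open>prob_rectangle_of_char_prod\<close>), and the probability becomes a product of standard
  normal probabilities of intervals. In case (B) the diagonal of the covariance matrix
  dominates: the off-diagonal part is at most \<open>c3\<close> times the sum of \<open>2 powr (- 2 * level i)\<close> over all
  \<open>i\<close>, relative to the matrix with diagonal entries \<open>2 powr (- level i)\<close>, and this sum is at most 3,
  while \<open>3 * c3 < c1\<close>.

  \<^emph>\<open>Sieve and entropy.\<close> Let the sieve consist of the span of the Faber--Schauder functions up to
  a level \<open>r\<close>, with a large enough constant in \<open>2 ^ r\<close> to make \<open>P (R > r)\<close> as small as required. The
  span is finite dimensional, hence closed in \<open>L\<^sup>2\<close>, hence measurable. Its elements are
  piecewise linear on a dyadic grid, so their \<open>L\<^sup>2\<close> norm controls their coefficients up to a factor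
  \<open>4 ^ r\<close> (\<open>coeff_le_norm2\<close>). Within the \<open>L\<^sup>2\<close> ball the coefficients thus lie in a cube of polynomial
  size, and rounding each of them to a polynomially fine grid gives a covering with at most
  \<open>exp (const * 2 ^ r * r)\<close> balls.\<close>

section \<open>Independence from factorising characteristic functions\<close>

text \<open>Uniqueness of characteristic functions in a weighted form: if the weight \<open>g\<close> is invisible to the
  functions \<open>iexp (t * W)\<close>, then it is invisible to the events of \<open>W\<close>. A constant is added to \<open>g\<close> so
  that it becomes the density, up to normalisation, of a probability measure \<open>N\<close>; then \<open>W\<close> has the same
  characteristic function under \<open>N\<close> and under the given measure.\<close>

lemma (in prob_space) integral_indicator_of_char_eq_real:
  fixes g W :: "'a \<Rightarrow> real"
  assumes W[measurable]: "W \<in> borel_measurable M" and g[measurable]: "g \<in> borel_measurable M"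
    and bnd: "\<And>x. \<bar>g x\<bar> \<le> K"
    and eq: "\<And>t. (LINT x|M. complex_of_real (g x) * iexp (t * W x)) =
               complex_of_real c * (LINT x|M. iexp (t * W x))"
    and B[measurable]: "B \<in> sets borel"
  shows "(LINT x|M. g x * indicator B (W x)) = c * prob {x\<in>space M. W x \<in> B}"
proof -
  have gi[simp]: "integrable M g"
    by (rule integrable_const_bound[of _ K]) (use bnd in auto)
  have ce: "c = (LINT x|M. g x)"
  proof -
    have "complex_of_real (LINT x|M. g x) = complex_of_real c"
      using eq[of 0] by (simp add: prob_space)
    then show ?thesis by (metis of_real_eq_iff)
  qed
  define h where "h x = K + 1 + g x" for x
  have h1: "h x \<ge> 1" for x using bnd[of x] by (auto simp: h_def)
  have hm[measurable]: "h \<in> borel_measurable M" unfolding h_def by measurable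
  define d where "d = K + 1 + c"
  have hi[simp]: "integrable M h" unfolding h_def by auto
  have hd: "(LINT x|M. h x) = d" unfolding h_def d_def ce by (simp add: prob_space)
  have "d \<ge> (LINT x|M. 1)" unfolding hd[symmetric] by (intro integral_mono) (use h1 in auto)
  then have d1: "d \<ge> 1" by (simp add: prob_space)
  define N where "N = density M (\<lambda>x. ennreal (h x / d))"
  have hp: "0 \<le> h x / d" for x using h1[of x] d1 by auto
  interpret N: prob_space N
  proof
    have "emeasure N (space N) = (\<integral>\<^sup>+ x. ennreal (h x / d) \<partial>M)"
      unfolding N_def by (auto simp: emeasure_density intro!: nn_integral_cong)
    also have "\<dots> = ennreal (LINT x|M. h x / d)" by (rule nn_integral_eq_integral) (use hp in auto)
    also have "\<dots> = 1" using d1 hd by simp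
    finally show "emeasure N (space N) = 1" .
  qed
  have [measurable]: "W \<in> borel_measurable N" unfolding N_def by measurable
  have int_iexp: "integrable M (\<lambda>x. iexp (t * W x))" for t
    by (rule integrable_const_bound[of _ 1]) auto
  have "distr N borel W = distr M borel W"
  proof (rule Levy_uniqueness)
    show "real_distribution (distr N borel W)" by (rule N.real_distribution_distr) measurable
    show "real_distribution (distr M borel W)" by (rule real_distribution_distr) measurable
    show "char (distr N borel W) = char (distr M borel W)"
    proof
      fix t
      have "char (distr N borel W) t = (LINT x|N. iexp (t * W x))"
        unfolding char_def by (subst integral_distr) auto
      also have "\<dots> = (LINT x|M. (h x / d) *\<^sub>R iexp (t * W x))"
        unfolding N_def by (subst integral_density) (use hp in auto)
      also have "\<dots> = (LINT x|M. complex_of_real ((K+1)/d) * iexp (t * W x) + complex_of_real (1/d) * (complex_of_real (g x) * iexp (t * W x)))"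
        by (intro Bochner_Integration.integral_cong) (auto simp: h_def scaleR_conv_of_real add_divide_distrib algebra_simps)
      also have "\<dots> = complex_of_real ((K+1)/d) * (LINT x|M. iexp (t * W x)) + complex_of_real (1/d) * (LINT x|M. complex_of_real (g x) * iexp (t * W x))"
      proof (subst Bochner_Integration.integral_add)
        show "integrable M (\<lambda>x. complex_of_real (1/d) * (complex_of_real (g x) * iexp (t * W x)))"
          by (intro integrable_mult_right integrable_const_bound[of _ K]) (use bnd in \<open>auto simp: norm_mult\<close>)
      qed (use int_iexp in auto)
      also have "\<dots> = (complex_of_real ((K+1)/d) + complex_of_real (1/d) * complex_of_real c) * (LINT x|M. iexp (t * W x))"
        unfolding eq by (simp add: algebra_simps)
      also have "complex_of_real ((K+1)/d) + complex_of_real (1/d) * complex_of_real c = complex_of_real (d / d)"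
        unfolding of_real_mult[symmetric] of_real_add[symmetric] of_real_eq_iff by (simp add: d_def flip: add_divide_distrib)
      also have "d / d = 1" using d1 by auto
      finally show "char (distr N borel W) t = char (distr M borel W) t"
        unfolding char_def by (subst (2) integral_distr) auto
    qed
  qed
  then have "measure (distr N borel W) B = measure (distr M borel W) B" by simp
  then have m: "measure N {x\<in>space M. W x \<in> B} = prob {x\<in>space M. W x \<in> B}"
    by (simp add: measure_distr N_def vimage_def Int_def conj_commute)
  have [measurable]: "{x\<in>space M. W x \<in> B} \<in> sets M" by measurable
  have "measure N {x\<in>space M. W x \<in> B} = (LINT x|N. indicator {x\<in>space M. W x \<in> B} x)"
    by (simp add: N_def)
  also have "\<dots> = (LINT x|M. (h x / d) *\<^sub>R indicator {x\<in>space M. W x \<in> B} x)"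
    unfolding N_def by (subst integral_density) (use hp in auto)
  also have "\<dots> = (LINT x|M. ((K+1)/d) * indicator {x\<in>space M. W x \<in> B} x + (1/d) * (g x * indicator B (W x)))"
    by (intro Bochner_Integration.integral_cong) (auto simp: h_def indicator_def add_divide_distrib algebra_simps)
  also have "\<dots> = ((K+1)/d) * prob {x\<in>space M. W x \<in> B} + (1/d) * (LINT x|M. g x * indicator B (W x))"
  proof (subst Bochner_Integration.integral_add)
    show "integrable M (\<lambda>x. (1/d) * (g x * indicator B (W x)))"
      by (intro integrable_mult_right integrable_const_bound[of _ K])
        (use bnd in \<open>auto simp: indicator_def abs_mult intro: order_trans[OF abs_ge_zero bnd]\<close>)
    have "integrable M (\<lambda>x. indicat_real {x\<in>space M. W x \<in> B} x)"
      by (rule integrable_const_bound[of _ 1]) auto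
    then show "integrable M (\<lambda>x. (K+1)/d * indicat_real {x\<in>space M. W x \<in> B} x)"
      by (rule integrable_mult_right)
  qed auto
  finally have "d * prob {x\<in>space M. W x \<in> B} = (K + 1) * prob {x\<in>space M. W x \<in> B} + (LINT x|M. g x * indicator B (W x))"
    unfolding m using d1 by (simp add: field_simps)
  then show ?thesis unfolding d_def by (simp add: algebra_simps)
qed

lemma (in prob_space) integral_indicator_of_char_eq:
  fixes F :: "'a \<Rightarrow> complex" and W :: "'a \<Rightarrow> real"
  assumes W[measurable]: "W \<in> borel_measurable M" and F[measurable]: "F \<in> borel_measurable M"
    and bnd: "\<And>x. norm (F x) \<le> K"
    and eq: "\<And>t. (LINT x|M. F x * iexp (t * W x)) = c * (LINT x|M. iexp (t * W x))"
    and B[measurable]: "B \<in> sets borel"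
  shows "(LINT x|M. F x * indicator B (W x)) = c * prob {x\<in>space M. W x \<in> B}"
proof -
  have Fi: "integrable M (\<lambda>x. F x * iexp (t * W x))" for t
    by (intro integrable_const_bound[of _ K]) (use bnd in \<open>auto simp: norm_mult\<close>)
  have eq': "(LINT x|M. cnj (F x) * iexp (t * W x)) = cnj c * (LINT x|M. iexp (t * W x))" for t
  proof -
    have "(LINT x|M. cnj (F x) * iexp (t * W x)) = (LINT x|M. cnj (F x * iexp (- t * W x)))"
      by (intro Bochner_Integration.integral_cong) (auto simp: exp_cnj)
    also have "\<dots> = cnj (LINT x|M. F x * iexp (- t * W x))"
      by (rule Bochner_Integration.integral_cnj)
    also have "\<dots> = cnj (c * (LINT x|M. iexp (- t * W x)))"
      by (simp only: eq)
    also have "\<dots> = cnj c * (LINT x|M. cnj (iexp (- t * W x)))"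
      by (subst Bochner_Integration.integral_cnj) (simp only: complex_cnj_mult)
    finally show ?thesis by (simp add: exp_cnj)
  qed
  have [measurable]: "(\<lambda>x. cnj (F x)) \<in> borel_measurable M"
    by (rule measurable_compose[OF F]) (intro borel_measurable_continuous_onI continuous_intros)
  have Fi': "integrable M (\<lambda>x. cnj (F x) * iexp (t * W x))" for t
    by (intro integrable_const_bound[of _ K]) (use bnd in \<open>auto simp: norm_mult\<close>)
  have Re_eq: "complex_of_real (Re z) * e = (1/2) * (z * e) + (1/2) * (cnj z * e)"
    and Im_eq: "complex_of_real (Im z) * e = (-\<i>/2) * (z * e) + (\<i>/2) * (cnj z * e)" for z e :: complex
    by (simp_all add: complex_eq_iff field_simps)
  have re: "(LINT x|M. Re (F x) * indicator B (W x)) = Re c * prob {x\<in>space M. W x \<in> B}"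
  proof (rule integral_indicator_of_char_eq_real)
    show "\<bar>Re (F x)\<bar> \<le> K" for x using bnd[of x] abs_Re_le_cmod[of "F x"] by linarith
    fix t
    have "(LINT x|M. complex_of_real (Re (F x)) * iexp (t * W x)) =
      (LINT x|M. (1/2) * (F x * iexp (t * W x)) + (1/2) * (cnj (F x) * iexp (t * W x)))"
      by (simp only: Re_eq)
    also have "\<dots> = (1/2) * (c * (LINT x|M. iexp (t * W x))) + (1/2) * (cnj c * (LINT x|M. iexp (t * W x)))"
      unfolding Bochner_Integration.integral_add[OF integrable_mult_right[OF Fi] integrable_mult_right[OF Fi']]
        integral_mult_right_zero eq eq' ..
    also have "\<dots> = complex_of_real (Re c) * (LINT x|M. iexp (t * W x))"
      by (rule Re_eq[symmetric])
    finally show "(LINT x|M. complex_of_real (Re (F x)) * iexp (t * W x)) = complex_of_real (Re c) * (LINT x|M. iexp (t * W x))" .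
  qed auto
  have im: "(LINT x|M. Im (F x) * indicator B (W x)) = Im c * prob {x\<in>space M. W x \<in> B}"
  proof (rule integral_indicator_of_char_eq_real)
    show "\<bar>Im (F x)\<bar> \<le> K" for x using bnd[of x] abs_Im_le_cmod[of "F x"] by linarith
    fix t
    have "(LINT x|M. complex_of_real (Im (F x)) * iexp (t * W x)) =
      (LINT x|M. (-\<i>/2) * (F x * iexp (t * W x)) + (\<i>/2) * (cnj (F x) * iexp (t * W x)))"
      by (simp only: Im_eq)
    also have "\<dots> = (-\<i>/2) * (c * (LINT x|M. iexp (t * W x))) + (\<i>/2) * (cnj c * (LINT x|M. iexp (t * W x)))"
      unfolding Bochner_Integration.integral_add[OF integrable_mult_right[OF Fi] integrable_mult_right[OF Fi']]
        integral_mult_right_zero eq eq' ..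
    also have "\<dots> = complex_of_real (Im c) * (LINT x|M. iexp (t * W x))"
      by (rule Im_eq[symmetric])
    finally show "(LINT x|M. complex_of_real (Im (F x)) * iexp (t * W x)) = complex_of_real (Im c) * (LINT x|M. iexp (t * W x))" .
  qed auto
  have ii: "integrable M (\<lambda>x. F x * indicator B (W x))"
    by (intro integrable_const_bound[of _ K]) (use bnd in \<open>auto simp: norm_mult indicator_def intro: order_trans[OF norm_ge_zero]\<close>)
  have "Re (F x * indicator B (W x)) = Re (F x) * indicator B (W x)"
    "Im (F x * indicator B (W x)) = Im (F x) * indicator B (W x)" for x
    by (auto simp: indicator_def)
  then show ?thesis
    using re im integral_Re[OF ii] integral_Im[OF ii] by (simp add: complex_eq_iff)
qed

text \<open>In the factorisation of the joint characteristic function, one exponential \<open>iexp (t i * W i)\<close> after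
  another is replaced by the indicator of \<open>W i \<in> B i\<close>. The weight in each replacement is the product of
  all the other factors, which is complex. This reduces the independence of several variables to
  the uniqueness theorem on the line.\<close>

lemma (in prob_space) prob_rectangle_of_char_prod:
  fixes W :: "'i \<Rightarrow> 'a \<Rightarrow> real"
  assumes "finite I"
    and W[measurable]: "\<And>i. i \<in> I \<Longrightarrow> W i \<in> borel_measurable M"
    and char: "\<And>t. (LINT x|M. (\<Prod>i\<in>I. iexp (t i * W i x))) = (\<Prod>i\<in>I. (LINT x|M. iexp (t i * W i x)))"
    and B[measurable]: "\<And>i. i \<in> I \<Longrightarrow> B i \<in> sets borel"
  shows "prob {x\<in>space M. \<forall>i\<in>I. W i x \<in> B i} = (\<Prod>i\<in>I. prob {x\<in>space M. W i x \<in> B i})"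
proof -
  have step: "K \<subseteq> I \<Longrightarrow> (\<forall>t. (LINT x|M. (\<Prod>i\<in>K. indicator (B i) (W i x)) * (\<Prod>i\<in>I-K. iexp (t i * W i x))) =
     complex_of_real (\<Prod>i\<in>K. prob {x\<in>space M. W i x \<in> B i}) * (\<Prod>i\<in>I-K. (LINT x|M. iexp (t i * W i x))))" if "finite K" for K
    using that
  proof (induction K rule: finite_induct)
    case empty
    then show ?case using char by simp
  next
    case (insert k K)
    then have KI: "K \<subseteq> I" "k \<in> I" "k \<notin> K" "finite K" by auto
    have dif: "I - K = insert k (I - insert k K)" using KI by auto
    have fin: "finite (I - insert k K)" using \<open>finite I\<close> by auto
    have sub: "I - insert k K \<subseteq> I" by auto
    show ?case
    proof
      fix t
      define F where "F x = (\<Prod>i\<in>K. indicator (B i) (W i x)) * (\<Prod>i\<in>I-insert k K. iexp (t i * W i x))" for x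
      define c where "c = complex_of_real (\<Prod>i\<in>K. prob {x\<in>space M. W i x \<in> B i}) * (\<Prod>i\<in>I-insert k K. (LINT x|M. iexp (t i * W i x)))"
      have "(LINT x|M. F x * indicator (B k) (W k x)) = c * prob {x\<in>space M. W k x \<in> B k}"
      proof (rule integral_indicator_of_char_eq[where K=1])
        show "W k \<in> borel_measurable M" "B k \<in> sets borel" using KI by auto
        show "F \<in> borel_measurable M" unfolding F_def
          by (intro borel_measurable_times borel_measurable_prod) (use KI in auto)
        show "norm (F x) \<le> 1" for x
        proof -
          have "norm (\<Prod>i\<in>K. indicator (B i) (W i x) :: complex) \<le> 1"
            unfolding prod_norm[symmetric] by (intro prod_le_1) (auto simp: indicator_def)
          moreover have "norm (\<Prod>i\<in>I-insert k K. iexp (t i * W i x)) = 1"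
            unfolding prod_norm[symmetric] by (intro prod.neutral) (auto)
          ultimately show ?thesis unfolding F_def norm_mult by simp
        qed
        fix s
        have *: "(\<Prod>i\<in>I-K. iexp ((t(k:=s)) i * W i x)) = iexp (s * W k x) * (\<Prod>i\<in>I-insert k K. iexp (t i * W i x))" for x
          unfolding dif by (subst prod.insert) (use fin in \<open>auto intro!: prod.cong\<close>)
        have **: "(\<Prod>i\<in>I-K. (LINT x|M. iexp ((t(k:=s)) i * W i x))) = (LINT x|M. iexp (s * W k x)) * (\<Prod>i\<in>I-insert k K. (LINT x|M. iexp (t i * W i x)))"
          unfolding dif by (subst prod.insert) (use fin in \<open>auto intro!: prod.cong\<close>)
        show "(LINT x|M. F x * iexp (s * W k x)) = c * (LINT x|M. iexp (s * W k x))"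
          using insert.IH[OF KI(1), rule_format, of "t(k:=s)"] unfolding * ** F_def c_def
          by (simp add: mult_ac)
      qed
      then show "(LINT x|M. (\<Prod>i\<in>insert k K. indicator (B i) (W i x)) * (\<Prod>i\<in>I-insert k K. iexp (t i * W i x))) =
     complex_of_real (\<Prod>i\<in>insert k K. prob {x\<in>space M. W i x \<in> B i}) * (\<Prod>i\<in>I-insert k K. (LINT x|M. iexp (t i * W i x)))"
        unfolding F_def c_def using KI by (simp add: mult_ac)
    qed
  qed
  have *: "(\<Prod>i\<in>I. indicator (B i) (W i x)) = complex_of_real (indicator {x\<in>space M. \<forall>i\<in>I. W i x \<in> B i} x)" if "x \<in> space M" for x
    using that \<open>finite I\<close> by (auto simp: indicator_def prod_zero_iff)
  have me: "{x\<in>space M. \<forall>i\<in>I. W i x \<in> B i} \<in> sets M"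
    by (intro sets.sets_Collect_finite_All[OF _ \<open>finite I\<close>] measurable_sets_Collect[of "W _" M borel "\<lambda>y. y \<in> B _"])
      (use W B in auto)
  have "(LINT x|M. (\<Prod>i\<in>I. indicator (B i) (W i x))) = complex_of_real (prob {x\<in>space M. \<forall>i\<in>I. W i x \<in> B i})"
    using me by (subst Bochner_Integration.integral_cong[OF refl *]) auto
  then have "complex_of_real (prob {x\<in>space M. \<forall>i\<in>I. W i x \<in> B i}) = complex_of_real (\<Prod>i\<in>I. prob {x\<in>space M. W i x \<in> B i})"
    using step[OF \<open>finite I\<close> order_refl, rule_format, of "\<lambda>_. 0"] by simp
  then show ?thesis by (simp only: of_real_eq_iff)
qed

section \<open>Lower bounds for Gaussian vectors\<close>

definition bform :: "'i set \<Rightarrow> ('i \<Rightarrow> 'i \<Rightarrow> real) \<Rightarrow> ('i \<Rightarrow> real) \<Rightarrow> ('i \<Rightarrow> real) \<Rightarrow> real" where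
  "bform J A u v = (\<Sum>k\<in>J. \<Sum>l\<in>J. u k * v l * A k l)"

lemma bform_sym:
  assumes "\<And>k l. k \<in> J \<Longrightarrow> l \<in> J \<Longrightarrow> A k l = A l k"
  shows "bform J A u v = bform J A v u"
  unfolding bform_def by (subst sum.swap) (auto intro!: sum.cong simp: assms mult_ac)

lemma bform_diff_left: "bform J A (\<lambda>l. u l - u' l) v = bform J A u v - bform J A u' v"
  unfolding bform_def by (simp add: algebra_simps sum_subtractf)

lemma bform_sum_left: "bform J A (\<lambda>l. \<Sum>k\<in>K. c k * u k l) v = (\<Sum>k\<in>K. c k * bform J A (u k) v)"
proof -
  have "bform J A (\<lambda>l. \<Sum>k\<in>K. c k * u k l) v = (\<Sum>p\<in>J. \<Sum>l\<in>J. \<Sum>k\<in>K. c k * (u k p * v l * A p l))"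
    unfolding bform_def sum_distrib_right by (simp add: mult.assoc)
  also have "\<dots> = (\<Sum>p\<in>J. \<Sum>k\<in>K. \<Sum>l\<in>J. c k * (u k p * v l * A p l))"
    by (intro sum.cong refl sum.swap)
  also have "\<dots> = (\<Sum>k\<in>K. \<Sum>p\<in>J. \<Sum>l\<in>J. c k * (u k p * v l * A p l))"
    by (rule sum.swap)
  finally show ?thesis by (simp only: bform_def sum_distrib_left)
qed

lemma bform_divide_left: "bform J A (\<lambda>l. u l / s) v = bform J A u v / s"
  unfolding bform_def by (simp add: sum_divide_distrib)

lemma bform_divide_right: "bform J A u (\<lambda>l. v l / s) = bform J A u v / s"
  unfolding bform_def by (simp add: sum_divide_distrib)

text \<open>Gram--Schmidt for the form with matrix \<open>A\<close>. The rows of \<open>T\<close> are orthonormal, and \<open>L\<close> recovers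
  the coordinates of a vector \<open>x\<close> from its image under \<open>T\<close>. Only indices in \<open>I\<close> have been treated, but the form lives
  on the full set \<open>J\<close> throughout, so that nothing has to be extended when \<open>I\<close> grows.\<close>

lemma ex_orthonormalisation:
  fixes A :: "'i \<Rightarrow> 'i \<Rightarrow> real"
  assumes J: "finite J" and sym: "\<And>k l. k \<in> J \<Longrightarrow> l \<in> J \<Longrightarrow> A k l = A l k"
    and pos: "\<And>u. \<exists>k\<in>J. u k \<noteq> 0 \<Longrightarrow> bform J A u u > 0"
    and "I \<subseteq> J"
  shows "\<exists>T L. (\<forall>i\<in>I. \<forall>l\<in>J-I. T i l = 0) \<and>
      (\<forall>i\<in>I. \<forall>j\<in>I. bform J A (T i) (T j) = (if i = j then 1 else 0)) \<and>
      (\<forall>x. \<forall>i\<in>I. x i = (\<Sum>k\<in>I. L i k * (\<Sum>l\<in>J. T k l * x l)))"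
proof -
  have "finite I" using J \<open>I \<subseteq> J\<close> by (rule rev_finite_subset)
  then show ?thesis using \<open>I \<subseteq> J\<close>
  proof (induction I rule: finite_induct)
    case empty
    then show ?case by auto
  next
    case (insert n I)
    then have I: "finite I" "n \<notin> I" "n \<in> J" "I \<subseteq> J" by auto
    obtain T L where TL: "(\<forall>i\<in>I. \<forall>l\<in>J-I. T i l = 0) \<and>
      (\<forall>i\<in>I. \<forall>j\<in>I. bform J A (T i) (T j) = (if i = j then 1 else 0)) \<and>
      (\<forall>x. \<forall>i\<in>I. x i = (\<Sum>k\<in>I. L i k * (\<Sum>l\<in>J. T k l * x l)))"
      using insert.IH[OF I(4)] by (elim exE) (rule that)
    have T0: "\<And>i l. i \<in> I \<Longrightarrow> l \<in> J - I \<Longrightarrow> T i l = 0" and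
      on: "\<And>i j. i \<in> I \<Longrightarrow> j \<in> I \<Longrightarrow> bform J A (T i) (T j) = (if i = j then 1 else 0)" and
      rec: "\<And>x i. i \<in> I \<Longrightarrow> x i = (\<Sum>k\<in>I. L i k * (\<Sum>l\<in>J. T k l * x l))"
      using TL by blast+
    \<comment> \<open>The new row is the unit vector of the new index minus its projections on the old rows.\<close>
    define e :: "'i \<Rightarrow> real" where "e l = (if l = n then 1 else 0)" for l
    define \<alpha> where "\<alpha> k = bform J A e (T k)" for k
    define t where "t l = e l - (\<Sum>k\<in>I. \<alpha> k * T k l)" for l
    have tT: "bform J A t (T j) = 0" if "j \<in> I" for j
    proof -
      have "bform J A t (T j) = \<alpha> j - (\<Sum>k\<in>I. \<alpha> k * bform J A (T k) (T j))"
        unfolding t_def \<alpha>_def by (simp add: bform_diff_left bform_sum_left)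
      also have "(\<Sum>k\<in>I. \<alpha> k * bform J A (T k) (T j)) = (\<Sum>k\<in>I. if k = j then \<alpha> k else 0)"
        by (intro sum.cong) (use on that in auto)
      also have "\<dots> = \<alpha> j" using that I by simp
      finally show ?thesis by simp
    qed
    have tT': "bform J A (T j) t = 0" if "j \<in> I" for j
      using tT[OF that] bform_sym[of J A, OF sym] by metis
    have "t n = 1" unfolding t_def e_def using T0 I by (auto intro!: sum.neutral)
    then have tt: "bform J A t t > 0" using I by (intro pos) (auto intro!: bexI[of _ n])
    define s where "s = sqrt (bform J A t t)"
    have s: "s > 0" "s * s = bform J A t t" using tt by (auto simp: s_def)
    define T' where "T' = T(n := \<lambda>l. t l / s)"
    define L' where "L' i k = (if i = n then (if k = n then s else \<alpha> k) else if k = n then 0 else L i k)" for i k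
    have T'n: "T' n = (\<lambda>l. t l / s)" and T'I: "i \<in> I \<Longrightarrow> T' i = T i" for i
      using I by (auto simp: T'_def)
    show ?case
    proof (rule exI[of _ T'], rule exI[of _ L'], intro conjI ballI allI)
      fix i l assume "i \<in> insert n I" "l \<in> J - insert n I"
      then show "T' i l = 0" using T0 by (auto simp: T'_def t_def e_def intro!: sum.neutral)
    next
      fix i j assume "i \<in> insert n I" "j \<in> insert n I"
      then show "bform J A (T' i) (T' j) = (if i = j then 1 else 0)"
        using I s on tT tT' by (auto simp: T'n T'I bform_divide_left bform_divide_right)
    next
      fix x :: "'i \<Rightarrow> real" and i assume i: "i \<in> insert n I"
      show "x i = (\<Sum>k\<in>insert n I. L' i k * (\<Sum>l\<in>J. T' k l * x l))"
      proof (cases "i = n")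
        case False
        then have iI: "i \<in> I" using i by auto
        have "(\<Sum>k\<in>insert n I. L' i k * (\<Sum>l\<in>J. T' k l * x l)) = (\<Sum>k\<in>I. L i k * (\<Sum>l\<in>J. T k l * x l))"
          using I False by (auto simp: L'_def T'I intro!: sum.cong)
        then show ?thesis using rec[OF iI, of x] by simp
      next
        case True
        have "(\<Sum>k\<in>insert n I. L' i k * (\<Sum>l\<in>J. T' k l * x l)) =
            s * (\<Sum>l\<in>J. t l / s * x l) + (\<Sum>k\<in>I. \<alpha> k * (\<Sum>l\<in>J. T k l * x l))"
          using I True by (subst sum.insert) (auto simp: L'_def T'n T'I intro!: sum.cong)
        also have "s * (\<Sum>l\<in>J. t l / s * x l) = (\<Sum>l\<in>J. t l * x l)"
          using s by (simp add: sum_distrib_left)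
        also have "\<dots> = (\<Sum>l\<in>J. e l * x l) - (\<Sum>l\<in>J. \<Sum>k\<in>I. \<alpha> k * T k l * x l)"
          by (simp add: t_def left_diff_distrib sum_subtractf sum_distrib_right)
        also have "(\<Sum>l\<in>J. e l * x l) = x n"
          using J I by (simp add: e_def if_distrib[of "\<lambda>c. c * _"] cong: if_cong)
        also have "(\<Sum>l\<in>J. \<Sum>k\<in>I. \<alpha> k * T k l * x l) = (\<Sum>k\<in>I. \<alpha> k * (\<Sum>l\<in>J. T k l * x l))"
          by (subst sum.swap) (simp add: sum_distrib_left mult.assoc)
        finally show ?thesis using True by simp
      qed
    qed
  qed
qed

lemma (in prob_space) centred_normal_moments:
  assumes X[measurable]: "X \<in> borel_measurable M" and N: "centred_normal M X"
  shows "integrable M (\<lambda>w. (X w)\<^sup>2)" "expectation X = 0"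
    "(LINT w|M. iexp (t * X w)) = complex_of_real (exp (- t\<^sup>2 * expectation (\<lambda>w. (X w)\<^sup>2) / 2))"
    "expectation (\<lambda>w. (X w)\<^sup>2) = 1 \<Longrightarrow> distributed M lborel X std_normal_density"
proof -
  have "integrable M (\<lambda>w. (X w)\<^sup>2) \<and> expectation X = 0 \<and>
    (LINT w|M. iexp (t * X w)) = complex_of_real (exp (- t\<^sup>2 * expectation (\<lambda>w. (X w)\<^sup>2) / 2)) \<and>
    (expectation (\<lambda>w. (X w)\<^sup>2) = 1 \<longrightarrow> distributed M lborel X std_normal_density)"
    using N unfolding centred_normal_def
  proof (elim disjE exE conjE)
    assume ae: "AE w in M. X w = 0"
    have "integrable M (\<lambda>w. (X w)\<^sup>2) \<longleftrightarrow> integrable M (\<lambda>w. 0 :: real)"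
      by (intro integrable_cong_AE) (use ae in auto)
    moreover have "expectation X = expectation (\<lambda>w. 0)" "expectation (\<lambda>w. (X w)\<^sup>2) = expectation (\<lambda>w. 0)"
      by (intro integral_cong_AE; use ae in auto)+
    moreover have "(LINT w|M. iexp (t * X w)) = (LINT w|M. 1)"
      by (intro integral_cong_AE) (use ae in auto)
    ultimately show ?thesis by (simp add: prob_space)
  next
    fix \<sigma> :: real assume s: "0 < \<sigma>" and D: "distributed M lborel X (normal_density 0 \<sigma>)"
    have E0: "expectation X = 0" using normal_distributed_expectation[OF s D] .
    have E2: "expectation (\<lambda>w. (X w)\<^sup>2) = \<sigma>\<^sup>2" using normal_distributed_variance[OF s D] E0 by simp
    have i: "integrable M (\<lambda>w. (X w)\<^sup>2)"
      using integrable_normal_moment[OF s, of 0 2] distributed_integrable[OF D, of "\<lambda>x. x\<^sup>2"] by simp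
    have D': "distributed M lborel (\<lambda>w. X w / \<sigma>) std_normal_density"
      using normal_standard_normal_convert[OF s, of X 0] D by simp
    have "distr M borel (\<lambda>w. X w / \<sigma>) = std_normal_distribution"
      using distributed_distr_eq_density[OF D'] by (simp cong: distr_cong)
    then have "char (distr M borel (\<lambda>w. X w / \<sigma>)) (t * \<sigma>) = complex_of_real (exp (- ((t*\<sigma>)^2) / 2))"
      by (simp only: char_std_normal_distribution)
    moreover have "char (distr M borel (\<lambda>w. X w / \<sigma>)) (t * \<sigma>) = (LINT w|M. iexp (t * X w))"
      unfolding char_def by (subst integral_distr) (use s in auto)
    ultimately have c: "(LINT w|M. iexp (t * X w)) = complex_of_real (exp (- t\<^sup>2 * \<sigma>\<^sup>2 / 2))"
      by (simp add: power_mult_distrib)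
    have "\<sigma>\<^sup>2 = 1 \<Longrightarrow> \<sigma> = 1" using s by (simp add: power2_eq_1_iff)
    then show ?thesis using E0 E2 i c D by auto
  qed
  then show "integrable M (\<lambda>w. (X w)\<^sup>2)" "expectation X = 0"
    "(LINT w|M. iexp (t * X w)) = complex_of_real (exp (- t\<^sup>2 * expectation (\<lambda>w. (X w)\<^sup>2) / 2))"
    "expectation (\<lambda>w. (X w)\<^sup>2) = 1 \<Longrightarrow> distributed M lborel X std_normal_density" by auto
qed

text \<open>On the interval \<open>\<bar>x\<bar> \<le> \<bar>g\<bar> + \<eta>\<close>, so the density is at least \<open>exp (- g\<^sup>2 - 1) / sqrt (2 * pi)\<close>. The constant
  \<open>1 / 8\<close> is crude.\<close>

lemma (in prob_space) std_normal_interval_lower_bound: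
  assumes X: "distributed M lborel X std_normal_density" and \<eta>: "0 < \<eta>" "\<eta> \<le> 1"
  shows "prob {w\<in>space M. X w \<in> {g - \<eta>..g + \<eta>}} \<ge> \<eta> / 8 * exp (- g\<^sup>2)"
proof -
  have Xm: "X \<in> borel_measurable M" using X by (auto simp: distributed_def)
  have dens: "\<eta> / 8 * exp (- g\<^sup>2) \<le> std_normal_density x * (2 * \<eta>)" if "x \<in> {g - \<eta>..g + \<eta>}" for x
  proof -
    have "\<bar>x\<bar> \<le> \<bar>g\<bar> + \<eta>" using that by auto
    then have "x\<^sup>2 \<le> (\<bar>g\<bar> + \<eta>)\<^sup>2" by (metis abs_ge_zero power2_abs power_mono)
    also have "\<dots> \<le> 2 * g\<^sup>2 + 2 * \<eta>\<^sup>2"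
      using sum_squares_bound[of "\<bar>g\<bar>" \<eta>] by (simp add: power2_sum)
    also have "\<eta>\<^sup>2 \<le> 1" using \<eta> by (simp add: power_le_one)
    finally have "x\<^sup>2 / 2 \<le> g\<^sup>2 + 1" by simp
    then have "exp (- g\<^sup>2) * exp (-1) \<le> exp (- x\<^sup>2 / 2)" by (simp flip: exp_add)
    moreover have "exp (-1::real) \<ge> 1/3" using exp_le by (simp add: exp_minus field_simps)
    ultimately have 1: "exp (- g\<^sup>2) * (1/3) \<le> exp (- x\<^sup>2 / 2)"
      by (smt (verit) exp_gt_zero mult_left_mono)
    have "sqrt (2 * pi) \<le> sqrt (3^2)" using pi_less_4 by (intro real_sqrt_le_mono) auto
    then have 2: "sqrt (2 * pi) \<le> 3" by simp
    have "1 / 3 \<le> 1 / sqrt (2 * pi)" using 2 by (intro divide_left_mono) auto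
    then have "(1/3) * (exp (- g\<^sup>2) * (1/3)) \<le> std_normal_density x"
      unfolding std_normal_density_def using 1 by (intro mult_mono) auto
    then have "(1/3) * (exp (- g\<^sup>2) * (1/3)) * (2 * \<eta>) \<le> std_normal_density x * (2 * \<eta>)"
      using \<eta> by (intro mult_right_mono) auto
    moreover have "\<eta> / 8 * exp (- g\<^sup>2) \<le> (1/3) * (exp (- g\<^sup>2) * (1/3)) * (2 * \<eta>)" using \<eta> by simp
    ultimately show ?thesis by linarith
  qed
  define c where "c = exp (- g\<^sup>2) / 16"
  have c: "c \<le> std_normal_density x" if "x \<in> {g - \<eta>..g + \<eta>}" for x
    using dens[OF that] \<eta> by (simp add: c_def field_simps)
  have "ennreal (\<eta> / 8 * exp (- g\<^sup>2)) = ennreal c * emeasure lborel {g - \<eta>..g + \<eta>}"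
    using \<eta> by (auto simp: c_def simp flip: ennreal_mult)
  also have "\<dots> = (\<integral>\<^sup>+x. ennreal c * indicator {g - \<eta>..g + \<eta>} x \<partial>lborel)"
    by (simp add: nn_integral_cmult_indicator)
  also have "\<dots> \<le> (\<integral>\<^sup>+x. ennreal (std_normal_density x) * indicator {g - \<eta>..g + \<eta>} x \<partial>lborel)"
    by (intro nn_integral_mono) (use c in \<open>auto simp: indicator_def intro!: ennreal_leI\<close>)
  also have "\<dots> = emeasure M (X -` {g - \<eta>..g + \<eta>} \<inter> space M)"
    by (subst distributed_emeasure[OF X]) auto
  also have "X -` {g - \<eta>..g + \<eta>} \<inter> space M = {w\<in>space M. X w \<in> {g - \<eta>..g + \<eta>}}" by auto
  finally show ?thesis by (simp add: emeasure_eq_measure)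
qed

lemma (in prob_space) expectation_lincomb_mult:
  assumes J: "finite J" and m[measurable]: "\<And>i. i \<in> J \<Longrightarrow> Z i \<in> borel_measurable M"
    and sq: "\<And>i. i \<in> J \<Longrightarrow> integrable M (\<lambda>w. (Z i w)\<^sup>2)"
  shows "expectation (\<lambda>w. (\<Sum>i\<in>J. u i * Z i w) * (\<Sum>i\<in>J. v i * Z i w)) =
     bform J (\<lambda>k l. expectation (\<lambda>w. Z k w * Z l w)) u v"
proof -
  have i: "integrable M (\<lambda>w. Z k w * Z l w)" if "k \<in> J" "l \<in> J" for k l
  proof (rule Bochner_Integration.integrable_bound)
    show "integrable M (\<lambda>w. (Z k w)\<^sup>2 + (Z l w)\<^sup>2)" using sq that by auto
    show "AE x in M. norm (Z k x * Z l x) \<le> norm ((Z k x)\<^sup>2 + (Z l x)\<^sup>2)"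
    proof (rule AE_I2)
      fix x
      have "2 * \<bar>Z k x\<bar> * \<bar>Z l x\<bar> \<le> (Z k x)\<^sup>2 + (Z l x)\<^sup>2"
        using sum_squares_bound[of "\<bar>Z k x\<bar>" "\<bar>Z l x\<bar>"] by simp
      moreover have "0 \<le> \<bar>Z k x\<bar> * \<bar>Z l x\<bar>" by simp
      ultimately show "norm (Z k x * Z l x) \<le> norm ((Z k x)\<^sup>2 + (Z l x)\<^sup>2)"
        by (simp only: real_norm_def abs_mult)
    qed
  qed (use that in measurable)
  have "(\<Sum>i\<in>J. u i * Z i w) * (\<Sum>i\<in>J. v i * Z i w) = (\<Sum>k\<in>J. \<Sum>l\<in>J. u k * v l * (Z k w * Z l w))" for w
    by (simp add: sum_product mult_ac)
  then show ?thesis unfolding bform_def using i by (simp add: Bochner_Integration.integral_sum)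
qed

text \<open>Let \<open>G = T Z\<close> be the whitened vector and \<open>g = T y\<close> the target in the new coordinates. The event is implied
  by \<open>\<bar>G k - g k\<bar> \<le> \<eta>\<close> for all \<open>k\<close>, because the entries of \<open>L\<close> in \<open>Z = L G\<close> are at most \<open>sqrt V\<close>. By
  independence this has probability at least \<open>(\<eta> / 8) ^ card J * exp (- Q)\<close> with \<open>Q\<close> the sum of the squares
  of the \<open>g k\<close>. This is the squared Mahalanobis norm of \<open>y\<close>, and the lower bound \<open>\<kappa> * d i\<close> on the covariance
  turns into an upper bound on it.\<close>

lemma (in prob_space) gaussian_box_lower_bound:
  fixes Z :: "'i \<Rightarrow> 'a \<Rightarrow> real"
  assumes J: "finite J" and m[measurable]: "\<And>i. i \<in> J \<Longrightarrow> Z i \<in> borel_measurable M"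
    and normal: "\<And>u. centred_normal M (\<lambda>w. \<Sum>i\<in>J. u i * Z i w)"
    and lam: "0 < \<kappa>" and d: "\<And>i. i \<in> J \<Longrightarrow> 0 < d i"
    and low: "\<And>u. \<kappa> * (\<Sum>i\<in>J. d i * (u i)\<^sup>2) \<le> expectation (\<lambda>w. (\<Sum>i\<in>J. u i * Z i w)\<^sup>2)"
    and up: "\<And>i. i \<in> J \<Longrightarrow> expectation (\<lambda>w. (Z i w)\<^sup>2) \<le> V"
    and \<eta>: "0 < \<eta>" "\<eta> \<le> 1" "real (card J) * sqrt V * \<eta> \<le> \<delta>"
  shows "prob {w\<in>space M. \<forall>i\<in>J. \<bar>Z i w - y i\<bar> \<le> \<delta>} \<ge>
     (\<eta> / 8) ^ card J * exp (- (\<Sum>i\<in>J. (y i)\<^sup>2 / (\<kappa> * d i)))"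
proof -
  define A where "A k l = expectation (\<lambda>w. Z k w * Z l w)" for k l
  have single: "(\<Sum>l\<in>J. (if l = i then 1 else 0) * Z l w) = Z i w" if "i \<in> J" for i w
    using that J by (simp add: if_distrib[of "\<lambda>c. c * _"] cong: if_cong)
  have sq: "integrable M (\<lambda>w. (Z i w)\<^sup>2)" if "i \<in> J" for i
    using centred_normal_moments(1)[OF _ normal[of "\<lambda>l. if l = i then 1 else 0"]] that
    by (simp add: single)
  note lin = expectation_lincomb_mult[of J Z, OF J m sq, folded A_def]
  have pos: "bform J A u u > 0" if "\<exists>k\<in>J. u k \<noteq> 0" for u
  proof -
    have "0 < (\<Sum>i\<in>J. d i * (u i)\<^sup>2)"
      using that d J by (auto intro!: sum_pos2 simp: less_imp_le)
    with lam have "0 < \<kappa> * (\<Sum>i\<in>J. d i * (u i)\<^sup>2)" by simp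
    also note low[of u]
    finally show ?thesis using lin[of u u] by (simp add: power2_eq_square)
  qed
  have sym: "A k l = A l k" for k l by (simp add: A_def mult.commute)
  obtain T L where TL: "(\<forall>i\<in>J. \<forall>l\<in>J-J. T i l = 0) \<and>
      (\<forall>i\<in>J. \<forall>j\<in>J. bform J A (T i) (T j) = (if i = j then 1 else 0)) \<and>
      (\<forall>x. \<forall>i\<in>J. x i = (\<Sum>k\<in>J. L i k * (\<Sum>l\<in>J. T k l * x l)))"
  proof -
    have "\<exists>T L. (\<forall>i\<in>J. \<forall>l\<in>J-J. T i l = 0) \<and>
      (\<forall>i\<in>J. \<forall>j\<in>J. bform J A (T i) (T j) = (if i = j then 1 else 0)) \<and>
      (\<forall>x. \<forall>i\<in>J. x i = (\<Sum>k\<in>J. L i k * (\<Sum>l\<in>J. T k l * x l)))"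
      using J sym pos by (rule ex_orthonormalisation) auto
    then show thesis by (elim exE) (rule that)
  qed
  have on: "\<And>i j. i \<in> J \<Longrightarrow> j \<in> J \<Longrightarrow> bform J A (T i) (T j) = (if i = j then 1 else 0)" and
      rec: "\<And>x i. i \<in> J \<Longrightarrow> x i = (\<Sum>k\<in>J. L i k * (\<Sum>l\<in>J. T k l * x l))"
    using TL by blast+
  define G where "G k w = (\<Sum>l\<in>J. T k l * Z l w)" for k w
  define g where "g k = (\<Sum>l\<in>J. T k l * y l)" for k
  have Gm[measurable]: "G k \<in> borel_measurable M" for k unfolding G_def by measurable
  have Gcomb: "(\<Sum>k\<in>J. c k * G k w) = (\<Sum>l\<in>J. (\<Sum>k\<in>J. c k * T k l) * Z l w)" for c w
    unfolding G_def sum_distrib_left sum_distrib_right by (subst sum.swap) (simp add: mult.assoc)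
  have Gsq: "expectation (\<lambda>w. (\<Sum>k\<in>J. c k * G k w)\<^sup>2) = (\<Sum>k\<in>J. (c k)\<^sup>2)" for c
  proof -
    have "expectation (\<lambda>w. (\<Sum>k\<in>J. c k * G k w)\<^sup>2) = bform J A (\<lambda>l. \<Sum>k\<in>J. c k * T k l) (\<lambda>l. \<Sum>k\<in>J. c k * T k l)"
      unfolding Gcomb power2_eq_square by (rule lin)
    also have "\<dots> = (\<Sum>k\<in>J. c k * bform J A (\<lambda>l. \<Sum>k\<in>J. c k * T k l) (T k))"
      by (subst bform_sum_left) (intro sum.cong refl arg_cong[of _ _ "(*) _"] bform_sym sym)
    also have "\<dots> = (\<Sum>k\<in>J. c k * (\<Sum>j\<in>J. c j * (if j = k then 1 else 0)))"
      unfolding bform_sum_left by (intro sum.cong refl) (simp add: on)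
    also have "\<dots> = (\<Sum>k\<in>J. (c k)\<^sup>2)"
      using J by (simp add: if_distrib[of "\<lambda>c. _ * c"] power2_eq_square cong: if_cong)
    finally show ?thesis .
  qed
  have Gnormal: "centred_normal M (\<lambda>w. \<Sum>k\<in>J. c k * G k w)" for c unfolding Gcomb by (rule normal)
  have char: "(LINT w|M. iexp (\<Sum>k\<in>J. c k * G k w)) = complex_of_real (exp (- (\<Sum>k\<in>J. (c k)\<^sup>2) / 2))" for c
    using centred_normal_moments(3)[OF _ Gnormal[of c], of 1] Gsq[of c] by simp
  have Gsingle: "(\<Sum>k\<in>J. (if k = j then c else 0) * G k w) = c * G j w" if "j \<in> J" for j c w
    using that J by (simp add: if_distrib[of "\<lambda>c. c * _"] cong: if_cong)
  have char1: "(LINT w|M. iexp (c * G j w)) = complex_of_real (exp (- c\<^sup>2 / 2))" if "j \<in> J" for j c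
  proof -
    have "(\<Sum>k\<in>J. (if k = j then c else 0)\<^sup>2) = c\<^sup>2"
      using that J by (simp add: if_distrib[of "\<lambda>c. c\<^sup>2"] cong: if_cong)
    then show ?thesis using char[of "\<lambda>k. if k = j then c else 0"] Gsingle[OF that, of c] by (simp only:)
  qed
  have Gstd: "distributed M lborel (G j) std_normal_density" if "j \<in> J" for j
  proof -
    have "centred_normal M (G j)" using Gnormal[of "\<lambda>k. if k = j then 1 else 0"] Gsingle[OF that, of 1] by simp
    moreover have "(\<Sum>k\<in>J. (if k = j then 1 else (0::real))\<^sup>2) = 1"
      using that J by (simp add: if_distrib[of "\<lambda>c. c\<^sup>2"] cong: if_cong)
    then have "expectation (\<lambda>w. (G j w)\<^sup>2) = 1"
      using Gsq[of "\<lambda>k. if k = j then 1 else 0"] Gsingle[OF that, of 1] by simp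
    ultimately show ?thesis using centred_normal_moments(4)[of "G j"] by simp
  qed
  have rect: "prob {w\<in>space M. \<forall>k\<in>J. G k w \<in> {g k - \<eta>..g k + \<eta>}} =
      (\<Prod>k\<in>J. prob {w\<in>space M. G k w \<in> {g k - \<eta>..g k + \<eta>}})"
  proof (rule prob_rectangle_of_char_prod[OF J])
    fix t
    have "(\<Prod>i\<in>J. iexp (t i * G i x)) = iexp (\<Sum>k\<in>J. t k * G k x)" for x
      using J by (simp add: exp_sum sum_distrib_left)
    then have "(LINT x|M. (\<Prod>i\<in>J. iexp (t i * G i x))) = complex_of_real (exp (\<Sum>k\<in>J. - (t k)\<^sup>2 / 2))"
      by (simp only: char sum_negf sum_divide_distrib[symmetric])
    also have "\<dots> = (\<Prod>k\<in>J. complex_of_real (exp (- (t k)\<^sup>2 / 2)))"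
      using J by (simp only: exp_sum of_real_prod)
    also have "\<dots> = (\<Prod>i\<in>J. (LINT x|M. iexp (t i * G i x)))"
      by (intro prod.cong refl char1[symmetric])
    finally show "(LINT x|M. (\<Prod>i\<in>J. iexp (t i * G i x))) = (\<Prod>i\<in>J. (LINT x|M. iexp (t i * G i x)))" .
  qed auto
  \<comment> \<open>Duality: \<open>Q\<close> is both the variance of the combination of the \<open>Z i\<close> with coefficients \<open>b\<close> and
    the inner product of \<open>b\<close> and \<open>y\<close>.\<close>
  define Q where "Q = (\<Sum>k\<in>J. (g k)\<^sup>2)"
  have Q: "Q \<le> (\<Sum>i\<in>J. (y i)\<^sup>2 / (\<kappa> * d i))"
  proof -
    define b where "b l = (\<Sum>k\<in>J. g k * T k l)" for l
    have "\<kappa> * (\<Sum>i\<in>J. d i * (b i)\<^sup>2) \<le> Q"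
      using low[of b] Gsq[of g] unfolding Gcomb b_def Q_def by simp
    moreover have "Q = (\<Sum>l\<in>J. b l * y l)"
      unfolding Q_def b_def power2_eq_square sum_distrib_right
      by (subst sum.swap) (simp add: g_def sum_distrib_left mult_ac)
    moreover have "(\<Sum>l\<in>J. 2 * (b l * y l)) \<le> (\<Sum>l\<in>J. \<kappa> * (d l * (b l)\<^sup>2) + (y l)\<^sup>2 / (\<kappa> * d l))"
    proof (rule sum_mono)
      fix l assume "l \<in> J"
      define e where "e = \<kappa> * d l"
      have e: "e > 0" using lam d[OF \<open>l \<in> J\<close>] by (simp add: e_def)
      have "0 \<le> (e * b l - y l)\<^sup>2 / e" using e by simp
      also have "\<dots> = e * (b l)\<^sup>2 - 2 * (b l * y l) + (y l)\<^sup>2 / e"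
        using e by (simp add: power2_diff field_simps) (simp add: power2_eq_square)
      finally show "2 * (b l * y l) \<le> \<kappa> * (d l * (b l)\<^sup>2) + (y l)\<^sup>2 / (\<kappa> * d l)"
        by (simp add: e_def mult.assoc)
    qed
    ultimately show ?thesis
      by (simp add: sum.distrib sum_distrib_left[symmetric])
  qed
  have "(\<eta> / 8) ^ card J * exp (- (\<Sum>i\<in>J. (y i)\<^sup>2 / (\<kappa> * d i))) \<le> (\<eta> / 8) ^ card J * exp (- Q)"
    using Q \<eta> by (intro mult_left_mono) auto
  also have "\<dots> = (\<Prod>k\<in>J. \<eta> / 8 * exp (- (g k)\<^sup>2))"
    unfolding Q_def prod.distrib prod_constant sum_negf[symmetric] exp_sum[OF J] ..
  also have "\<dots> \<le> (\<Prod>k\<in>J. prob {w\<in>space M. G k w \<in> {g k - \<eta>..g k + \<eta>}})"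
    by (intro prod_mono conjI std_normal_interval_lower_bound Gstd) (use \<eta> in auto)
  also have "\<dots> = prob {w\<in>space M. \<forall>k\<in>J. G k w \<in> {g k - \<eta>..g k + \<eta>}}" by (rule rect[symmetric])
  also have "\<dots> \<le> prob {w\<in>space M. \<forall>i\<in>J. \<bar>Z i w - y i\<bar> \<le> \<delta>}"
  proof (rule finite_measure_mono)
    show "{w\<in>space M. \<forall>k\<in>J. G k w \<in> {g k - \<eta>..g k + \<eta>}} \<subseteq> {w\<in>space M. \<forall>i\<in>J. \<bar>Z i w - y i\<bar> \<le> \<delta>}"
    proof (safe)
      fix w i assume w: "w \<in> space M" "\<forall>k\<in>J. G k w \<in> {g k - \<eta>..g k + \<eta>}" and i: "i \<in> J"
      have L: "\<bar>L i k\<bar> \<le> sqrt V" if "k \<in> J" for k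
      proof -
        have Z: "Z i w = (\<Sum>k\<in>J. L i k * G k w)" for w using rec[OF i, of "\<lambda>l. Z l w"] by (simp add: G_def)
        have "(L i k)\<^sup>2 \<le> (\<Sum>k\<in>J. (L i k)\<^sup>2)" by (intro member_le_sum) (use that J in auto)
        also have "\<dots> \<le> V" using up[OF i] Gsq[of "L i"] by (simp add: Z)
        finally show ?thesis using real_le_rsqrt by (metis power2_abs)
      qed
      have "Z i w - y i = (\<Sum>k\<in>J. L i k * (\<Sum>l\<in>J. T k l * (Z l w - y l)))"
        by (rule rec[OF i, of "\<lambda>l. Z l w - y l"])
      also have "\<dots> = (\<Sum>k\<in>J. L i k * (G k w - g k))" by (simp add: G_def g_def right_diff_distrib sum_subtractf)
      finally have "\<bar>Z i w - y i\<bar> \<le> (\<Sum>k\<in>J. \<bar>L i k * (G k w - g k)\<bar>)" by simp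
      also have "\<dots> \<le> (\<Sum>k\<in>J. sqrt V * \<eta>)"
        unfolding abs_mult using order_trans[OF abs_ge_zero L[OF i]] w L
        by (intro sum_mono mult_mono) (auto simp: abs_le_iff algebra_simps)
      also have "\<dots> \<le> \<delta>" using \<eta> by simp
      finally show "\<bar>Z i w - y i\<bar> \<le> \<delta>" .
    qed
    show "{w\<in>space M. \<forall>i\<in>J. \<bar>Z i w - y i\<bar> \<le> \<delta>} \<in> sets M"
      by (intro sets.sets_Collect_finite_All[OF _ J]) measurable
  qed
  finally show ?thesis .
qed

section \<open>Faber--Schauder sums\<close>

text \<open>The indices \<open>2 ^ j + k\<close> with \<open>1 \<le> k \<le> 2 ^ j\<close>. For \<open>j = 0\<close> this is \<open>{2}\<close>, although \<open>level 1 = 0\<close>: the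
  function with index 1 is not a rescaled \<open>hat\<close> and is kept apart.\<close>

definition level_block :: "nat \<Rightarrow> nat set" where
  "level_block j = {2 ^ j + 1..2 ^ (j + 1)}"

definition schauder_sum :: "nat \<Rightarrow> (nat \<Rightarrow> real) \<Rightarrow> real \<Rightarrow> real" where
  "schauder_sum r c x = (\<Sum>i\<in>levels_upto r. c i * schauder i x)"

lemma finite_levels_upto [simp]: "finite (levels_upto r)"
  by (simp add: levels_upto_eq)

lemma card_levels_upto: "card (levels_upto r) = 2 ^ (r + 1)"
  by (simp add: levels_upto_eq)

lemma levels_upto_ge_1: "i \<in> levels_upto r \<Longrightarrow> 1 \<le> i"
  by (simp add: levels_upto_eq)

lemma level_le: "i \<in> levels_upto r \<Longrightarrow> level i \<le> r"
  by (simp add: levels_upto_def)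

lemma levels_upto_0: "levels_upto 0 = {1, 2}"
  by (auto simp: levels_upto_eq)

lemma level_level_block: "i \<in> level_block j \<Longrightarrow> level i = j"
  by (intro level_eq) (auto simp: level_block_def)

lemma levels_upto_Suc: "levels_upto (Suc r) = levels_upto r \<union> level_block (Suc r)"
proof -
  have "(2::nat) ^ (r + 1) \<le> 2 ^ (Suc r + 1)" by (intro power_increasing) auto
  moreover have "1 \<le> (2::nat) ^ Suc r" by simp
  ultimately show ?thesis unfolding levels_upto_eq level_block_def by auto
qed

lemma sum_levels_upto_Suc:
  "sum f (levels_upto (Suc r)) = sum f (levels_upto r) + sum f (level_block (Suc r))"
  unfolding levels_upto_Suc
  by (rule sum.union_disjoint) (auto simp: levels_upto_eq level_block_def)

lemma schauder_sum_Suc: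
  "schauder_sum (Suc r) c x = schauder_sum r c x + (\<Sum>i\<in>level_block (Suc r). c i * schauder i x)"
  unfolding schauder_sum_def by (rule sum_levels_upto_Suc)

lemma level_blockE:
  assumes "i \<in> level_block j"
  obtains k where "1 \<le> k" "k \<le> 2 ^ j" "i = 2 ^ j + k"
proof (rule that[of "i - 2 ^ j"])
qed (use assms in \<open>auto simp: level_block_def\<close>)

lemma levels_upto_cases:
  assumes "i \<in> levels_upto r"
  obtains "i = 1" | j k where "j \<le> r" "1 \<le> k" "k \<le> 2 ^ j" "i = 2 ^ j + k"
proof -
  have "i = 1 \<or> (\<exists>j\<le>r. i \<in> level_block j)"
    using assms
  proof (induction r)
    case 0
    then show ?case by (auto simp: levels_upto_0 level_block_def)
  next
    case (Suc r)
    then show ?case unfolding levels_upto_Suc using le_Suc_eq by blast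
  qed
  then show ?thesis using that level_blockE by metis
qed

lemma hat_eq: "hat x = max 0 (1 - \<bar>2 * x - 1\<bar>)"
  by (auto simp: hat_def indicator_def max_def abs_if)

lemma schauder_1: "schauder 1 x = \<bar>2 * frac x - 1\<bar>"
proof -
  have "hat (y - 1/2) + hat (y + 1/2) = \<bar>2 * y - 1\<bar>" if "0 \<le> y" "y < 1" for y
    using that by (auto simp: hat_eq max_def abs_if)
  from this[OF frac_ge_0 frac_lt_1, of x] show ?thesis using frac_ge_0[of x] frac_lt_1[of x]
    by (simp add: schauder_def schauder_unit_def schauder_jk_def less_imp_le add.commute)
qed

lemma schauder_double_index_frac:
  assumes "1 \<le> k" "k \<le> 2 ^ j"
  shows "schauder (2 ^ j + k) x = hat (2 ^ j * frac x - real k + 1)"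
  using schauder_double_index[OF assms, of "frac x"] frac_ge_0[of x] frac_lt_1[of x]
  by (simp add: schauder_def schauder_jk_def frac_eq)

lemma schauder_periodic: "schauder i (x + 1) = schauder i x"
  by (simp add: schauder_def frac_def)

lemma schauder_sum_periodic: "schauder_sum r c (x + 1) = schauder_sum r c x"
  by (simp add: schauder_sum_def schauder_periodic)

lemma abs_schauder_le_1: "1 \<le> i \<Longrightarrow> \<bar>schauder i x\<bar> \<le> 1"
proof -
  assume "1 \<le> i"
  then have "i \<in> levels_upto (level i)" by (simp add: levels_upto_def)
  then show ?thesis
  proof (cases rule: levels_upto_cases)
    case 1
    then show ?thesis using frac_ge_0[of x] frac_lt_1[of x] schauder_1[of x] by (auto simp: abs_if)
  next
    case (2 j k)
    show ?thesis unfolding 2(4) schauder_double_index_frac[OF 2(2,3)] by (auto simp: hat_eq)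
  qed
qed

lemma continuous_on_periodic_extension:
  fixes g :: "real \<Rightarrow> real"
  assumes g: "continuous_on {0..1} g" and eq: "g 0 = g 1"
  shows "continuous_on UNIV (\<lambda>x. g (frac x))"
proof -
  have piece: "continuous_on {real_of_int n..real_of_int n + 1} (\<lambda>x. g (frac x))" for n :: int
  proof (subst continuous_on_cong[OF refl, of _ _ "\<lambda>x. g (x - real_of_int n)"])
    fix x assume x: "x \<in> {real_of_int n..real_of_int n + 1}"
    show "g (frac x) = g (x - real_of_int n)"
    proof (cases "x = real_of_int n + 1")
      case True
      then have "frac x = 0" by (simp add: frac_def)
      then show ?thesis using True eq by simp
    next
      case False
      then have "\<lfloor>x\<rfloor> = n" using x by (intro floor_unique) auto
      then show ?thesis by (simp add: frac_def)
    qed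
  qed (intro continuous_on_compose2[OF g] continuous_intros, auto)
  have "isCont (\<lambda>x. g (frac x)) x" for x
  proof -
    define n where "n = \<lfloor>x\<rfloor>"
    have n: "real_of_int n \<le> x" "x < real_of_int n + 1" unfolding n_def by linarith+
    have "continuous_on ({real_of_int (n-1)..real_of_int (n-1) + 1} \<union> {real_of_int n..real_of_int n + 1}) (\<lambda>x. g (frac x))"
      by (intro continuous_on_closed_Un piece) auto
    moreover have "{real_of_int (n-1)..real_of_int (n-1) + 1} \<union> {real_of_int n..real_of_int n + 1} = {real_of_int n - 1..real_of_int n + 1}"
      by auto
    ultimately have c: "continuous_on {real_of_int n - 1..real_of_int n + 1} (\<lambda>x. g (frac x))" by simp
    have "x \<in> interior {real_of_int n - 1..real_of_int n + 1}" using n by (simp add: interior_atLeastAtMost_real)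
    then show ?thesis using c continuous_on_interior by blast
  qed
  then show ?thesis by (simp add: continuous_at_imp_continuous_on)
qed

lemma continuous_on_hat: "continuous_on UNIV hat"
  unfolding hat_eq[abs_def] by (intro continuous_intros)

lemma continuous_on_schauder:
  assumes "1 \<le> i"
  shows "continuous_on UNIV (schauder i)"
proof -
  have c: "continuous_on S (\<lambda>x. hat (f x))" if "continuous_on S f" for f and S :: "real set"
    by (rule continuous_on_compose2[OF continuous_on_hat that]) auto
  have "continuous_on {0..1} (schauder_unit i)"
  proof (cases "i = 1")
    case True
    have "continuous_on {0..1} (\<lambda>x. schauder_jk 0 1 (x - 1/2) + schauder_jk 0 1 (x + 1/2))"
      unfolding schauder_jk_def by (intro continuous_intros c)
    then show ?thesis
      unfolding True by (rule continuous_on_eq) (simp add: schauder_unit_def)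
  next
    case False
    have "continuous_on {0..1} (\<lambda>x. schauder_jk (level i) (i - 2 ^ level i) x)"
      unfolding schauder_jk_def by (intro continuous_intros c)
    then show ?thesis
      by (rule continuous_on_eq) (use False in \<open>simp add: schauder_unit_def\<close>)
  qed
  then have "continuous_on UNIV (\<lambda>x. schauder_unit i (frac x))"
    by (rule continuous_on_periodic_extension) (rule schauder_unit_0_eq_1[OF assms])
  then show ?thesis by (simp add: schauder_def[abs_def])
qed

lemma continuous_on_schauder_sum: "continuous_on UNIV (schauder_sum r c)"
  unfolding schauder_sum_def[abs_def]
  by (intro continuous_intros continuous_on_schauder) (auto dest: levels_upto_ge_1)

text \<open>The functions of one block have disjoint supports, so that sup-norms of sums over a block are
  governed by the largest coefficient, not by the number of terms.\<close>

lemma sum_level_block_schauder_le_1: "(\<Sum>i\<in>level_block j. \<bar>schauder i x\<bar>) \<le> 1"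
proof -
  define k0 where "k0 = nat (\<lfloor>2 ^ j * frac x\<rfloor> + 1)"
  have "(\<Sum>i\<in>level_block j. \<bar>schauder i x\<bar>) \<le> (\<Sum>i\<in>level_block j. if i = 2 ^ j + k0 then 1 else 0)"
  proof (rule sum_mono)
    fix i assume i: "i \<in> level_block j"
    then obtain k where k: "1 \<le> k" "k \<le> 2 ^ j" "i = 2 ^ j + k" by (rule level_blockE)
    show "\<bar>schauder i x\<bar> \<le> (if i = 2 ^ j + k0 then 1 else 0)"
    proof (cases "k = k0")
      case True
      then show ?thesis using abs_schauder_le_1[of i x] k by auto
    next
      case False
      have "hat (2 ^ j * frac x - real k + 1) = 0"
      proof (rule ccontr)
        assume "hat (2 ^ j * frac x - real k + 1) \<noteq> 0"
        then have "real k - 1 < 2 ^ j * frac x" "2 ^ j * frac x < real k"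
          by (auto simp: hat_eq max_def abs_if split: if_splits)
        then have "\<lfloor>2 ^ j * frac x\<rfloor> = int k - 1" by (intro floor_unique) auto
        then have "k = k0" by (simp add: k0_def)
        with False show False by simp
      qed
      then show ?thesis using k False by (simp add: schauder_double_index_frac)
    qed
  qed
  also have "\<dots> \<le> 1" by (simp add: level_block_def)
  finally show ?thesis .
qed

lemma abs_sum_level_block_le:
  assumes "\<And>i. i \<in> level_block j \<Longrightarrow> \<bar>c i\<bar> \<le> K" "0 \<le> K"
  shows "\<bar>\<Sum>i\<in>level_block j. c i * schauder i x\<bar> \<le> K"
proof -
  have "\<bar>\<Sum>i\<in>level_block j. c i * schauder i x\<bar> \<le> (\<Sum>i\<in>level_block j. K * \<bar>schauder i x\<bar>)"
    by (intro order_trans[OF sum_abs] sum_mono) (auto simp: abs_mult intro!: mult_right_mono assms)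
  also have "\<dots> \<le> K * 1" unfolding sum_distrib_left[symmetric]
    by (intro mult_left_mono sum_level_block_schauder_le_1 assms)
  finally show ?thesis by simp
qed

lemma abs_schauder_sum_le:
  assumes "\<And>i. i \<in> levels_upto r \<Longrightarrow> \<bar>c i\<bar> \<le> K" "0 \<le> K"
  shows "\<bar>schauder_sum r c x\<bar> \<le> (real r + 2) * K"
  using assms(1)
proof (induction r)
  case 0
  have "\<bar>c i * schauder i x\<bar> \<le> K" if "i \<in> {1,2}" for i
  proof -
    have "\<bar>c i\<bar> * \<bar>schauder i x\<bar> \<le> K * 1"
      using 0[of i] that \<open>0 \<le> K\<close> abs_schauder_le_1[of i x] by (intro mult_mono) (auto simp: levels_upto_0)
    then show ?thesis by (simp add: abs_mult)
  qed
  from this[of 1] this[of 2] show ?case by (simp add: schauder_sum_def levels_upto_0)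
next
  case (Suc r)
  have "\<bar>schauder_sum r c x\<bar> \<le> (real r + 2) * K" using Suc by (auto simp: levels_upto_Suc)
  moreover have "\<bar>\<Sum>i\<in>level_block (Suc r). c i * schauder i x\<bar> \<le> K"
    using Suc.prems assms(2) by (intro abs_sum_level_block_le) (auto simp: levels_upto_Suc)
  ultimately show ?case unfolding schauder_sum_Suc by (simp add: algebra_simps)
qed

lemma schauder_sum_diff: "schauder_sum r c x - schauder_sum r c' x = schauder_sum r (\<lambda>i. c i - c' i) x"
  by (simp add: schauder_sum_def left_diff_distrib sum_subtractf)


lemma coeff_sup_bound:
  assumes "coeff_sup \<beta> z < \<infinity>"
  obtains K where "0 < K" "\<And>i. 1 \<le> i \<Longrightarrow> \<bar>z i\<bar> \<le> K * 2 powr (- \<beta> * real (level i))"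
proof -
  obtain K where K: "coeff_sup \<beta> z \<le> ereal K"
    using assms by (cases "coeff_sup \<beta> z") auto
  show ?thesis
  proof (rule that[of "max K 1"])
    fix i :: nat assume "1 \<le> i"
    then have "ereal (2 powr (\<beta> * real (level i)) * \<bar>z i\<bar>) \<le> coeff_sup \<beta> z"
      unfolding coeff_sup_def by (intro SUP_upper) auto
    then have "2 powr (\<beta> * real (level i)) * \<bar>z i\<bar> \<le> max K 1" using K by (metis ereal_less_eq(3) max.coboundedI1 order_trans)
    then show "\<bar>z i\<bar> \<le> max K 1 * 2 powr (- \<beta> * real (level i))"
      by (simp add: powr_minus field_simps)
  qed auto
qed

text \<open>Level \<open>j\<close> contributes at most \<open>K * 2 powr (- \<beta> * j)\<close>, and these bounds form a geometric series. The
  partial sums over complete levels are a subsequence of all partial sums.\<close>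

lemma schauder_tail:
  assumes z: "\<And>i. 1 \<le> i \<Longrightarrow> \<bar>z i\<bar> \<le> K * 2 powr (- \<beta> * real (level i))" and K: "0 < K" and \<beta>: "0 < \<beta>"
    and sums: "(\<lambda>i. z (i + 1) * schauder (i + 1) x) sums b"
  shows "\<bar>b - schauder_sum r z x\<bar> \<le> K / (2 powr \<beta> - 1) * 2 powr (- \<beta> * real r)"
proof -
  define \<tau> where "\<tau> = K / (2 powr \<beta> - 1)"
  have b1: "2 powr \<beta> > 1" using \<beta> by simp
  then have tau: "\<tau> > 0" using K by (simp add: \<tau>_def)
  have step: "\<bar>schauder_sum (r + m) z x - schauder_sum r z x\<bar> \<le>
      \<tau> * (2 powr (- \<beta> * real r) - 2 powr (- \<beta> * real (r + m)))" for m
  proof (induction m)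
    case (Suc m)
    have "\<bar>\<Sum>i\<in>level_block (Suc (r + m)). z i * schauder i x\<bar> \<le> K * 2 powr (- \<beta> * real (Suc (r + m)))"
    proof (rule abs_sum_level_block_le)
      fix i assume i: "i \<in> level_block (Suc (r + m))"
      then have "1 \<le> i" by (auto simp: level_block_def)
      from z[OF this] show "\<bar>z i\<bar> \<le> K * 2 powr (- \<beta> * real (Suc (r + m)))"
        unfolding level_level_block[OF i] .
    qed (use K in auto)
    also have "\<dots> = \<tau> * ((2 powr \<beta> - 1) * 2 powr (- \<beta> * real (Suc (r + m))))"
      using less_imp_neq[OF b1] unfolding \<tau>_def by (metis (no_types, lifting) eq_iff_diff_eq_0 mult.assoc nonzero_eq_divide_eq)
    also have "(2 powr \<beta> - 1) * 2 powr (- \<beta> * real (Suc (r + m))) =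
        2 powr (- \<beta> * real (r + m)) - 2 powr (- \<beta> * real (r + Suc m))"
      by (simp add: left_diff_distrib algebra_simps flip: powr_add)
    finally show ?case using Suc schauder_sum_Suc[of "r + m" z x] by (simp add: right_diff_distrib)
  qed simp
  have "(\<lambda>n. schauder_sum n z x) \<longlonglongrightarrow> b"
  proof -
    have "(\<lambda>n. \<Sum>i<n. z (i + 1) * schauder (i + 1) x) \<longlonglongrightarrow> b" using sums by (simp add: sums_def)
    moreover have "filterlim (\<lambda>n. (2::nat) ^ (n + 1)) sequentially sequentially"
    proof (rule filterlim_subseq)
      show "strict_mono (\<lambda>n. (2::nat) ^ (n + 1))" by (auto simp: strict_mono_def)
    qed
    ultimately have "(\<lambda>n. \<Sum>i<2 ^ (n + 1). z (i + 1) * schauder (i + 1) x) \<longlonglongrightarrow> b"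
      by (rule filterlim_compose)
    moreover have "(\<Sum>i<2 ^ (n + 1). z (i + 1) * schauder (i + 1) x) = schauder_sum n z x" for n
      unfolding schauder_sum_def levels_upto_eq
      by (rule sum.reindex_bij_witness[of _ "\<lambda>i. i - 1" "\<lambda>i. i + 1"]) auto
    ultimately show ?thesis by simp
  qed
  then have "(\<lambda>m. schauder_sum (m + r) z x) \<longlonglongrightarrow> b" by (rule LIMSEQ_ignore_initial_segment)
  then have "(\<lambda>m. \<bar>schauder_sum (m + r) z x - schauder_sum r z x\<bar>) \<longlonglongrightarrow> \<bar>b - schauder_sum r z x\<bar>"
    by (intro tendsto_intros)
  then show ?thesis unfolding \<tau>_def[symmetric]
  proof (rule LIMSEQ_le_const2, intro exI allI impI)
    fix m
    have "0 \<le> \<tau> * 2 powr (- \<beta> * real (r + m))" using tau by simp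
    then show "\<bar>schauder_sum (m + r) z x - schauder_sum r z x\<bar> \<le> \<tau> * 2 powr (- \<beta> * real r)"
      using step[of m] by (simp add: add.commute right_diff_distrib)
  qed
qed


lemma schauder_block_eq_0:
  assumes i: "i \<in> level_block j" and x: "2 ^ j * x \<in> \<int>" "0 \<le> x" "x < 1"
  shows "schauder i x = 0"
proof -
  obtain k where k: "1 \<le> k" "k \<le> 2 ^ j" "i = 2 ^ j + k" using i by (rule level_blockE)
  obtain n where n: "2 ^ j * x = real_of_int n" using x by (auto elim: Ints_cases)
  have "2 ^ j * x - real k + 1 = real_of_int (n - int k + 1)" by (simp add: n)
  moreover have "hat (real_of_int p) = 0" for p
  proof -
    have "p \<le> 0 \<or> p \<ge> 1" by linarith
    then show ?thesis by (auto simp: hat_eq max_def abs_if)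
  qed
  ultimately have "hat (2 ^ j * x - real k + 1) = 0" by metis
  then show ?thesis using k x by (simp add: schauder_double_index_frac frac_eq)
qed

text \<open>Functions of level above \<open>j\<close> vanish on the grid of mesh \<open>1 / 2 ^ (j + 1)\<close>; hence the values of a sum on
  that grid determine its part up to level \<open>j\<close>.\<close>

lemma schauder_sum_eq_lower:
  assumes x: "2 ^ (j + 1) * x \<in> \<int>" "0 \<le> x" "x < 1"
  shows "schauder_sum (j + m) c x = schauder_sum j c x"
proof (induction m)
  case (Suc m)
  have "2 ^ Suc (j + m) * x \<in> \<int>"
  proof -
    have "2 ^ Suc (j + m) * x = 2 ^ m * (2 ^ (j + 1) * x)" by (simp add: power_add)
    also have "\<dots> \<in> \<int>" by (rule Ints_mult[OF _ x(1)]) simp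
    finally show ?thesis .
  qed
  then have "(\<Sum>i\<in>level_block (Suc (j + m)). c i * schauder i x) = 0"
    by (intro sum.neutral ballI) (simp add: schauder_block_eq_0 x)
  then show ?case using Suc schauder_sum_Suc[of "j + m"] by simp
qed simp

text \<open>At the midpoint of the support of a function of level \<open>j\<close>, all other functions of level at least
  \<open>j\<close> vanish, so its coefficient is the value of the sum there minus that of the partial sum of lower
  levels; for the index 1 the point 0 plays the part of the midpoint. Bounding the latter by its sup-norm doubles the bound at each level, which is affordable:
  a power of \<open>2 ^ r\<close> only enters through its logarithm. The bound \<open>(3 * 2 ^ j - 1) * S\<close> for the partial
  sums makes the induction close.\<close>

lemma coeff_le_of_nodes:
  assumes S: "\<And>m. m < 2 ^ (r + 1) \<Longrightarrow> \<bar>schauder_sum r c (real m / 2 ^ (r + 1))\<bar> \<le> S"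
    and i: "i \<in> levels_upto r"
  shows "\<bar>c i\<bar> \<le> 3 * 2 ^ r * S"
proof -
  have S0: "0 \<le> S" using S[of 0] by (simp add: order_trans[OF abs_ge_zero])
  have node: "\<bar>schauder_sum j c (real m / 2 ^ (j + 1))\<bar> \<le> S" if "j \<le> r" "m < 2 ^ (j + 1)" for j m
  proof -
    have p: "(2::nat) ^ (r + 1) = 2 ^ (j + 1) * 2 ^ (r - j)" using that by (simp flip: power_add)
    have p': "(2::real) ^ (r + 1) = 2 ^ (j + 1) * 2 ^ (r - j)" using that by (simp flip: power_add)
    have "real m < 2 ^ (j + 1)" using that by (metis of_nat_less_iff of_nat_numeral of_nat_power)
    then have "schauder_sum (j + (r - j)) c (real m / 2 ^ (j + 1)) = schauder_sum j c (real m / 2 ^ (j + 1))"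
      by (intro schauder_sum_eq_lower) auto
    moreover have "real m / 2 ^ (j + 1) = real (m * 2 ^ (r - j)) / 2 ^ (r + 1)"
      unfolding p' by simp
    moreover have "m * 2 ^ (r - j) < 2 ^ (r + 1)" unfolding p using that by simp
    ultimately show ?thesis using S[of "m * 2 ^ (r - j)"] that by simp
  qed
  have main: "j \<le> r \<Longrightarrow> (\<forall>x. \<bar>schauder_sum j c x\<bar> \<le> (3 * 2 ^ j - 1) * S) \<and>
     (\<forall>i\<in>levels_upto j. \<bar>c i\<bar> \<le> 3 * 2 ^ j * S)" for j
  proof (induction j)
    case 0
    have h0: "schauder 2 0 = 0" "schauder 2 (1/2) = 1" "schauder 1 0 = 1" "schauder 1 (1/2) = 0"
      using schauder_double_index_frac[of 1 0 0] schauder_double_index_frac[of 1 0 "1/2"]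
        schauder_1[of 0] schauder_1[of "1/2"]
      by (simp_all add: hat_eq frac_eq numeral_2_eq_2[symmetric])
    have c: "\<bar>c 1\<bar> \<le> S" "\<bar>c 2\<bar> \<le> S"
      using node[of 0 0] node[of 0 1] h0 by (simp_all add: schauder_sum_def levels_upto_0)
    have "\<bar>schauder_sum 0 c x\<bar> \<le> (real 0 + 2) * S" for x
      using c S0 by (intro abs_schauder_sum_le) (auto simp: levels_upto_0)
    then show ?case using c S0 by (auto simp: levels_upto_0)
  next
    case (Suc j)
    then have IH: "\<And>x. \<bar>schauder_sum j c x\<bar> \<le> (3 * 2 ^ j - 1) * S"
       "\<And>i. i \<in> levels_upto j \<Longrightarrow> \<bar>c i\<bar> \<le> 3 * 2 ^ j * S" by auto
    have new: "\<bar>c i\<bar> \<le> 3 * 2 ^ j * S" if i: "i \<in> level_block (Suc j)" for i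
    proof -
      obtain k where k: "1 \<le> k" "k \<le> 2 ^ Suc j" "i = 2 ^ Suc j + k" using i by (rule level_blockE)
      define m where "m = 2 * k - 1"
      define x where "x = real m / 2 ^ (Suc j + 1)"
      have m: "m < 2 ^ (Suc j + 1)" "real m = 2 * real k - 1" using k by (auto simp: m_def of_nat_diff)
      have "real m < 2 ^ (Suc j + 1)" using m(1) by (metis of_nat_less_iff of_nat_numeral of_nat_power)
      then have x: "0 \<le> x" "x < 1" by (auto simp: x_def)
      have x2: "2 ^ Suc j * x = real k - 1/2" by (simp add: x_def m(2) field_simps)
      have "schauder i' x = (if i' = i then 1 else 0)" if i': "i' \<in> level_block (Suc j)" for i'
      proof -
        obtain k' where k': "1 \<le> k'" "k' \<le> 2 ^ Suc j" "i' = 2 ^ Suc j + k'" using i' by (rule level_blockE)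
        have "schauder i' x = hat (real k - real k' + 1/2)"
          unfolding k'(3) schauder_double_index_frac[OF k'(1,2)] using x x2 by (simp add: frac_eq add.commute)
        also have "\<dots> = (if k' = k then 1 else 0)" by (auto simp: hat_eq max_def abs_if)
        finally show ?thesis using k k' by simp
      qed
      then have "(\<Sum>i'\<in>level_block (Suc j). c i' * schauder i' x) = (\<Sum>i'\<in>level_block (Suc j). if i' = i then c i else 0)"
        by (intro sum.cong) auto
      also have "\<dots> = c i" using i by (simp add: level_block_def)
      finally have "c i = schauder_sum (Suc j) c x - schauder_sum j c x" by (simp add: schauder_sum_Suc)
      moreover have "\<bar>schauder_sum (Suc j) c x\<bar> \<le> S" unfolding x_def using node[of "Suc j" m] Suc.prems m by blast
      ultimately have "\<bar>c i\<bar> \<le> S + (3 * 2 ^ j - 1) * S" using IH(1)[of x] by linarith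
      then show ?thesis by (simp add: algebra_simps)
    qed
    have "\<bar>schauder_sum (Suc j) c x\<bar> \<le> (3 * 2 ^ Suc j - 1) * S" for x
    proof -
      have "\<bar>\<Sum>i\<in>level_block (Suc j). c i * schauder i x\<bar> \<le> 3 * 2 ^ j * S"
        by (intro abs_sum_level_block_le new) (use S0 in auto)
      then show ?thesis using IH(1)[of x] unfolding schauder_sum_Suc by (simp add: algebra_simps)
    qed
    moreover have "\<bar>c i\<bar> \<le> 3 * 2 ^ Suc j * S" if "i \<in> levels_upto (Suc j)" for i
    proof -
      have "\<bar>c i\<bar> \<le> 3 * 2 ^ j * S" using that new IH(2) by (auto simp: levels_upto_Suc)
      also have "\<dots> \<le> 3 * 2 ^ Suc j * S" using S0 by (intro mult_right_mono) auto
      finally show ?thesis .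
    qed
    ultimately show ?case by blast
  qed
  then show ?thesis using i by blast
qed

section \<open>The two covariance structures\<close>

lemma (in prob_space) centred_gaussian_seqD:
  assumes "centred_gaussian_seq M Z A"
  shows centred_gaussian_seq_measurable: "\<And>i. 1 \<le> i \<Longrightarrow> Z i \<in> borel_measurable M"
    and centred_gaussian_seq_normal: "\<And>I u. finite I \<Longrightarrow> I \<subseteq> {1..} \<Longrightarrow> centred_normal M (\<lambda>w. \<Sum>i\<in>I. u i * Z i w)"
    and centred_gaussian_seq_integrable: "\<And>i. 1 \<le> i \<Longrightarrow> integrable M (\<lambda>w. (Z i w)\<^sup>2)"
    and centred_gaussian_seq_product: "\<And>i i'. 1 \<le> i \<Longrightarrow> 1 \<le> i' \<Longrightarrow> expectation (\<lambda>w. Z i w * Z i' w) = A i i'"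
proof -
  show m: "Z i \<in> borel_measurable M" if "1 \<le> i" for i
    using assms that unfolding centred_gaussian_seq_def by auto
  show n: "centred_normal M (\<lambda>w. \<Sum>i\<in>I. u i * Z i w)" if "finite I" "I \<subseteq> {1..}" for I u
    using assms that unfolding centred_gaussian_seq_def by auto
  have n1: "centred_normal M (Z i)" if "1 \<le> i" for i
    using n[of "{i}" "\<lambda>_. 1"] that by simp
  show "integrable M (\<lambda>w. (Z i w)\<^sup>2)" if "1 \<le> i" for i
    using centred_normal_moments(1)[OF m n1] that by auto
  have e: "expectation (Z i) = 0" if "1 \<le> i" for i
    using centred_normal_moments(2)[OF m n1] that by auto
  show "expectation (\<lambda>w. Z i w * Z i' w) = A i i'" if "1 \<le> i" "1 \<le> i'" for i i'
  proof -
    have "covariance M (Z i) (Z i') = A i i'"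
      using assms that unfolding centred_gaussian_seq_def by auto
    then show ?thesis using e that by (simp add: covariance_def)
  qed
qed

lemma (in prob_space) centred_gaussian_seq_second_moment:
  assumes G: "centred_gaussian_seq M Z A" and J: "finite J" "J \<subseteq> {1..}"
  shows "expectation (\<lambda>w. (\<Sum>i\<in>J. u i * Z i w)\<^sup>2) = bform J A u u"
proof -
  have J1: "1 \<le> i" if "i \<in> J" for i using J that by auto
  have "expectation (\<lambda>w. (\<Sum>i\<in>J. u i * Z i w)\<^sup>2) = bform J (\<lambda>k l. expectation (\<lambda>w. Z k w * Z l w)) u u"
    unfolding power2_eq_square using J1
    by (intro expectation_lincomb_mult J centred_gaussian_seq_measurable[OF G] centred_gaussian_seq_integrable[OF G])
  also have "\<dots> = bform J A u u"
    unfolding bform_def using J1 by (intro sum.cong refl) (simp add: centred_gaussian_seq_product[OF G])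
  finally show ?thesis .
qed

lemma sum_levels_upto_powr_le: "(\<Sum>i\<in>levels_upto r. 2 powr (- 2 * real (level i))) \<le> 3 - 2 powr (- real r)"
proof (induction r)
  case 0
  have "level 2 = 0" by (rule level_eq) auto
  then show ?case using level_1 by (simp add: levels_upto_0)
next
  case (Suc r)
  have "(\<Sum>i\<in>level_block (Suc r). 2 powr (- 2 * real (level i))) = (\<Sum>i\<in>level_block (Suc r). 2 powr (- 2 * real (Suc r)))"
    by (intro sum.cong refl) (simp add: level_level_block)
  also have "\<dots> = real (2 ^ Suc r) * 2 powr (- 2 * real (Suc r))"
    by (simp add: level_block_def)
  also have "\<dots> = 2 powr (real (Suc r)) * 2 powr (- 2 * real (Suc r))"
    by (simp only: of_nat_power of_nat_numeral powr_realpow[symmetric, of 2])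
  also have "\<dots> = 2 powr (real (Suc r) + - 2 * real (Suc r))"
    by (rule powr_add[symmetric])
  also have "real (Suc r) + - 2 * real (Suc r) = - real r - 1"
    by simp
  also have "2 powr (- real r - 1) = 2 powr (- real r) / 2"
    by (subst powr_diff) simp
  also have "\<dots> = 2 powr (- real r) - 2 powr (- real (Suc r))"
    by (simp add: powr_diff powr_minus_divide)
  finally show ?case using Suc by (simp only: sum_levels_upto_Suc)
qed

text \<open>The off-diagonal part of the form is at most \<open>c3\<close> times the square of the sum of
  \<open>\<bar>u i\<bar> * 2 powr (- 1.5 * level i)\<close>. Splitting the exponent as \<open>1/2 + 1\<close>, the Cauchy--Schwarz inequality
  bounds the square by the diagonal form times the sum of \<open>2 powr (- 2 * level i)\<close>, which is at most 3
  for every \<open>r\<close>. A row-sum criterion would not do: the row sums grow with \<open>r\<close>.\<close>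

lemma bform_lower_bound_nearly_diagonal:
  assumes c: "0 \<le> c3"
    and diag: "\<And>i. 1 \<le> i \<Longrightarrow> c1 * 2 powr (- real (level i)) \<le> A i i"
    and off: "\<And>i i'. 1 \<le> i \<Longrightarrow> 1 \<le> i' \<Longrightarrow> i \<noteq> i' \<Longrightarrow>
      \<bar>A i i'\<bar> \<le> c3 * 2 powr (- 1.5 * (real (level i) + real (level i')))"
  shows "(c1 - 3 * c3) * (\<Sum>i\<in>levels_upto r. 2 powr (- real (level i)) * (u i)\<^sup>2) \<le> bform (levels_upto r) A u u"
proof -
  define J where "J = levels_upto r"
  define d where "d i = (2::real) powr (- real (level i))" for i
  define e where "e i = (2::real) powr (- 1.5 * real (level i))" for i
  define D where "D = (\<Sum>i\<in>J. d i * (u i)\<^sup>2)"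
  have J1: "1 \<le> i" if "i \<in> J" for i using that levels_upto_ge_1 by (auto simp: J_def)
  have fin: "finite J" by (simp add: J_def)
  have "(\<Sum>i\<in>J. \<bar>u i\<bar> * e i)\<^sup>2 = (\<Sum>i\<in>J. (sqrt (d i) * \<bar>u i\<bar>) * d i)\<^sup>2"
  proof -
    have "sqrt (d i) * d i = e i" for i
      by (simp add: d_def e_def powr_half_sqrt[symmetric] powr_powr flip: powr_add)
    then have "\<bar>u i\<bar> * e i = (sqrt (d i) * \<bar>u i\<bar>) * d i" for i by (metis mult.assoc mult.commute)
    then show ?thesis by (simp only:)
  qed
  also have "\<dots> \<le> (\<Sum>i\<in>J. (sqrt (d i) * \<bar>u i\<bar>)\<^sup>2) * (\<Sum>i\<in>J. (d i)\<^sup>2)"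
    by (rule Cauchy_Schwarz_ineq_sum)
  also have "(\<Sum>i\<in>J. (sqrt (d i) * \<bar>u i\<bar>)\<^sup>2) = D"
    by (simp add: D_def power_mult_distrib d_def)
  also have "(\<Sum>i\<in>J. (d i)\<^sup>2) = (\<Sum>i\<in>levels_upto r. 2 powr (- 2 * real (level i)))"
    by (simp add: d_def J_def power2_eq_square flip: powr_add)
  also have "\<dots> \<le> 3" using sum_levels_upto_powr_le[of r] by (smt (verit) powr_ge_zero)
  finally have "(\<Sum>i\<in>J. \<bar>u i\<bar> * e i)\<^sup>2 \<le> D * 3"
    by (smt (verit) D_def d_def mult_left_mono powr_ge_zero sum_nonneg zero_le_power2 mult_nonneg_nonneg)
  from mult_left_mono[OF this c] have S: "c3 * (\<Sum>i\<in>J. \<bar>u i\<bar> * e i)\<^sup>2 \<le> 3 * c3 * D"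
    by (simp add: mult_ac)
  have "c1 * D - c3 * (\<Sum>i\<in>J. \<bar>u i\<bar> * e i)\<^sup>2 =
     (\<Sum>i\<in>J. \<Sum>j\<in>J. (if i = j then c1 * d i * (u i)\<^sup>2 else 0) - c3 * (\<bar>u i\<bar> * e i) * (\<bar>u j\<bar> * e j))"
    unfolding sum_subtractf using fin
    by (simp add: D_def power2_eq_square[of "sum _ _"] sum_product sum_distrib_left mult_ac)
  also have "\<dots> \<le> (\<Sum>i\<in>J. \<Sum>j\<in>J. u i * u j * A i j)"
  proof (intro sum_mono)
    fix i j assume ij: "i \<in> J" "j \<in> J"
    have nn: "0 \<le> c3 * (\<bar>u i\<bar> * e i) * (\<bar>u j\<bar> * e j)" using c by (simp add: e_def)
    show "(if i = j then c1 * d i * (u i)\<^sup>2 else 0) - c3 * (\<bar>u i\<bar> * e i) * (\<bar>u j\<bar> * e j) \<le> u i * u j * A i j"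
    proof (cases "i = j")
      case True
      have "c1 * d i * (u i)\<^sup>2 \<le> A i i * (u i)\<^sup>2"
        using diag[OF J1[OF ij(1)]] by (intro mult_right_mono) (auto simp: d_def)
      then show ?thesis using True nn by (simp add: power2_eq_square mult_ac)
    next
      case False
      have "\<bar>A i j\<bar> \<le> c3 * (e i * e j)"
        using off[OF J1[OF ij(1)] J1[OF ij(2)] False] by (simp add: e_def distrib_left flip: powr_add)
      then have "\<bar>u i\<bar> * \<bar>u j\<bar> * \<bar>A i j\<bar> \<le> \<bar>u i\<bar> * \<bar>u j\<bar> * (c3 * (e i * e j))"
        by (intro mult_left_mono) auto
      then have "\<bar>u i * u j * A i j\<bar> \<le> c3 * (\<bar>u i\<bar> * e i) * (\<bar>u j\<bar> * e j)"
        by (simp add: abs_mult mult_ac)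
      then show ?thesis using False by auto
    qed
  qed
  finally show ?thesis using S unfolding bform_def D_def d_def J_def by (simp add: algebra_simps)
qed

text \<open>The common consequence of (A) and (B): up to constants that do not depend on the truncation
  level, the covariance is bounded below by the diagonal matrix with entries
  \<open>2 powr (- 2 * \<alpha> * level i)\<close>.\<close>

definition covariance_bounds ::
    "'w measure \<Rightarrow> (nat \<Rightarrow> 'w \<Rightarrow> real) \<Rightarrow> real \<Rightarrow> real \<Rightarrow> real \<Rightarrow> bool" where
  "covariance_bounds M Z \<alpha> \<kappa> V \<longleftrightarrow> 0 < \<kappa> \<and> 0 < V \<and>
     (\<forall>i\<ge>1. (LINT w|M. (Z i w)\<^sup>2) \<le> V) \<and>
     (\<forall>r u. \<kappa> * (\<Sum>i\<in>levels_upto r. 2 powr (- 2 * \<alpha> * real (level i)) * (u i)\<^sup>2)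
        \<le> (LINT w|M. (\<Sum>i\<in>levels_upto r. u i * Z i w)\<^sup>2))"

lemma (in prob_space) covariance_bounds_cases:
  assumes G: "centred_gaussian_seq M Z A" and
    "(0 < \<alpha> \<and>
          (\<forall>i\<ge>1. A i i = 2 powr (- 2 * \<alpha> * real (level i))) \<and>
          (\<forall>i\<ge>1. \<forall>i'\<ge>1. i \<noteq> i' \<longrightarrow> A i i' = 0))
       \<or> (\<alpha> = 1/2 \<and>
          (\<exists>c1 c2 c3. 0 < c1 \<and> c1 < c2 \<and> 0 < c3 \<and> 3 * c3 < c1 \<and>
            (\<forall>i\<ge>1. c1 * 2 powr (- real (level i)) \<le> A i i \<and>
                   A i i \<le> c2 * 2 powr (- real (level i))) \<and>
            (\<forall>i\<ge>1. \<forall>i'\<ge>1. i \<noteq> i' \<longrightarrow>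
               \<bar>A i i'\<bar> \<le> c3 * 2 powr (- 1.5 * (real (level i) + real (level i'))))))"
  shows "\<exists>\<kappa> V. covariance_bounds M Z \<alpha> \<kappa> V"
proof -
  have sub: "levels_upto r \<subseteq> {1..}" for r by (auto simp: levels_upto_def)
  have sm: "expectation (\<lambda>w. (\<Sum>i\<in>levels_upto r. u i * Z i w)\<^sup>2) = bform (levels_upto r) A u u" for r u
    by (rule centred_gaussian_seq_second_moment[OF G _ sub]) simp
  have sq: "expectation (\<lambda>w. (Z i w)\<^sup>2) = A i i" if "1 \<le> i" for i
    using centred_gaussian_seq_product[OF G that that] by (simp add: power2_eq_square)
  show ?thesis using assms(2)
  proof (elim disjE conjE exE)
    assume a: "0 < \<alpha>" "\<forall>i\<ge>1. A i i = 2 powr (- 2 * \<alpha> * real (level i))"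
      "\<forall>i\<ge>1. \<forall>i'\<ge>1. i \<noteq> i' \<longrightarrow> A i i' = 0"
    have "covariance_bounds M Z \<alpha> 1 1"
      unfolding covariance_bounds_def
    proof (intro conjI allI impI)
      fix i :: nat assume "1 \<le> i"
      then show "expectation (\<lambda>w. (Z i w)\<^sup>2) \<le> 1" using a powr_mono[of "- 2 * \<alpha> * real (level i)" 0 2] by (simp add: sq)
    next
      fix r u
      have "bform (levels_upto r) A u u = (\<Sum>k\<in>levels_upto r. \<Sum>l\<in>levels_upto r. if k = l then A k k * (u k)\<^sup>2 else 0)"
        unfolding bform_def using a(3) by (intro sum.cong refl) (auto dest!: levels_upto_ge_1 simp: power2_eq_square)
      also have "\<dots> = (\<Sum>i\<in>levels_upto r. 2 powr (- 2 * \<alpha> * real (level i)) * (u i)\<^sup>2)"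
        using a(2) by (auto intro!: sum.cong dest!: levels_upto_ge_1)
      finally show "1 * (\<Sum>i\<in>levels_upto r. 2 powr (- 2 * \<alpha> * real (level i)) * (u i)\<^sup>2)
        \<le> expectation (\<lambda>w. (\<Sum>i\<in>levels_upto r. u i * Z i w)\<^sup>2)" by (simp add: sm)
    qed auto
    then show ?thesis by blast
  next
    fix c1 c2 c3
    assume a: "\<alpha> = 1/2" and c: "0 < c1" "c1 < c2" "0 < c3" "3 * c3 < c1" and
      A: "\<forall>i\<ge>1. c1 * 2 powr (- real (level i)) \<le> A i i \<and> A i i \<le> c2 * 2 powr (- real (level i))"
      "\<forall>i\<ge>1. \<forall>i'\<ge>1. i \<noteq> i' \<longrightarrow> \<bar>A i i'\<bar> \<le> c3 * 2 powr (- 1.5 * (real (level i) + real (level i')))"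
    have "covariance_bounds M Z \<alpha> (c1 - 3 * c3) c2"
      unfolding covariance_bounds_def
    proof (intro conjI allI impI)
      fix i :: nat assume "1 \<le> i"
      then have "A i i \<le> c2 * 2 powr (- real (level i))" using A by auto
      also have "\<dots> \<le> c2 * 2 powr 0" using c by (intro mult_left_mono powr_mono) auto
      finally show "expectation (\<lambda>w. (Z i w)\<^sup>2) \<le> c2" using sq[OF \<open>1 \<le> i\<close>] by simp
    next
      fix r u
      show "(c1 - 3 * c3) * (\<Sum>i\<in>levels_upto r. 2 powr (- 2 * \<alpha> * real (level i)) * (u i)\<^sup>2)
        \<le> expectation (\<lambda>w. (\<Sum>i\<in>levels_upto r. u i * Z i w)\<^sup>2)"
        unfolding sm a using bform_lower_bound_nearly_diagonal[where u = u and r = r] A c by auto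
    qed (use c in auto)
    then show ?thesis by blast
  qed
qed

section \<open>The square norm of Faber--Schauder sums\<close>

lemma L2T_measurable: "b \<in> L2T \<Longrightarrow> b \<in> borel_measurable borel"
  and L2T_integrable: "b \<in> L2T \<Longrightarrow> set_integrable lborel {0..1} (\<lambda>x. (b x)\<^sup>2)"
  and L2T_periodic: "b \<in> L2T \<Longrightarrow> b (x + 1) = b x"
  by (auto simp: L2T_def)

lemma continuous_periodic_in_L2T:
  assumes "continuous_on UNIV b" "\<And>x. b (x + 1) = b x"
  shows "b \<in> L2T"
proof -
  have "set_integrable lborel {0..1} (\<lambda>x. (b x)\<^sup>2)"
    using assms by (intro borel_integrable_atLeastAtMost') (auto intro!: continuous_intros intro: continuous_on_subset)
  then show ?thesis using assms by (auto simp: L2T_def intro: borel_measurable_continuous_onI)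
qed

lemma schauder_sum_in_L2T: "schauder_sum r c \<in> L2T"
  by (intro continuous_periodic_in_L2T continuous_on_schauder_sum schauder_sum_periodic)

lemma norm2_nonneg: "0 \<le> norm2 b"
  unfolding norm2_def set_lebesgue_integral_def by (intro real_sqrt_ge_zero integral_nonneg_AE) auto

lemma norm2_squared: "(norm2 b)\<^sup>2 = (LINT x:{0..1}|lborel. (b x)\<^sup>2)"
  unfolding norm2_def set_lebesgue_integral_def
  by (subst real_sqrt_pow2) (auto intro!: integral_nonneg_AE)

lemma norm2_uminus: "norm2 (\<lambda>x. f x - g x) = norm2 (\<lambda>x. g x - f x)"
  by (simp add: norm2_def power2_commute)

lemma sum_squared_le: "(a + b)\<^sup>2 \<le> 2 * a\<^sup>2 + 2 * (b\<^sup>2 :: real)"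
  using sum_squares_bound[of a b] by (simp add: power2_sum)

lemma L2T_add:
  assumes f: "f \<in> L2T" and g: "g \<in> L2T"
  shows "(\<lambda>x. f x + g x) \<in> L2T"
proof -
  note [measurable] = L2T_measurable[OF f] L2T_measurable[OF g]
  have "set_integrable lborel {0..1} (\<lambda>x. 2 * (f x)\<^sup>2 + 2 * (g x)\<^sup>2)"
    using L2T_integrable[OF f] L2T_integrable[OF g] by (intro set_integral_add) auto
  then have "set_integrable lborel {0..1} (\<lambda>x. (f x + g x)\<^sup>2)"
    by (rule set_integrable_bound) (auto simp: set_borel_measurable_def sum_squared_le)
  then show ?thesis using L2T_periodic[OF f] L2T_periodic[OF g] by (auto simp: L2T_def)
qed

lemma L2T_diff:
  assumes f: "f \<in> L2T" and g: "g \<in> L2T"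
  shows "(\<lambda>x. f x - g x) \<in> L2T"
proof -
  have "(\<lambda>x. - g x) \<in> L2T" using g by (auto simp: L2T_def)
  from L2T_add[OF f this] show ?thesis by simp
qed

lemma norm2_add_squared_le:
  assumes f: "f \<in> L2T" and g: "g \<in> L2T"
  shows "(norm2 (\<lambda>x. f x + g x))\<^sup>2 \<le> 2 * (norm2 f)\<^sup>2 + 2 * (norm2 g)\<^sup>2"
proof -
  have "(norm2 (\<lambda>x. f x + g x))\<^sup>2 \<le> (LINT x:{0..1}|lborel. 2 * (f x)\<^sup>2 + 2 * (g x)\<^sup>2)"
    unfolding norm2_squared using L2T_integrable[OF f] L2T_integrable[OF g] L2T_integrable[OF L2T_add[OF f g]]
    by (intro set_integral_mono set_integral_add(1)) (auto simp: sum_squared_le)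
  also have "\<dots> = 2 * (norm2 f)\<^sup>2 + 2 * (norm2 g)\<^sup>2"
    unfolding norm2_squared using L2T_integrable[OF f] L2T_integrable[OF g]
    by (subst set_integral_add(2)) auto
  finally show ?thesis .
qed

lemma norm2_triangle_squared:
  assumes f: "f \<in> L2T" and g: "g \<in> L2T" and h: "h \<in> L2T"
  shows "(norm2 (\<lambda>x. f x - h x))\<^sup>2 \<le> 2 * (norm2 (\<lambda>x. f x - g x))\<^sup>2 + 2 * (norm2 (\<lambda>x. g x - h x))\<^sup>2"
  using norm2_add_squared_le[OF L2T_diff[OF f g] L2T_diff[OF g h]] by simp

lemma norm2_le_bound:
  assumes f: "f \<in> L2T" and K: "\<And>x. \<bar>f x\<bar> \<le> K"
  shows "norm2 f \<le> K"
proof -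
  have K0: "0 \<le> K" using K[of 0] by linarith
  have "(norm2 f)\<^sup>2 \<le> (LINT x:{0..1::real}|lborel. K\<^sup>2)"
    unfolding norm2_squared
  proof (intro set_integral_mono)
    show "set_integrable lborel {0..1} (\<lambda>x. (f x)\<^sup>2)" by (rule L2T_integrable[OF f])
    show "set_integrable lborel {0..1} (\<lambda>x::real. K\<^sup>2)" by (simp add: set_integrable_def)
    show "(f x)\<^sup>2 \<le> K\<^sup>2" for x using K[of x] by (metis abs_ge_zero power2_abs power_mono)
  qed
  also have "\<dots> = K\<^sup>2" by (simp add: set_lebesgue_integral_def)
  finally show ?thesis using K0 by (rule power2_le_imp_le)
qed

lemma AE_eq_0_if_norm2_eq_0:
  assumes f: "f \<in> L2T" and 0: "norm2 f = 0"
  shows "AE x in lborel. f x = 0"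
proof -
  note [measurable] = L2T_measurable[OF f]
  have "(LINT x|lborel. indicator {0..1} x *\<^sub>R (f x)\<^sup>2) = 0"
    using norm2_squared[of f] 0 by (simp add: set_lebesgue_integral_def)
  then have "AE x in lborel. indicator {0..1} x *\<^sub>R (f x)\<^sup>2 = 0"
    by (subst (asm) integral_nonneg_eq_0_iff_AE)
      (use L2T_integrable[OF f] in \<open>auto simp: set_integrable_def\<close>)
  then have base: "AE x in lborel. x \<in> {0..1} \<longrightarrow> f x = 0" by eventually_elim auto
  interpret periodic_fun_simple' f
    by standard (rule L2T_periodic[OF f])
  have "AE x in lborel. - real_of_int n + 1 * x \<in> {0..1} \<longrightarrow> f (- real_of_int n + 1 * x) = 0" for n
    by (rule AE_borel_affine[OF _ _ base]) auto
  then have "AE x in lborel. \<forall>n::int. - real_of_int n + 1 * x \<in> {0..1} \<longrightarrow> f (- real_of_int n + 1 * x) = 0"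
    by (simp add: AE_all_countable)
  then show ?thesis
  proof eventually_elim
    case (elim x)
    have "- real_of_int \<lfloor>x\<rfloor> + 1 * x \<in> {0..1}" by auto linarith+
    then have "f (- real_of_int \<lfloor>x\<rfloor> + 1 * x) = 0" using elim by blast
    moreover have "- real_of_int \<lfloor>x\<rfloor> + 1 * x = x - real_of_int \<lfloor>x\<rfloor>" by simp
    ultimately show ?case using minus_of_int[of x "\<lfloor>x\<rfloor>"] by metis
  qed
qed


lemma hat_affine: "\<exists>p s. \<forall>y\<in>{real_of_int q / 2..real_of_int q / 2 + 1/2}. hat y = p + s * y"
proof -
  consider "q < 0" | "q = 0" | "q = 1" | "q \<ge> 2" by linarith
  then show ?thesis
  proof cases
    case 1
    then have "real_of_int q \<le> -1" by linarith
    then show ?thesis by (intro exI[of _ 0]) (auto simp: hat_eq max_def abs_if)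
  next
    case 2
    then show ?thesis by (intro exI[of _ 0] exI[of _ 2]) (auto simp: hat_eq max_def abs_if)
  next
    case 3
    then show ?thesis by (intro exI[of _ 2] exI[of _ "-2"]) (auto simp: hat_eq max_def abs_if)
  next
    case 4
    then have "real_of_int q \<ge> 2" by linarith
    then show ?thesis by (intro exI[of _ 0]) (auto simp: hat_eq max_def abs_if)
  qed
qed

lemma schauder_affine:
  assumes i: "i \<in> levels_upto r" and m: "m < 2 ^ (r + 1)"
  shows "\<exists>p s. \<forall>x\<in>{real m / 2 ^ (r + 1)..<(real m + 1) / 2 ^ (r + 1)}. schauder i x = p + s * x"
proof -
  have m1: "real m + 1 \<le> 2 ^ (r + 1)"
    using m by (metis Suc_leI of_nat_Suc of_nat_le_iff of_nat_numeral of_nat_power add.commute)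
  have x01: "0 \<le> x" "x < 1" if "x \<in> {real m / 2 ^ (r + 1)..<(real m + 1) / 2 ^ (r + 1)}" for x
  proof -
    have "0 \<le> real m / 2 ^ (r + 1)" by simp
    then show "0 \<le> x" using that by (meson atLeastLessThan_iff order_trans)
    have "(real m + 1) / 2 ^ (r + 1) \<le> 1" using m1 by simp
    then show "x < 1" using that by (meson atLeastLessThan_iff less_le_trans)
  qed
  show ?thesis using i
  proof (cases rule: levels_upto_cases)
    case 1
    show ?thesis
    proof (cases "m < 2 ^ r")
      case True
      then have "real m + 1 \<le> 2 ^ r"
        by (metis Suc_leI of_nat_Suc of_nat_le_iff of_nat_numeral of_nat_power add.commute)
      then have "(real m + 1) / 2 ^ (r + 1) \<le> 1/2" by (simp add: field_simps)
      then have "schauder i x = 1 + (-2) * x" if "x \<in> {real m / 2 ^ (r + 1)..<(real m + 1) / 2 ^ (r + 1)}" for x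
      proof -
        have "x < 1/2" using that \<open>(real m + 1) / 2 ^ (r + 1) \<le> 1/2\<close> by (meson atLeastLessThan_iff less_le_trans)
        then show ?thesis using x01[OF that] unfolding 1 schauder_1 by (simp add: frac_eq[THEN iffD2])
      qed
      then show ?thesis by blast
    next
      case False
      then have "2 ^ r \<le> real m" by (metis of_nat_le_iff of_nat_numeral of_nat_power not_less)
      then have "1/2 \<le> real m / 2 ^ (r + 1)" by (simp add: field_simps)
      then have "schauder i x = -1 + 2 * x" if "x \<in> {real m / 2 ^ (r + 1)..<(real m + 1) / 2 ^ (r + 1)}" for x
      proof -
        have "1/2 \<le> x" using that \<open>1/2 \<le> real m / 2 ^ (r + 1)\<close> by (meson atLeastLessThan_iff order_trans)
        then show ?thesis using x01[OF that] unfolding 1 schauder_1 by (simp add: frac_eq[THEN iffD2])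
      qed
      then show ?thesis by blast
    qed
  next
    case (2 j k)
    define q where "q = m div 2 ^ (r - j)"
    have "2 ^ (r - j) * q \<le> m" by (simp add: q_def)
    then have q1: "2 ^ (r - j) * real q \<le> real m"
      by (metis of_nat_le_iff of_nat_mult of_nat_numeral of_nat_power)
    have "m < 2 ^ (r - j) * (q + 1)" unfolding q_def by (simp add: dividend_less_times_div)
    then have "m + 1 \<le> 2 ^ (r - j) * (q + 1)" by simp
    then have "real (m + 1) \<le> real (2 ^ (r - j) * (q + 1))" by (simp only: of_nat_le_iff)
    then have q2: "real m + 1 \<le> 2 ^ (r - j) * (real q + 1)" by (simp add: algebra_simps)
    obtain p s where ps: "\<And>y. y \<in> {real_of_int (int q - 2 * int k + 2) / 2..real_of_int (int q - 2 * int k + 2) / 2 + 1/2} \<Longrightarrow> hat y = p + s * y"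
      using hat_affine[of "int q - 2 * int k + 2"] by blast
    have pw: "(2::real) ^ (r + 1) = 2 ^ (j + 1) * 2 ^ (r - j)" using 2(1) by (simp flip: power_add)
    have "schauder i x = (p + s * (1 - real k)) + (s * 2 ^ j) * x"
      if x: "x \<in> {real m / 2 ^ (r + 1)..<(real m + 1) / 2 ^ (r + 1)}" for x
    proof -
      have "real m \<le> 2 ^ (r - j) * (2 ^ (j + 1) * x)" "2 ^ (r - j) * (2 ^ (j + 1) * x) \<le> real m + 1"
        using x unfolding pw by (auto simp: field_simps)
      with q1 q2 have "2 ^ (r - j) * real q \<le> 2 ^ (r - j) * (2 ^ (j + 1) * x)"
        "2 ^ (r - j) * (2 ^ (j + 1) * x) \<le> 2 ^ (r - j) * (real q + 1)" by linarith+
      then have "real q \<le> 2 ^ (j + 1) * x" "2 ^ (j + 1) * x \<le> real q + 1" by simp_all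
      then have "hat (2 ^ j * x - real k + 1) = p + s * (2 ^ j * x - real k + 1)"
        by (intro ps) (auto simp: field_simps)
      moreover have "schauder i x = hat (2 ^ j * x - real k + 1)"
        unfolding 2(4) schauder_double_index_frac[OF 2(2,3)] using x01[OF x] by (simp add: frac_eq)
      ultimately show ?thesis by (simp add: algebra_simps)
    qed
    then show ?thesis by blast
  qed
qed

lemma schauder_sum_affine:
  assumes m: "m < 2 ^ (r + 1)"
  obtains p s where "\<And>x. x \<in> {real m / 2 ^ (r + 1)..<(real m + 1) / 2 ^ (r + 1)} \<Longrightarrow> schauder_sum r c x = p + s * x"
proof -
  have "\<forall>i\<in>levels_upto r. \<exists>ps. \<forall>x\<in>{real m / 2 ^ (r + 1)..<(real m + 1) / 2 ^ (r + 1)}. schauder i x = fst ps + snd ps * x"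
    using schauder_affine[OF _ m] by (metis fst_conv snd_conv)
  then obtain ps where ps: "\<And>i x. i \<in> levels_upto r \<Longrightarrow> x \<in> {real m / 2 ^ (r + 1)..<(real m + 1) / 2 ^ (r + 1)} \<Longrightarrow> schauder i x = fst (ps i) + snd (ps i) * x"
    by (metis bchoice)
  show ?thesis
  proof (rule that)
    fix x assume x: "x \<in> {real m / 2 ^ (r + 1)..<(real m + 1) / 2 ^ (r + 1)}"
    have "schauder_sum r c x = (\<Sum>i\<in>levels_upto r. c i * (fst (ps i) + snd (ps i) * x))"
      unfolding schauder_sum_def by (intro sum.cong refl) (simp add: ps[OF _ x])
    then show "schauder_sum r c x = (\<Sum>i\<in>levels_upto r. c i * fst (ps i)) + (\<Sum>i\<in>levels_upto r. c i * snd (ps i)) * x"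
      by (simp add: sum_distrib_right sum.distrib distrib_left mult.assoc)
  qed
qed

text \<open>With the values \<open>A\<close> and \<open>A + D\<close> of the affine function at the end points, the integral is
  \<open>h * (A\<^sup>2 + A * D + D\<^sup>2 / 3)\<close>, and completing the square in \<open>D\<close> leaves \<open>h * A\<^sup>2 / 4\<close>.\<close>

lemma integral_affine_squared_ge:
  fixes a h p s :: real
  assumes h: "0 \<le> h"
  shows "h * (p + s * a)\<^sup>2 / 4 \<le> (LINT x|lborel. indicator {a..a + h} x *\<^sub>R (p + s * x)\<^sup>2)"
proof -
  define F where "F x = p\<^sup>2 * x + p * s * x\<^sup>2 + s\<^sup>2 * x ^ 3 / 3" for x
  have "(LINT x|lborel. indicator {a..a + h} x *\<^sub>R (p + s * x)\<^sup>2) = (LINT x|lborel. (p + s * x)\<^sup>2 * indicator {a..a + h} x)"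
    by (simp add: mult.commute)
  also have "\<dots> = F (a + h) - F a"
  proof (rule integral_FTC_Icc_real)
    fix x :: real
    show "(F has_real_derivative (p + s * x)\<^sup>2) (at x)"
      unfolding F_def by (auto intro!: derivative_eq_intros simp: power2_eq_square algebra_simps)
  qed (use h in \<open>auto intro!: continuous_intros\<close>)
  also have "\<dots> = h * ((p + s * a)\<^sup>2 + (p + s * a) * (s * h) + (s * h)\<^sup>2 / 3)"
    by (simp add: F_def power2_eq_square power3_eq_cube field_simps)
  also have "\<dots> = h * ((p + s * a)\<^sup>2 / 4 + (3 * (p + s * a) + 2 * (s * h))\<^sup>2 / 12)"
    by (simp add: power2_eq_square field_simps)
  also have "\<dots> \<ge> h * ((p + s * a)\<^sup>2 / 4)" using h by (intro mult_left_mono) auto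
  finally show ?thesis by simp
qed

text \<open>A sum up to level \<open>r\<close> is affine on each cell of length \<open>1 / 2 ^ (r + 1)\<close>, and one such cell already
  contributes a fixed fraction of the squared value at its left end point.\<close>

lemma schauder_sum_node_le_norm2:
  assumes m: "m < 2 ^ (r + 1)"
  shows "\<bar>schauder_sum r c (real m / 2 ^ (r + 1))\<bar> \<le> 2 * sqrt (2 ^ (r + 1)) * norm2 (schauder_sum r c)"
proof -
  define v where "v = schauder_sum r c"
  define h where "h = 1 / (2::real) ^ (r + 1)"
  define a where "a = real m * h"
  have h0: "0 < h" by (simp add: h_def)
  have eq: "real m / 2 ^ (r + 1) = a" "(real m + 1) / 2 ^ (r + 1) = a + h" by (simp_all add: a_def h_def add_divide_distrib)
  have m1: "real m + 1 \<le> 2 ^ (r + 1)"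
    using m by (metis Suc_leI of_nat_Suc of_nat_le_iff of_nat_numeral of_nat_power add.commute)
  have ah: "0 \<le> a" "a + h \<le> 1" unfolding eq(2)[symmetric] using m1 h0 by (auto simp: a_def)
  obtain p s where ps: "\<And>x. x \<in> {a..<a + h} \<Longrightarrow> v x = p + s * x"
    using schauder_sum_affine[OF m, of c] unfolding eq v_def by blast
  have "h * (v a)\<^sup>2 / 4 \<le> (LINT x|lborel. indicator {a..a + h} x *\<^sub>R (p + s * x)\<^sup>2)"
    using integral_affine_squared_ge[of h p s a] h0 ps[of a] by simp
  also have "\<dots> \<le> (LINT x|lborel. indicator {0..1} x *\<^sub>R (v x)\<^sup>2)"
  proof (rule integral_mono_AE)
    show "integrable lborel (\<lambda>x. indicator {a..a + h} x *\<^sub>R (p + s * x)\<^sup>2)"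
      unfolding set_integrable_def[symmetric] by (intro borel_integrable_atLeastAtMost' continuous_intros)
    show "integrable lborel (\<lambda>x. indicator {0..1} x *\<^sub>R (v x)\<^sup>2)"
      using L2T_integrable[OF schauder_sum_in_L2T] unfolding v_def set_integrable_def .
    show "AE x in lborel. indicator {a..a + h} x *\<^sub>R (p + s * x)\<^sup>2 \<le> indicator {0..1} x *\<^sub>R (v x)\<^sup>2"
      using AE_lborel_singleton[of "a + h"]
    proof eventually_elim
      case (elim x)
      then show ?case using ps[of x] ah by (auto simp: indicator_def)
    qed
  qed
  also have "\<dots> = (norm2 v)\<^sup>2" by (simp add: norm2_squared set_lebesgue_integral_def)
  finally have "(v a)\<^sup>2 \<le> 4 * 2 ^ (r + 1) * (norm2 v)\<^sup>2" by (simp add: h_def field_simps)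
  also have "\<dots> = (2 * sqrt (2 ^ (r + 1)) * norm2 v)\<^sup>2" by (simp add: power_mult_distrib)
  finally show ?thesis unfolding eq v_def[symmetric]
    by (intro abs_le_square_iff[THEN iffD2, of "v a" "2 * sqrt (2 ^ (r + 1)) * norm2 v", THEN order_trans])
      (auto simp: norm2_nonneg abs_mult)
qed

text \<open>The equivalence of norms on the finite dimensional span, with a constant whose logarithm is
  linear in \<open>r\<close>.\<close>

lemma coeff_le_norm2:
  assumes "i \<in> levels_upto r"
  shows "\<bar>c i\<bar> \<le> 12 * 4 ^ r * norm2 (schauder_sum r c)"
proof -
  have "\<bar>c i\<bar> \<le> 3 * 2 ^ r * (2 * sqrt (2 ^ (r + 1)) * norm2 (schauder_sum r c))"
    by (rule coeff_le_of_nodes[OF schauder_sum_node_le_norm2 assms])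
  also have "sqrt (2 ^ (r + 1)) \<le> 2 ^ (r + 1)"
  proof -
    have "(1::real) \<le> 2 ^ (r + 1)" by (rule one_le_power) simp
    then have "sqrt (2 ^ (r + 1)) \<le> sqrt ((2 ^ (r + 1))\<^sup>2)" by (intro real_sqrt_le_mono self_le_power) auto
    then show ?thesis by (simp only: real_sqrt_abs) simp
  qed
  then have "3 * 2 ^ r * (2 * sqrt (2 ^ (r + 1)) * norm2 (schauder_sum r c)) \<le>
     3 * 2 ^ r * (2 * 2 ^ (r + 1) * norm2 (schauder_sum r c))"
    by (intro mult_left_mono mult_right_mono) (auto simp: norm2_nonneg)
  also have "\<dots> = 12 * 4 ^ r * norm2 (schauder_sum r c)"
    by (simp add: power_mult_distrib[symmetric])
  finally show ?thesis .
qed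

section \<open>The sieve and its entropy\<close>

text \<open>The span is taken in \<open>L\<^sup>2\<close>: a set of the Borel sigma-algebra of a seminorm is closed under changes at
  distance zero.\<close>

definition schauder_space :: "nat \<Rightarrow> (real \<Rightarrow> real) set" where
  "schauder_space r = {b\<in>L2T. \<exists>c. norm2 (\<lambda>x. b x - schauder_sum r c x) = 0}"

text \<open>Finite dimensional subspaces are closed: by \<open>coeff_le_norm2\<close> the coefficients of an approximating
  sequence are Cauchy, and convergence of coefficients implies uniform convergence.\<close>

lemma schauder_space_closed:
  assumes b: "b \<in> L2T" and approx: "\<And>\<eta>. 0 < \<eta> \<Longrightarrow> \<exists>c. (norm2 (\<lambda>x. b x - schauder_sum r c x))\<^sup>2 < \<eta>"
  shows "b \<in> schauder_space r"
proof -
  define D where "D c = (norm2 (\<lambda>x. b x - schauder_sum r c x))\<^sup>2" for c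
  have "\<exists>c. D c < inverse (real (Suc k))" for k using approx[of "inverse (real (Suc k))"] by (simp add: D_def)
  then obtain c where c: "\<And>k. D (c k) < inverse (real (Suc k))" by metis
  have pair: "(norm2 (schauder_sum r (\<lambda>i. c k i - c l i)))\<^sup>2 \<le> 2 * D (c k) + 2 * D (c l)" for k l
  proof -
    have "(norm2 (\<lambda>x. schauder_sum r (c k) x - schauder_sum r (c l) x))\<^sup>2 \<le>
       2 * (norm2 (\<lambda>x. schauder_sum r (c k) x - b x))\<^sup>2 + 2 * D (c l)"
      unfolding D_def by (intro norm2_triangle_squared schauder_sum_in_L2T b)
    then show ?thesis unfolding D_def schauder_sum_diff norm2_uminus[of "schauder_sum r (c k)" b] .
  qed
  define K where "K = 12 * (4::real) ^ r"
  have K: "K > 0" by (simp add: K_def)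
  have coord: "(c k i - c l i)\<^sup>2 \<le> K\<^sup>2 * (2 * D (c k) + 2 * D (c l))" if "i \<in> levels_upto r" for i k l
  proof -
    have "\<bar>c k i - c l i\<bar>\<^sup>2 \<le> (K * norm2 (schauder_sum r (\<lambda>i. c k i - c l i)))\<^sup>2"
      unfolding K_def using coeff_le_norm2[OF that, of "\<lambda>i. c k i - c l i"] by (intro power_mono) auto
    also have "\<dots> \<le> K\<^sup>2 * (2 * D (c k) + 2 * D (c l))"
      unfolding power_mult_distrib by (intro mult_left_mono pair) auto
    finally show ?thesis by simp
  qed
  have D0: "(\<lambda>k. D (c k)) \<longlonglongrightarrow> 0"
  proof (rule real_tendsto_sandwich[OF _ _ tendsto_const LIMSEQ_inverse_real_of_nat])
    show "\<forall>\<^sub>F k in sequentially. 0 \<le> D (c k)" by (simp add: D_def)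
    show "\<forall>\<^sub>F k in sequentially. D (c k) \<le> inverse (real (Suc k))"
      by (intro always_eventually allI less_imp_le c)
  qed
  have "convergent (\<lambda>k. c k i)" if i: "i \<in> levels_upto r" for i
  proof (rule Cauchy_convergent, rule metric_CauchyI)
    fix e :: real assume e: "0 < e"
    have "0 < e\<^sup>2 / (4 * K\<^sup>2)" using e K by simp
    then obtain N where N: "\<And>k. k \<ge> N \<Longrightarrow> D (c k) < e\<^sup>2 / (4 * K\<^sup>2)"
      using order_tendstoD(2)[OF D0, of "e\<^sup>2 / (4 * K\<^sup>2)"] by (auto simp: eventually_sequentially)
    show "\<exists>N. \<forall>m\<ge>N. \<forall>n\<ge>N. dist (c m i) (c n i) < e"
    proof (intro exI allI impI)
      fix m n assume "N \<le> m" "N \<le> n"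
      then have "2 * D (c m) + 2 * D (c n) < e\<^sup>2 / K\<^sup>2" using N[of m] N[of n] by (simp add: field_simps)
      then have "K\<^sup>2 * (2 * D (c m) + 2 * D (c n)) < K\<^sup>2 * (e\<^sup>2 / K\<^sup>2)" using K by (intro mult_strict_left_mono) auto
      then have "\<bar>c m i - c n i\<bar>\<^sup>2 < e\<^sup>2" using coord[OF i, of m n] K by simp
      then show "dist (c m i) (c n i) < e" unfolding dist_real_def
        using e power2_less_imp_less[of "\<bar>c m i - c n i\<bar>" e] by simp
    qed
  qed
  then obtain c' where c': "\<And>i. i \<in> levels_upto r \<Longrightarrow> (\<lambda>k. c k i) \<longlonglongrightarrow> c' i"
    unfolding convergent_def by metis
  define s where "s k = (\<Sum>i\<in>levels_upto r. \<bar>c k i - c' i\<bar>)" for k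
  have s: "s \<longlonglongrightarrow> 0"
  proof -
    have "(\<lambda>k. \<Sum>i\<in>levels_upto r. \<bar>c k i - c' i\<bar>) \<longlonglongrightarrow> (\<Sum>i\<in>levels_upto r. \<bar>c' i - c' i\<bar>)"
      by (intro tendsto_intros c')
    then show ?thesis by (simp add: s_def[abs_def])
  qed
  have "D c' \<le> 2 * D (c k) + 2 * ((real r + 2) * s k)\<^sup>2" for k
  proof -
    have "norm2 (\<lambda>x. schauder_sum r (c k) x - schauder_sum r c' x) \<le> (real r + 2) * s k"
    proof (rule norm2_le_bound)
      show "(\<lambda>x. schauder_sum r (c k) x - schauder_sum r c' x) \<in> L2T"
        by (intro L2T_diff schauder_sum_in_L2T)
      fix x
      show "\<bar>schauder_sum r (c k) x - schauder_sum r c' x\<bar> \<le> (real r + 2) * s k"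
        unfolding schauder_sum_diff
        by (rule abs_schauder_sum_le) (auto simp: s_def intro!: member_le_sum sum_nonneg)
    qed
    then have "(norm2 (\<lambda>x. schauder_sum r (c k) x - schauder_sum r c' x))\<^sup>2 \<le> ((real r + 2) * s k)\<^sup>2"
      by (intro power_mono norm2_nonneg)
    moreover have "D c' \<le> 2 * D (c k) + 2 * (norm2 (\<lambda>x. schauder_sum r (c k) x - schauder_sum r c' x))\<^sup>2"
      unfolding D_def by (intro norm2_triangle_squared schauder_sum_in_L2T b)
    ultimately show ?thesis by linarith
  qed
  moreover have "(\<lambda>k. 2 * D (c k) + 2 * ((real r + 2) * s k)\<^sup>2) \<longlonglongrightarrow> 2 * 0 + 2 * ((real r + 2) * 0)\<^sup>2"
    by (intro tendsto_intros D0 s)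
  ultimately have "D c' \<le> 2 * 0 + 2 * ((real r + 2) * 0)\<^sup>2"
    by (intro LIMSEQ_le_const) auto
  then have "norm2 (\<lambda>x. b x - schauder_sum r c' x) = 0" by (simp add: D_def)
  then show ?thesis using b by (auto simp: schauder_space_def)
qed

lemma schauder_space_measurable: "schauder_space r \<in> sets L2T_borel"
proof -
  have sub: "{U. U \<subseteq> L2T \<and> (\<forall>b\<in>U. \<exists>e>0. \<forall>b'\<in>L2T. norm2 (\<lambda>x. b' x - b x) < e \<longrightarrow> b' \<in> U)} \<subseteq> Pow L2T"
    by auto
  have "L2T - schauder_space r \<in> {U. U \<subseteq> L2T \<and>
         (\<forall>b\<in>U. \<exists>e>0. \<forall>b'\<in>L2T. norm2 (\<lambda>x. b' x - b x) < e \<longrightarrow> b' \<in> U)}"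
  proof safe
    fix b assume b: "b \<in> L2T" "b \<notin> schauder_space r"
    show "\<exists>e>0. \<forall>b'\<in>L2T. norm2 (\<lambda>x. b' x - b x) < e \<longrightarrow> b' \<in> L2T - schauder_space r"
    proof (rule ccontr)
      assume "\<not> ?thesis"
      then have near: "\<exists>b'\<in>schauder_space r. norm2 (\<lambda>x. b' x - b x) < e" if "e > 0" for e
        using that by blast
      have "b \<in> schauder_space r"
      proof (rule schauder_space_closed[OF b(1)])
        fix \<eta> :: real assume \<eta>: "0 < \<eta>"
        obtain b' where b': "b' \<in> schauder_space r" "norm2 (\<lambda>x. b' x - b x) < sqrt (\<eta> / 2)"
          using near[of "sqrt (\<eta> / 2)"] \<eta> by auto
        then obtain c where c: "norm2 (\<lambda>x. b' x - schauder_sum r c x) = 0" and b'L: "b' \<in> L2T"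
          by (auto simp: schauder_space_def)
        have "(norm2 (\<lambda>x. b x - schauder_sum r c x))\<^sup>2 \<le> 2 * (norm2 (\<lambda>x. b x - b' x))\<^sup>2 + 2 * 0\<^sup>2"
          using norm2_triangle_squared[OF b(1) b'L schauder_sum_in_L2T, of r c] unfolding c .
        also have "(norm2 (\<lambda>x. b x - b' x))\<^sup>2 < (sqrt (\<eta> / 2))\<^sup>2"
          using b'(2) unfolding norm2_uminus[of b'] by (intro power_strict_mono norm2_nonneg) auto
        finally show "\<exists>c. (norm2 (\<lambda>x. b x - schauder_sum r c x))\<^sup>2 < \<eta>" using \<eta> by auto
      qed
      with b show False by simp
    qed
  qed
  then have "L2T - (L2T - schauder_space r) \<in> sets L2T_borel"
    unfolding L2T_borel_def sets_measure_of[OF sub] by (intro sigma_sets.Compl sigma_sets.Basic)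
  also have "L2T - (L2T - schauder_space r) = schauder_space r" by (auto simp: schauder_space_def)
  finally show ?thesis .
qed

lemma schauder_sum_in_schauder_space: "schauder_sum r c \<in> schauder_space r"
  unfolding schauder_space_def using schauder_sum_in_L2T
  by (auto simp: norm2_def set_lebesgue_integral_def intro!: exI[of _ c])

lemma schauder_sum_mono_level:
  assumes "r \<le> r'"
  shows "\<exists>c'. schauder_sum r c = schauder_sum r' c'"
proof (intro exI ext)
  fix x
  have "levels_upto r \<subseteq> levels_upto r'" using assms by (auto simp: levels_upto_def)
  then   show "schauder_sum r c x = schauder_sum r' (\<lambda>i. if i \<in> levels_upto r then c i else 0) x"
    unfolding schauder_sum_def by (intro sum.mono_neutral_cong_left) auto
qed

text \<open>In the ball around \<open>b0\<close> the \<open>L\<^sup>2\<close> norm is at most \<open>2 + 2 * norm2 b0\<close>, which bounds the coefficients.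
  The centres of the covering have coefficients in \<open>\<theta>\<close> times the integers; rounding moves the sum by
  at most \<open>(r + 2) * \<theta>\<close> in sup-norm, one \<open>\<theta>\<close> for each block and for the index 1.\<close>

lemma covering_number_schauder_space:
  assumes b0: "b0 \<in> L2T" and \<epsilon>: "\<epsilon> \<le> 1" and \<theta>: "0 < \<theta>" and \<delta>: "(real r + 2) * \<theta> < \<delta>"
  shows "\<exists>N. covering_number L2T (\<lambda>b b'. L2T_sup_norm (\<lambda>x. b x - b' x)) (ereal \<delta>)
      {b\<in>schauder_space r. norm2 (\<lambda>x. b x - b0 x) \<le> \<epsilon>} \<le> enat N \<and>
    real N \<le> (2 * (12 * 4 ^ r * (2 + 2 * norm2 b0)) / \<theta> + 3) ^ 2 ^ (r + 1)"
proof -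
  define K where "K = 12 * 4 ^ r * (2 + 2 * norm2 b0)"
  have K0: "0 \<le> K" by (simp add: K_def norm2_nonneg)
  define g where "g = \<lceil>K / \<theta>\<rceil>"
  have g0: "0 \<le> g" proof -
    have "0 \<le> K / \<theta>" using K0 \<theta> by simp
    then show ?thesis unfolding g_def by linarith
  qed
  define P where "P = PiE (levels_upto r) (\<lambda>_. {-g..g})"
  define F where "F = (\<lambda>k. schauder_sum r (\<lambda>i. \<theta> * real_of_int (k i))) ` P"
  have cardP: "card P = nat (2 * g + 1) ^ 2 ^ (r + 1)"
    unfolding P_def by (simp add: card_PiE card_levels_upto)
  have finP: "finite P" unfolding P_def by (intro finite_PiE) auto
  have cover: "\<exists>c\<in>F. L2T_sup_norm (\<lambda>x. c x - b x) < ereal \<delta>"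
    if b: "b \<in> schauder_space r" "norm2 (\<lambda>x. b x - b0 x) \<le> \<epsilon>" for b
  proof -
    from b obtain c where bL: "b \<in> L2T" and c: "norm2 (\<lambda>x. b x - schauder_sum r c x) = 0"
      by (auto simp: schauder_space_def)
    have "(norm2 (schauder_sum r c))\<^sup>2 \<le> (2 + 2 * norm2 b0)\<^sup>2"
    proof -
      have "(norm2 (\<lambda>x. (schauder_sum r c x - b x) + b x))\<^sup>2 \<le> 2 * (norm2 (\<lambda>x. schauder_sum r c x - b x))\<^sup>2 + 2 * (norm2 b)\<^sup>2"
        by (intro norm2_add_squared_le L2T_diff schauder_sum_in_L2T bL)
      then have 1: "(norm2 (schauder_sum r c))\<^sup>2 \<le> 2 * (norm2 b)\<^sup>2"
        using c norm2_uminus[of b] by simp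
      have "(norm2 (\<lambda>x. (b x - b0 x) + b0 x))\<^sup>2 \<le> 2 * (norm2 (\<lambda>x. b x - b0 x))\<^sup>2 + 2 * (norm2 b0)\<^sup>2"
        by (intro norm2_add_squared_le L2T_diff b0 bL)
      moreover have "(norm2 (\<lambda>x. b x - b0 x))\<^sup>2 \<le> 1\<^sup>2"
        using b \<epsilon> by (intro power_mono norm2_nonneg) auto
      ultimately have "(norm2 b)\<^sup>2 \<le> 2 + 2 * (norm2 b0)\<^sup>2" by simp
      then have "(norm2 (schauder_sum r c))\<^sup>2 \<le> 4 + 4 * (norm2 b0)\<^sup>2" using 1 by simp
      also have "\<dots> \<le> (2 + 2 * norm2 b0)\<^sup>2" using norm2_nonneg[of b0] by (simp add: power2_sum power_mult_distrib)
      finally show ?thesis .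
    qed
    then have nb: "norm2 (schauder_sum r c) \<le> 2 + 2 * norm2 b0"
      by (rule power2_le_imp_le) (simp add: norm2_nonneg)
    have cK: "\<bar>c i\<bar> \<le> K" if "i \<in> levels_upto r" for i
    proof -
      note coeff_le_norm2[OF that, of c]
      also have "12 * 4 ^ r * norm2 (schauder_sum r c) \<le> K"
        unfolding K_def by (intro mult_left_mono nb) auto
      finally show ?thesis .
    qed
    define k where "k = (\<lambda>i\<in>levels_upto r. \<lfloor>c i / \<theta>\<rfloor>)"
    have kP: "k \<in> P"
      unfolding P_def
    proof (rule PiE_I)
      fix i assume i: "i \<in> levels_upto r"
      have "c i / \<theta> \<le> K / \<theta>" "- (K / \<theta>) \<le> c i / \<theta>"
        using cK[OF i] \<theta> by (auto simp: divide_right_mono abs_le_iff field_simps)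
      moreover have "K / \<theta> \<le> real_of_int g" by (simp add: g_def)
      ultimately have "- g \<le> \<lfloor>c i / \<theta>\<rfloor>" "\<lfloor>c i / \<theta>\<rfloor> \<le> g" by linarith+
      then show "k i \<in> {-g..g}" using i by (simp add: k_def)
    qed (simp add: k_def)
    let ?v = "schauder_sum r (\<lambda>i. \<theta> * real_of_int (k i))"
    have close: "\<bar>?v x - schauder_sum r c x\<bar> \<le> (real r + 2) * \<theta>" for x
      unfolding schauder_sum_diff
    proof (rule abs_schauder_sum_le)
      fix i assume i: "i \<in> levels_upto r"
      have "real_of_int (k i) \<le> c i / \<theta>" "c i / \<theta> \<le> real_of_int (k i) + 1" using i by (auto simp: k_def)
      then show "\<bar>\<theta> * real_of_int (k i) - c i\<bar> \<le> \<theta>" using \<theta> by (simp add: field_simps abs_le_iff)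
    qed (use \<theta> in auto)
    have "L2T_sup_norm (\<lambda>x. ?v x - b x) \<le> ereal ((real r + 2) * \<theta>)"
      unfolding L2T_sup_norm_def
    proof (rule esssup_I)
      have "(\<lambda>x. ?v x - b x) \<in> borel_measurable lborel"
        using L2T_measurable[OF L2T_diff[OF schauder_sum_in_L2T bL]] by simp
      then show "(\<lambda>x. ereal \<bar>?v x - b x\<bar>) \<in> borel_measurable lborel" by simp
      have "AE x in lborel. b x - schauder_sum r c x = 0"
        by (rule AE_eq_0_if_norm2_eq_0[OF L2T_diff[OF bL schauder_sum_in_L2T] c])
      then show "AE x in lborel. ereal \<bar>?v x - b x\<bar> \<le> ereal ((real r + 2) * \<theta>)"
      proof eventually_elim
        case (elim x)
        then show ?case using close[of x] by simp
      qed
    qed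
    also have "\<dots> < ereal \<delta>" using \<delta> by simp
    finally show ?thesis using kP unfolding F_def by blast
  qed
  have "covering_number L2T (\<lambda>b b'. L2T_sup_norm (\<lambda>x. b x - b' x)) (ereal \<delta>)
      {b\<in>schauder_space r. norm2 (\<lambda>x. b x - b0 x) \<le> \<epsilon>} \<le> enat (card F)"
    unfolding covering_number_def
  proof (rule Inf_lower, rule CollectI, intro exI[of _ F] conjI refl)
    show "finite F" using finP by (simp add: F_def)
    show "F \<subseteq> L2T" using schauder_sum_in_L2T by (auto simp: F_def)
    show "{b \<in> schauder_space r. norm2 (\<lambda>x. b x - b0 x) \<le> \<epsilon>} \<subseteq> (\<Union>c\<in>F. {x \<in> L2T. L2T_sup_norm (\<lambda>xa. c xa - x xa) < ereal \<delta>})"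
      using cover by (auto simp: schauder_space_def)
  qed
  moreover have "enat (card F) \<le> enat (card P)" unfolding F_def using card_image_le[OF finP] by simp
  moreover have "real (card P) \<le> (2 * K / \<theta> + 3) ^ 2 ^ (r + 1)"
  proof -
    have "real_of_int g \<le> K / \<theta> + 1" unfolding g_def by linarith
    then have "real (nat (2 * g + 1)) \<le> 2 * K / \<theta> + 3" using g0 by simp
    then show ?thesis unfolding cardP of_nat_power by (intro power_mono) auto
  qed
  ultimately show ?thesis unfolding K_def by (meson order_trans)
qed

lemma elog_le:
  assumes "x \<le> ereal y" "0 < y"
  shows "elog x \<le> ereal (ln y)"
proof (cases "x \<le> 0")
  case False
  then obtain u where "x = ereal u" "0 < u" using assms by (cases x) auto
  then show ?thesis using assms by (simp add: elog_def)
qed (simp add: elog_def)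

lemma elog_ge:
  assumes "0 < y" "y \<le> x"
  shows "ereal (ln y) \<le> elog (ereal x)"
  using assms by (simp add: elog_def)

section \<open>The small ball probability\<close>

lemma random_series_eq: "random_series Z R S w x = schauder_sum (R w) (\<lambda>i. S w * Z i w) x"
  by (simp add: random_series_def schauder_sum_def sum_distrib_left mult.assoc)

lemma schauder_series_continuous:
  assumes z: "\<And>i. 1 \<le> i \<Longrightarrow> \<bar>z i\<bar> \<le> K * 2 powr (- \<beta> * real (level i))" and K: "0 < K" and \<beta>: "0 < \<beta>"
    and sums: "\<And>x. (\<lambda>i. z (i + 1) * schauder (i + 1) x) sums b x"
  shows "continuous_on UNIV b"
proof (rule uniform_limit_theorem)
  show "uniform_limit UNIV (\<lambda>r. schauder_sum r z) b sequentially"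
  proof (rule uniform_limitI)
    fix e :: real assume e: "0 < e"
    have "(\<lambda>r. K / (2 powr \<beta> - 1) * (2 powr (- \<beta>)) ^ r) \<longlonglongrightarrow> K / (2 powr \<beta> - 1) * 0"
      using \<beta> by (intro tendsto_intros LIMSEQ_power_zero) (auto simp: powr_less_one)
    then have "\<forall>\<^sub>F r in sequentially. K / (2 powr \<beta> - 1) * (2 powr (- \<beta>)) ^ r < e"
      using e by (intro order_tendstoD(2)) auto
    then show "\<forall>\<^sub>F r in sequentially. \<forall>x\<in>UNIV. dist (schauder_sum r z x) (b x) < e"
    proof eventually_elim
      case (elim r)
      have "(2 powr (- \<beta>)) ^ r = 2 powr (- \<beta> * real r)" by (simp add: powr_power mult.commute)
      with elim have lt: "K / (2 powr \<beta> - 1) * 2 powr (- \<beta> * real r) < e" by simp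
      have "dist (schauder_sum r z x) (b x) < e" for x
        using le_less_trans[OF schauder_tail[OF z K \<beta> sums] lt] by (simp add: dist_real_def abs_minus_commute)
      then show ?case by blast
    qed
  qed
qed (auto intro!: always_eventually continuous_on_schauder_sum)

lemma sup_norm_eq_SUP_rational:
  assumes "continuous_on UNIV f"
  shows "sup_norm f = (SUP x\<in>\<rat>. ereal \<bar>f x\<bar>)"
proof (rule antisym)
  show "sup_norm f \<le> (SUP x\<in>\<rat>. ereal \<bar>f x\<bar>)"
    unfolding sup_norm_def
  proof (rule SUP_least)
    fix x :: real
    have "closed {x. ereal \<bar>f x\<bar> \<le> (SUP x\<in>\<rat>. ereal \<bar>f x\<bar>)}"
      using assms by (intro closed_Collect_le continuous_intros)
    then have "closure \<rat> \<subseteq> {x. ereal \<bar>f x\<bar> \<le> (SUP x\<in>\<rat>. ereal \<bar>f x\<bar>)}"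
      by (intro closure_minimal) (auto intro: SUP_upper)
    then show "ereal \<bar>f x\<bar> \<le> (SUP x\<in>\<rat>. ereal \<bar>f x\<bar>)" by (auto simp: Rats_closure_real)
  qed
qed (auto simp: sup_norm_def intro: SUP_subset_mono)

text \<open>By continuity the supremum may be taken over the rational numbers.\<close>

lemma (in prob_space) sup_norm_event_measurable:
  assumes Z: "\<And>i. 1 \<le> i \<Longrightarrow> Z i \<in> borel_measurable M" and R: "R \<in> measurable M (count_space UNIV)"
    and S[measurable]: "S \<in> borel_measurable M" and b: "continuous_on UNIV b"
  shows "{w\<in>space M. sup_norm (\<lambda>x. random_series Z R S w x - b x) < e} \<in> sets M"
proof -
  have m: "(\<lambda>w. schauder_sum (R w) (\<lambda>i. S w * Z i w) x) \<in> borel_measurable M" for x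
  proof (rule measurable_compose_countable[OF _ R])
    show "(\<lambda>w. schauder_sum r (\<lambda>i. S w * Z i w) x) \<in> borel_measurable M" for r
      unfolding schauder_sum_def
      by (intro borel_measurable_sum borel_measurable_times S Z) (auto dest: levels_upto_ge_1)
  qed
  have "sup_norm (\<lambda>x. random_series Z R S w x - b x) = (SUP x\<in>\<rat>. ereal \<bar>schauder_sum (R w) (\<lambda>i. S w * Z i w) x - b x\<bar>)" for w
    unfolding random_series_eq
    by (intro sup_norm_eq_SUP_rational continuous_intros continuous_on_schauder_sum b)
  moreover have "(\<lambda>w. SUP x\<in>\<rat>. ereal \<bar>schauder_sum (R w) (\<lambda>i. S w * Z i w) x - b x\<bar>) \<in> borel_measurable M"
    using m by (intro borel_measurable_SUP countable_rat) auto
  ultimately have [measurable]: "(\<lambda>w. sup_norm (\<lambda>x. random_series Z R S w x - b x)) \<in> borel_measurable M"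
    by simp
  show ?thesis by measurable
qed

lemma (in prob_space) indep_vars3_prob:
  assumes ind: "indep_vars3 M N1 X1 N2 X2 N3 X3"
    and B: "B1 \<in> sets N1" "B2 \<in> sets N2" "B3 \<in> sets N3"
  shows "prob {w\<in>space M. X1 w \<in> B1 \<and> X2 w \<in> B2 \<and> X3 w \<in> B3} =
    prob {w\<in>space M. X1 w \<in> B1} * prob {w\<in>space M. X2 w \<in> B2} * prob {w\<in>space M. X3 w \<in> B3}"
proof -
  define E where "E j = (if j = 1 then {w\<in>space M. X1 w \<in> B1} else if j = (2::nat) then {w\<in>space M. X2 w \<in> B2} else {w\<in>space M. X3 w \<in> B3})" for j
  have "prob (\<Inter>j\<in>{1,2,3}. E j) = (\<Prod>j\<in>{1,2,3}. prob (E j))"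
  proof (rule indep_setsD)
    show "indep_sets (\<lambda>j::nat. if j = 1 then generated_events M N1 X1
                 else if j = 2 then generated_events M N2 X2
                 else generated_events M N3 X3) {1, 2, 3}"
      using ind by (simp add: indep_vars3_def)
    have "{w\<in>space M. X w \<in> B} = X -` B \<inter> space M" for X :: "'a \<Rightarrow> 'z" and B by auto
    then show "\<forall>j\<in>{1, 2, 3}. E j \<in> (if j = 1 then generated_events M N1 X1
                 else if j = 2 then generated_events M N2 X2
                 else generated_events M N3 X3)"
      using B by (auto simp: E_def generated_events_def)
  qed auto
  moreover have "(\<Inter>j\<in>{1,2,3}. E j) = {w\<in>space M. X1 w \<in> B1 \<and> X2 w \<in> B2 \<and> X3 w \<in> B3}"
    by (auto simp: E_def)
  ultimately show ?thesis by (simp add: E_def)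
qed

text \<open>Pigeonhole: an interval covered by \<open>N + 1\<close> cells of length \<open>h\<close> has a cell that carries the average
  probability. With cells whose length is a negative power of \<open>2 ^ r\<close> this fixes the scale \<open>S\<close>
  almost exactly at a deterministic \<open>t\<close>, at a negligible cost. Closeness of \<open>S * Z i\<close> to its target
  can then be expressed by an event that involves the Gaussian coefficients alone.\<close>

lemma (in prob_space) ex_cell_prob_ge:
  assumes S[measurable]: "S \<in> borel_measurable M" and h: "0 < h" and N: "s1 \<le> s0 + real N * h"
  shows "\<exists>t\<in>{s0..s0 + real N * h}. prob {w\<in>space M. S w \<in> {t..t + h}} \<ge> prob {w\<in>space M. S w \<in> {s0..s1}} / (real N + 1)"
proof (rule ccontr)
  let ?p = "prob {w\<in>space M. S w \<in> {s0..s1}}"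
  assume neg: "\<not> ?thesis"
  have lt: "prob {w\<in>space M. S w \<in> {s0 + real k * h..s0 + real k * h + h}} < ?p / (real N + 1)" if "k \<le> N" for k
  proof -
    have "real k * h \<le> real N * h" using that h by (intro mult_right_mono) auto
    then have "s0 + real k * h \<in> {s0..s0 + real N * h}" using h by auto
    then show ?thesis using neg by (meson not_less)
  qed
  have "?p \<le> prob (\<Union>k\<in>{..N}. {w\<in>space M. S w \<in> {s0 + real k * h..s0 + real k * h + h}})"
  proof (rule finite_measure_mono)
    show "{w\<in>space M. S w \<in> {s0..s1}} \<subseteq> (\<Union>k\<in>{..N}. {w\<in>space M. S w \<in> {s0 + real k * h..s0 + real k * h + h}})"
    proof
      fix w assume w: "w \<in> {w\<in>space M. S w \<in> {s0..s1}}"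
      define u where "u = (S w - s0) / h"
      have u: "0 \<le> u" "u \<le> real N" "S w = s0 + u * h" using w N h by (auto simp: u_def field_simps)
      define k where "k = nat \<lfloor>u\<rfloor>"
      have k: "real k \<le> u" "u \<le> real k + 1" "k \<le> N" using u by (auto simp: k_def nat_le_iff floor_le_iff)
      have "real k * h \<le> u * h" "u * h \<le> (real k + 1) * h" using k h by (intro mult_right_mono; simp)+
      then have "S w \<in> {s0 + real k * h..s0 + real k * h + h}" unfolding u(3) by (auto simp: algebra_simps)
      then show "w \<in> (\<Union>k\<in>{..N}. {w\<in>space M. S w \<in> {s0 + real k * h..s0 + real k * h + h}})"
        using w k by auto
    qed
  qed measurable
  also have "\<dots> \<le> (\<Sum>k\<le>N. prob {w\<in>space M. S w \<in> {s0 + real k * h..s0 + real k * h + h}})"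
    by (rule finite_measure_subadditive_finite) (auto intro!: measurable_sets_Collect[OF S])
  also have "\<dots> < (\<Sum>k\<le>N. ?p / (real N + 1))"
  proof (rule sum_strict_mono)
    fix k assume "k \<in> {..N}"
    then have "k \<le> N" by simp
    then show "prob {w\<in>space M. S w \<in> {s0 + real k * h..s0 + real k * h + h}} < ?p / (real N + 1)" by (rule lt)
  qed auto
  also have "\<dots> = ?p" by (simp add: add.commute)
  finally show False by simp
qed

text \<open>Division by a scale \<open>t \<ge> 2 powr (r * \<bar>\<alpha> - \<beta>\<bar>)\<close> brings each target coefficient below \<open>K\<close> times
  \<open>2 powr (- \<alpha> * level i)\<close>, so that each of the \<open>2 ^ (r + 1)\<close> coordinates adds at most \<open>K\<^sup>2 / \<kappa>\<close> to the
  exponent.\<close>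

lemma (in prob_space) gaussian_coeff_box:
  assumes G: "centred_gaussian_seq M Z A" and lb: "covariance_bounds M Z \<alpha> \<kappa> V"
    and z: "\<And>i. 1 \<le> i \<Longrightarrow> \<bar>z i\<bar> \<le> K * 2 powr (- \<beta> * real (level i))" and K: "0 < K"
    and t: "2 powr (real r * \<bar>\<alpha> - \<beta>\<bar>) \<le> t"
    and \<eta>: "0 < \<eta>" "\<eta> \<le> 1" "2 ^ (r + 1) * sqrt V * \<eta> \<le> \<delta>"
  shows "prob {w\<in>space M. \<forall>i\<in>levels_upto r. \<bar>Z i w - z i / t\<bar> \<le> \<delta>} \<ge>
     (\<eta> / 8) ^ 2 ^ (r + 1) * exp (- (2 ^ (r + 1) * (K\<^sup>2 / \<kappa>)))"
proof -
  define d where "d i = 2 powr (- 2 * \<alpha> * real (level i))" for i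
  have kap: "0 < \<kappa>" using lb by (simp add: covariance_bounds_def)
  have t0: "0 < t" using t less_le_trans[of 0 "2 powr (real r * \<bar>\<alpha> - \<beta>\<bar>)" t] by simp
  have term_le: "(z i / t)\<^sup>2 / (\<kappa> * d i) \<le> K\<^sup>2 / \<kappa>" if i: "i \<in> levels_upto r" for i
  proof -
    have "- \<beta> * real (level i) \<le> - \<alpha> * real (level i) + real r * \<bar>\<alpha> - \<beta>\<bar>"
    proof -
      have "(\<alpha> - \<beta>) * real (level i) \<le> \<bar>\<alpha> - \<beta>\<bar> * real r"
        using level_le[OF i] by (intro mult_mono) auto
      then show ?thesis by (simp add: algebra_simps)
    qed
    then have "2 powr (- \<beta> * real (level i)) \<le> 2 powr (- \<alpha> * real (level i)) * 2 powr (real r * \<bar>\<alpha> - \<beta>\<bar>)"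
      unfolding powr_add[symmetric] by (intro powr_mono) auto
    also have "\<dots> \<le> 2 powr (- \<alpha> * real (level i)) * t" using t by (intro mult_left_mono) auto
    finally have "K * 2 powr (- \<beta> * real (level i)) \<le> K * (2 powr (- \<alpha> * real (level i)) * t)"
      using K by (intro mult_left_mono) auto
    then have "\<bar>z i\<bar> \<le> K * (2 powr (- \<alpha> * real (level i)) * t)"
      using z[OF levels_upto_ge_1[OF i]] by linarith
    then have "\<bar>z i / t\<bar> \<le> K * 2 powr (- \<alpha> * real (level i))" using t0 by (simp add: field_simps)
    then have "\<bar>z i / t\<bar>\<^sup>2 \<le> (K * 2 powr (- \<alpha> * real (level i)))\<^sup>2" by (intro power_mono) auto
    also have "\<dots> = K\<^sup>2 * d i"
      by (simp add: d_def power_mult_distrib power2_eq_square mult.assoc flip: powr_add)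
    finally have "(z i / t)\<^sup>2 \<le> K\<^sup>2 * d i" unfolding power2_abs .
    then have "(z i / t)\<^sup>2 / d i \<le> K\<^sup>2"
      by (subst pos_divide_le_eq) (auto simp: d_def)
    then have "(z i / t)\<^sup>2 / d i / \<kappa> \<le> K\<^sup>2 / \<kappa>" using kap by (intro divide_right_mono) auto
    then show ?thesis by (simp add: mult.commute)
  qed
  have "(\<eta> / 8) ^ card (levels_upto r) * exp (- (\<Sum>i\<in>levels_upto r. (z i / t)\<^sup>2 / (\<kappa> * d i)))
    \<le> prob {w\<in>space M. \<forall>i\<in>levels_upto r. \<bar>Z i w - z i / t\<bar> \<le> \<delta>}"
  proof (rule gaussian_box_lower_bound[where V = V])
    show "centred_normal M (\<lambda>w. \<Sum>i\<in>levels_upto r. u i * Z i w)" for u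
      by (rule centred_gaussian_seq_normal[OF G finite_levels_upto]) (auto simp: levels_upto_def)
    show "\<kappa> * (\<Sum>i\<in>levels_upto r. d i * (u i)\<^sup>2) \<le> expectation (\<lambda>w. (\<Sum>i\<in>levels_upto r. u i * Z i w)\<^sup>2)" for u
      using lb unfolding covariance_bounds_def d_def by blast
    show "expectation (\<lambda>w. (Z i w)\<^sup>2) \<le> V" if "i \<in> levels_upto r" for i
      using lb levels_upto_ge_1[OF that] unfolding covariance_bounds_def by blast
    show "real (card (levels_upto r)) * sqrt V * \<eta> \<le> \<delta>" using \<eta> by (simp add: card_levels_upto)
  qed (use \<eta> kap in \<open>auto simp: d_def intro: centred_gaussian_seq_measurable[OF G] dest: levels_upto_ge_1\<close>)
  moreover have "(\<Sum>i\<in>levels_upto r. (z i / t)\<^sup>2 / (\<kappa> * d i)) \<le> 2 ^ (r + 1) * (K\<^sup>2 / \<kappa>)"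
    using sum_bounded_above[OF term_le, of "levels_upto r"] by (simp add: card_levels_upto)
  then have "(\<eta> / 8) ^ 2 ^ (r + 1) * exp (- (2 ^ (r + 1) * (K\<^sup>2 / \<kappa>))) \<le>
     (\<eta> / 8) ^ card (levels_upto r) * exp (- (\<Sum>i\<in>levels_upto r. (z i / t)\<^sup>2 / (\<kappa> * d i)))"
    unfolding card_levels_upto using \<eta> by (intro mult_left_mono) auto
  ultimately show ?thesis by linarith
qed

text \<open>Used to absorb constants and powers of \<open>2 ^ r\<close> in \<open>exp (const * r)\<close>.\<close>

lemma mult_powr_le_exp:
  fixes a c r :: real
  assumes "1 \<le> c" "1 \<le> r"
  shows "c * 2 powr (a * r) \<le> exp ((ln c + a * ln 2) * r)"
proof -
  have "exp (ln c) = c" using assms by simp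
  moreover have "exp (ln c) \<le> exp (ln c * r)"
    unfolding exp_le_cancel_iff using assms mult_left_mono[of 1 r "ln c"] by simp
  ultimately have "c * 2 powr (a * r) \<le> exp (ln c * r) * 2 powr (a * r)" by (intro mult_right_mono) auto
  also have "\<dots> = exp ((ln c + a * ln 2) * r)" by (simp add: powr_def algebra_simps flip: exp_add)
  finally show ?thesis .
qed

lemma add_2_lt_4_power: "1 \<le> r \<Longrightarrow> real r + 2 < 4 ^ r"
proof (induction r rule: nat_induct_at_least)
  case (Suc n)
  have "(1::real) \<le> 4 ^ n" by simp
  then show ?case using Suc by simp
qed simp

text \<open>Apply the hypothesis on \<open>S\<close> at \<open>x = C * 2 powr (r * g / p1)\<close>. The lower end \<open>x powr p1\<close> of the window is
  then at least \<open>2 powr (r * g)\<close>, while \<open>x powr q \<le> C powr q * 2 ^ r\<close> because \<open>q * g < p1\<close>.\<close>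

lemma (in prob_space) scale_window:
  assumes p: "0 < p1" "p1 < p2" and q: "0 < q" and C: "1 < C" and gap: "p1 > q * g" and g: "0 \<le> g"
    and S: "\<forall>x\<ge>C. prob {w\<in>space M. S w \<in> {x powr p1..x powr p2}} \<ge> exp (- (x powr q))"
  defines "s0 \<equiv> \<lambda>r::nat. (C * 2 powr (real r * (g / p1))) powr p1"
    and "s1 \<equiv> \<lambda>r::nat. (C * 2 powr (real r * (g / p1))) powr p2"
  shows "prob {w\<in>space M. S w \<in> {s0 r..s1 r}} \<ge> exp (- (C powr q * 2 ^ r))"
    and "2 powr (real r * g) \<le> s0 r" "s0 r \<le> s1 r" "s1 r = C powr p2 * 2 powr (g / p1 * p2 * real r)"
proof -
  define x where "x = C * 2 powr (real r * (g / p1))"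
  have "1 \<le> 2 powr (real r * (g / p1))" using g p by (intro ge_one_powr_ge_zero) auto
  then have xC: "C \<le> x" using C mult_left_mono[of 1 "2 powr (real r * (g / p1))" C] by (simp add: x_def)
  show "s0 r \<le> s1 r" unfolding s0_def s1_def x_def[symmetric] using xC C p by (intro powr_mono) auto
  have "2 powr (real r * g) = 1 * 2 powr (real r * (g / p1) * p1)" using p by simp
  also have "\<dots> \<le> C powr p1 * 2 powr (real r * (g / p1) * p1)"
    using C p by (intro mult_right_mono ge_one_powr_ge_zero) auto
  also have "\<dots> = s0 r" unfolding s0_def using C by (simp add: powr_mult powr_powr)
  finally show "2 powr (real r * g) \<le> s0 r" .
  show "s1 r = C powr p2 * 2 powr (g / p1 * p2 * real r)"
    unfolding s1_def using C by (simp add: powr_mult powr_powr mult_ac)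
  have "x powr q = C powr q * 2 powr (real r * (g / p1) * q)"
    unfolding x_def using C by (simp add: powr_mult powr_powr)
  also have "real r * (g / p1) * q \<le> real r * 1"
    unfolding mult.assoc using gap p by (intro mult_left_mono) (auto simp: field_simps)
  then have "2 powr (real r * (g / p1) * q) \<le> 2 powr real r" by (intro powr_mono) auto
  then have "C powr q * 2 powr (real r * (g / p1) * q) \<le> C powr q * 2 ^ r"
    by (intro mult_left_mono) (auto simp: powr_realpow)
  finally have "exp (- (C powr q * 2 ^ r)) \<le> exp (- (x powr q))" by simp
  also have "\<dots> \<le> prob {w\<in>space M. S w \<in> {x powr p1..x powr p2}}" using S xC by blast
  finally show "prob {w\<in>space M. S w \<in> {s0 r..s1 r}} \<ge> exp (- (C powr q * 2 ^ r))"
    unfolding s0_def s1_def x_def .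
qed

text \<open>The probability is bounded below by that of the product event \<open>R = r\<close>, \<open>S\<close> in a short interval
  \<open>[t, t + h]\<close> and \<open>Z i\<close> within \<open>\<delta>\<close> of \<open>z i / t\<close> up to level \<open>r\<close>. The lengths \<open>h\<close> and \<open>\<delta>\<close> are such that
  each coefficient \<open>S * Z i\<close> misses \<open>z i\<close> by at most \<open>\<rho>\<close>; summed over the levels this adds up to less
  than \<open>2 powr (- \<beta> * r)\<close>, the order of the tail of \<open>b0\<close>.\<close>

lemma (in prob_space) small_ball:
  assumes G: "centred_gaussian_seq M Z A" and lb: "covariance_bounds M Z \<alpha> \<kappa> V"
    and z: "\<And>i. 1 \<le> i \<Longrightarrow> \<bar>z i\<bar> \<le> K * 2 powr (- \<beta> * real (level i))" and K: "0 < K" and \<beta>: "0 < \<beta>"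
    and sums: "\<And>x. (\<lambda>i. z (i + 1) * schauder (i + 1) x) sums b0 x"
    and ind: "indep_vars3 M (PiM {1..} (\<lambda>_. borel)) (\<lambda>w. \<lambda>i\<in>{1..}. Z i w) (count_space UNIV) R borel S"
    and R: "\<forall>r\<ge>1. prob {w\<in>space M. R w = r} \<ge> exp (- c2 * 2 ^ r * real r)" and c2: "0 < c2"
    and p: "0 < p1" "p1 < p2" and q: "0 < q" and C: "1 < C" and gap: "p1 > q * \<bar>\<alpha> - \<beta>\<bar>"
    and S: "\<forall>x\<ge>C. prob {w\<in>space M. S w \<in> {x powr p1..x powr p2}} \<ge> exp (- (x powr q))"
  shows "\<exists>D>0. \<forall>r\<ge>1. exp (- (D * 2 ^ r * real r)) \<le>
    prob {w\<in>space M. sup_norm (\<lambda>x. random_series Z R S w x - b0 x) < ereal ((K / (2 powr \<beta> - 1) + 1) * 2 powr (- \<beta> * real r))}"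
proof -
  have kap: "0 < \<kappa>" "0 < V" using lb by (auto simp: covariance_bounds_def)
  define \<tau> where "\<tau> = K / (2 powr \<beta> - 1)"
  define g where "g = \<bar>\<alpha> - \<beta>\<bar>"
  define s0 s1 where "s0 r = (C * 2 powr (real r * (g / p1))) powr p1"
    and "s1 r = (C * 2 powr (real r * (g / p1))) powr p2" for r :: nat
  have gap': "p1 > q * g" and g0: "0 \<le> g" using gap by (simp_all add: g_def)
  note window = scale_window[OF p q C gap' g0 S, folded s0_def s1_def]
  define cs where "cs = C powr p2"
  define es where "es = g / p1 * p2"
  have cs1: "1 \<le> cs" unfolding cs_def using C p by (intro ge_one_powr_ge_zero) auto
  have es0: "0 \<le> es" using g0 p by (simp add: es_def)
  have s1_eq: "s1 r = cs * 2 powr (es * real r)" for r using window(4)[of r] by (simp add: cs_def es_def)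
  \<comment> \<open>Each coefficient will cost a factor \<open>exp (- L1 * r)\<close>, and \<open>exp (L2 * r)\<close> bounds the number of cells
    for \<open>S\<close>.\<close>
  define L1 where "L1 = ln (96 * (sqrt V + 1) * cs) + (3 + \<beta> + es) * ln 2"
  define L2 where "L2 = ln (6 * (K + 1) * cs) + (2 + \<beta> + es) * ln 2"
  have big1: "1 \<le> 96 * (sqrt V + 1) * cs"
    using mult_mono[of 1 "96 * (sqrt V + 1)" 1 cs] cs1 kap by simp
  have big2: "1 \<le> 6 * (K + 1) * cs"
    using mult_mono[of 1 "6 * (K + 1)" 1 cs] cs1 K by simp
  have L0: "0 \<le> L1" "0 \<le> L2" unfolding L1_def L2_def using big1 big2 \<beta> es0
    by (auto intro!: add_nonneg_nonneg mult_nonneg_nonneg)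
  define D where "D = c2 + C powr q + L2 + 2 * L1 + 2 * (K\<^sup>2 / \<kappa>)"
  have D0: "0 < D" unfolding D_def using c2 L0 kap by (intro add_pos_nonneg) auto
  have main: "exp (- (D * 2 ^ r * real r)) \<le>
    prob {w\<in>space M. sup_norm (\<lambda>x. random_series Z R S w x - b0 x) < ereal ((\<tau> + 1) * 2 powr (- \<beta> * real r))}"
    if r: "1 \<le> r" for r
  proof -
    \<comment> \<open>The extra factor \<open>1 / 4 ^ r\<close> in \<open>\<rho>\<close> beats the number \<open>r + 2\<close> of blocks. \<open>U\<close> is a bound for \<open>t\<close>, and \<open>\<eta>\<close> is
      the half-width of the intervals for the whitened coefficients.\<close>
    define \<rho> where "\<rho> = 2 powr (- (\<beta> + 2) * real r)"
    define U where "U = 2 * s1 r + 1"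
    define h where "h = \<rho> / (2 * (K + 1))"
    define \<delta> where "\<delta> = \<rho> / (2 * U)"
    define \<eta> where "\<eta> = \<delta> / (2 ^ (r + 1) * (sqrt V + 1))"
    define N where "N = nat \<lceil>s1 r / h\<rceil>"
    have r1: "1 \<le> real r" using r by simp
    have s0_1: "1 \<le> s0 r"
    proof -
      have "1 \<le> 2 powr (real r * g)" using g0 by (intro ge_one_powr_ge_zero) auto
      also note window(2)[of r]
      finally show ?thesis .
    qed
    have s1_1: "1 \<le> s1 r" using s0_1 window(3)[of r] by linarith
    have \<rho>: "0 < \<rho>" "\<rho> \<le> 1"
    proof -
      have "- (\<beta> + 2) * real r \<le> 0" using \<beta> by (intro mult_nonpos_nonneg) auto
      then show "\<rho> \<le> 1" unfolding \<rho>_def using powr_mono[of "- (\<beta> + 2) * real r" 0 2] by simp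
    qed (simp add: \<rho>_def)
    have \<rho>_inv: "1 / \<rho> = 2 powr ((\<beta> + 2) * real r)" unfolding \<rho>_def mult_minus_left powr_minus_divide by simp
    have h: "0 < h" "h \<le> 1" using \<rho> K by (auto simp: h_def field_simps)
    have U: "1 \<le> U" "U \<le> 3 * s1 r" using s1_1 by (auto simp: U_def)
    have \<delta>: "0 < \<delta>" "\<delta> \<le> 1" using \<rho> U by (auto simp: \<delta>_def field_simps)
    have den: "1 \<le> 2 ^ (r + 1) * (sqrt V + 1)"
      using mult_mono[of 1 "2 ^ (r + 1)" 1 "sqrt V + 1"] one_le_power[of "2::real" "r + 1"] kap by simp
    have \<eta>: "0 < \<eta>" "\<eta> \<le> 1"
    proof -
      show "0 < \<eta>" unfolding \<eta>_def by (intro divide_pos_pos \<delta> less_le_trans[OF zero_less_one den])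
      have "\<eta> \<le> \<delta> / 1" unfolding \<eta>_def using \<delta> den less_le_trans[OF zero_less_one den]
        by (intro divide_left_mono) auto
      then show "\<eta> \<le> 1" using \<delta> by simp
    qed
    have "2 ^ (r + 1) * sqrt V * \<eta> \<le> 2 ^ (r + 1) * (sqrt V + 1) * \<eta>"
      using \<eta> by (intro mult_right_mono mult_left_mono) auto
    also have "\<dots> = \<delta>"
    proof -
      have "a * (\<delta> / a) = \<delta>" if "1 \<le> a" for a using that by simp
      from this[OF den] show ?thesis unfolding \<eta>_def .
    qed
    finally have \<eta>_box: "2 ^ (r + 1) * sqrt V * \<eta> \<le> \<delta>" .
    have \<eta>_exp: "exp (- (L1 * real r)) \<le> \<eta> / 8"
    proof -
      have "8 / \<eta> = 16 * 2 ^ (r + 1) * (sqrt V + 1) * U * (1 / \<rho>)"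
        using \<rho> U den by (simp add: \<eta>_def \<delta>_def field_simps)
      also have "\<dots> \<le> 16 * 2 ^ (r + 1) * (sqrt V + 1) * (3 * s1 r) * (1 / \<rho>)"
        using U \<rho> kap by (intro mult_right_mono mult_left_mono) auto
      also have "\<dots> = 96 * (sqrt V + 1) * cs * (2 powr real r * 2 powr (es * real r) * 2 powr ((\<beta> + 2) * real r))"
        unfolding \<rho>_inv s1_eq by (simp add: powr_realpow)
      also have "2 powr real r * 2 powr (es * real r) * 2 powr ((\<beta> + 2) * real r) = 2 powr ((3 + \<beta> + es) * real r)"
        unfolding powr_add[symmetric] by (simp add: algebra_simps)
      also have "96 * (sqrt V + 1) * cs * 2 powr ((3 + \<beta> + es) * real r) \<le> exp (L1 * real r)"
        unfolding L1_def by (rule mult_powr_le_exp[OF big1 r1])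
      finally have "8 \<le> exp (L1 * real r) * \<eta>" using \<eta> by (simp add: field_simps)
      then have "1 / exp (L1 * real r) \<le> \<eta> / 8" by (simp add: field_simps)
      then show ?thesis by (simp add: exp_minus field_simps)
    qed
    have N: "real N + 1 \<le> exp (L2 * real r)" "real N * h \<le> s1 r + h" "s1 r \<le> real N * h"
    proof -
      have q0: "0 \<le> s1 r / h" using s1_1 h by simp
      have Nc: "s1 r / h \<le> real N" "real N \<le> s1 r / h + 1" using q0 unfolding N_def by linarith+
      then show "real N * h \<le> s1 r + h" "s1 r \<le> real N * h" using h by (auto simp: field_simps)
      have "1 \<le> s1 r / h" using s1_1 h by (simp add: field_simps)
      then have "real N + 1 \<le> 3 * (s1 r / h)" using Nc by linarith
      also have "\<dots> = 6 * (K + 1) * s1 r * (1 / \<rho>)" using K \<rho> by (simp add: h_def field_simps)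
      also have "\<dots> = 6 * (K + 1) * cs * (2 powr (es * real r) * 2 powr ((\<beta> + 2) * real r))"
        unfolding \<rho>_inv s1_eq by simp
      also have "2 powr (es * real r) * 2 powr ((\<beta> + 2) * real r) = 2 powr ((2 + \<beta> + es) * real r)"
        unfolding powr_add[symmetric] by (simp add: algebra_simps)
      also have "6 * (K + 1) * cs * 2 powr ((2 + \<beta> + es) * real r) \<le> exp (L2 * real r)"
        unfolding L2_def by (rule mult_powr_le_exp[OF big2 r1])
      finally show "real N + 1 \<le> exp (L2 * real r)" .
    qed
    have Sm: "S \<in> borel_measurable M" and Rm: "R \<in> measurable M (count_space UNIV)"
      using ind by (auto simp: indep_vars3_def)
    obtain t where t: "s0 r \<le> t" "t \<le> s0 r + real N * h"
      and tS: "prob {w\<in>space M. S w \<in> {s0 r..s1 r}} / (real N + 1) \<le> prob {w\<in>space M. S w \<in> {t..t + h}}"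
      using ex_cell_prob_ge[OF Sm h(1), of "s1 r" "s0 r" N] N(3) s0_1 by auto
    have t1: "1 \<le> t" "t \<le> U" using t s0_1 N(2) h window(3)[of r] by (auto simp: U_def)
    have PS: "exp (- (C powr q * 2 ^ r)) / exp (L2 * real r) \<le> prob {w\<in>space M. S w \<in> {t..t + h}}"
    proof -
      have "exp (- (C powr q * 2 ^ r)) / exp (L2 * real r) \<le> prob {w\<in>space M. S w \<in> {s0 r..s1 r}} / (real N + 1)"
        using window(1)[of r] N(1) by (intro frac_le) auto
      with tS show ?thesis by linarith
    qed
    define BZ where "BZ = {f\<in>space (PiM {1..} (\<lambda>_. borel)). \<forall>i\<in>levels_upto r. \<bar>f i - z i / t\<bar> \<le> \<delta>}"
    have BZ: "BZ \<in> sets (PiM {1..} (\<lambda>_. borel))"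
      unfolding BZ_def
    proof (rule sets.sets_Collect_finite_All)
      fix i assume "i \<in> levels_upto r"
      then have [measurable]: "(\<lambda>f. f i) \<in> borel_measurable (PiM {1..} (\<lambda>_. borel))"
        by (intro measurable_component_singleton) (auto dest: levels_upto_ge_1)
      show "{f \<in> space (PiM {1..} (\<lambda>_. borel)). \<bar>f i - z i / t\<bar> \<le> \<delta>} \<in> sets (PiM {1..} (\<lambda>_. borel))"
        by measurable
    qed simp
    have BZ_iff: "(\<lambda>i\<in>{1..}. Z i w) \<in> BZ \<longleftrightarrow> (\<forall>i\<in>levels_upto r. \<bar>Z i w - z i / t\<bar> \<le> \<delta>)" for w
    proof -
      have "(\<forall>i\<in>levels_upto r. \<bar>(\<lambda>i\<in>{1..}. Z i w) i - z i / t\<bar> \<le> \<delta>) \<longleftrightarrow> (\<forall>i\<in>levels_upto r. \<bar>Z i w - z i / t\<bar> \<le> \<delta>)"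
      proof (rule ball_cong[OF refl])
        fix i assume "i \<in> levels_upto r"
        from levels_upto_ge_1[OF this]
        show "(\<bar>(\<lambda>i\<in>{1..}. Z i w) i - z i / t\<bar> \<le> \<delta>) = (\<bar>Z i w - z i / t\<bar> \<le> \<delta>)" by simp
      qed
      then show ?thesis by (simp add: BZ_def space_PiM del: restrict_apply)
    qed
    have PZ: "exp (- (L1 * real r)) ^ 2 ^ (r + 1) * exp (- (2 ^ (r + 1) * (K\<^sup>2 / \<kappa>))) \<le>
      prob {w\<in>space M. (\<lambda>i\<in>{1..}. Z i w) \<in> BZ}"
    proof -
      have "exp (- (L1 * real r)) ^ 2 ^ (r + 1) * exp (- (2 ^ (r + 1) * (K\<^sup>2 / \<kappa>))) \<le>
        (\<eta> / 8) ^ 2 ^ (r + 1) * exp (- (2 ^ (r + 1) * (K\<^sup>2 / \<kappa>)))"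
        by (intro mult_right_mono power_mono \<eta>_exp) auto
      also have "\<dots> \<le> prob {w\<in>space M. \<forall>i\<in>levels_upto r. \<bar>Z i w - z i / t\<bar> \<le> \<delta>}"
        using window(2)[of r] t(1) unfolding g_def
        by (intro gaussian_coeff_box[OF G lb z K _ \<eta> \<eta>_box]) auto
      finally show ?thesis unfolding BZ_iff .
    qed
    have "exp (- (D * 2 ^ r * real r)) \<le>
       (exp (- (L1 * real r)) ^ 2 ^ (r + 1) * exp (- (2 ^ (r + 1) * (K\<^sup>2 / \<kappa>)))) *
       exp (- c2 * 2 ^ r * real r) * (exp (- (C powr q * 2 ^ r)) / exp (L2 * real r))"
    proof -
      define E where "E = (2::real) ^ r * real r"
      have E: "2 ^ r \<le> E" "real r \<le> E"
        using r1 mult_left_mono[of 1 "real r" "2 ^ r"] mult_right_mono[of 1 "2 ^ r" "real r"] by (auto simp: E_def)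
      have "L1 * real r * 2 ^ (r + 1) + 2 ^ (r + 1) * (K\<^sup>2 / \<kappa>) + c2 * 2 ^ r * real r + C powr q * 2 ^ r + L2 * real r
         \<le> D * E"
      proof -
        have "L1 * real r * 2 ^ (r + 1) = 2 * L1 * E" "c2 * 2 ^ r * real r = c2 * E" by (simp_all add: E_def)
        moreover have "2 ^ (r + 1) * (K\<^sup>2 / \<kappa>) \<le> 2 * (K\<^sup>2 / \<kappa>) * E"
          using mult_left_mono[OF E(1), of "2 * (K\<^sup>2 / \<kappa>)"] kap by (simp add: mult_ac)
        moreover have "C powr q * 2 ^ r \<le> C powr q * E" "L2 * real r \<le> L2 * E"
          using E L0 by (auto intro!: mult_left_mono)
        ultimately show ?thesis unfolding D_def distrib_right by linarith
      qed
      then have "exp (- (D * E)) \<le> exp (- (L1 * real r * 2 ^ (r + 1)) + (- (2 ^ (r + 1) * (K\<^sup>2 / \<kappa>))) +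
         (- c2 * 2 ^ r * real r) + (- (C powr q * 2 ^ r)) + (- (L2 * real r)))"
        by simp
      also have "\<dots> = (exp (- (L1 * real r)) ^ 2 ^ (r + 1) * exp (- (2 ^ (r + 1) * (K\<^sup>2 / \<kappa>)))) *
       exp (- c2 * 2 ^ r * real r) * (exp (- (C powr q * 2 ^ r)) / exp (L2 * real r))"
        unfolding exp_add exp_of_nat_mult[symmetric] by (simp add: exp_minus[of "L2 * _"] divide_inverse mult_ac)
      finally show ?thesis by (simp add: E_def mult.assoc)
    qed
    also have "\<dots> \<le> prob {w\<in>space M. (\<lambda>i\<in>{1..}. Z i w) \<in> BZ} * prob {w\<in>space M. R w \<in> {r}} * prob {w\<in>space M. S w \<in> {t..t + h}}"
      using PZ PS R r by (intro mult_mono) auto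
    also have "\<dots> = prob {w\<in>space M. (\<lambda>i\<in>{1..}. Z i w) \<in> BZ \<and> R w \<in> {r} \<and> S w \<in> {t..t + h}}"
      by (rule indep_vars3_prob[OF ind BZ, symmetric]) auto
    also have "\<dots> \<le> prob {w\<in>space M. sup_norm (\<lambda>x. random_series Z R S w x - b0 x) < ereal ((\<tau> + 1) * 2 powr (- \<beta> * real r))}"
    proof (rule finite_measure_mono)
      show "{w\<in>space M. sup_norm (\<lambda>x. random_series Z R S w x - b0 x) < ereal ((\<tau> + 1) * 2 powr (- \<beta> * real r))} \<in> sets M"
        by (rule sup_norm_event_measurable[OF centred_gaussian_seq_measurable[OF G] Rm Sm
              schauder_series_continuous[OF z K \<beta> sums]])
      show "{w\<in>space M. (\<lambda>i\<in>{1..}. Z i w) \<in> BZ \<and> R w \<in> {r} \<and> S w \<in> {t..t + h}} \<subseteq>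
        {w\<in>space M. sup_norm (\<lambda>x. random_series Z R S w x - b0 x) < ereal ((\<tau> + 1) * 2 powr (- \<beta> * real r))}"
      proof (rule subsetI)
        fix w assume w: "w \<in> {w\<in>space M. (\<lambda>i\<in>{1..}. Z i w) \<in> BZ \<and> R w \<in> {r} \<and> S w \<in> {t..t + h}}"
        then have "(\<lambda>i\<in>{1..}. Z i w) \<in> BZ" by blast
        then have Zw: "\<And>i. i \<in> levels_upto r \<Longrightarrow> \<bar>Z i w - z i / t\<bar> \<le> \<delta>" unfolding BZ_iff by blast
        have Rw: "R w = r" and Sw: "\<bar>S w - t\<bar> \<le> h" using w by auto
        have coeff: "\<bar>S w * Z i w - z i\<bar> \<le> \<rho>" if i: "i \<in> levels_upto r" for i
        proof -
          have "\<bar>z i\<bar> \<le> K * 2 powr (- \<beta> * real (level i))" by (rule z[OF levels_upto_ge_1[OF i]])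
          also have "\<dots> \<le> K * 2 powr 0" using K \<beta> by (intro mult_left_mono powr_mono) auto
          finally have "\<bar>z i\<bar> \<le> K" by simp
          moreover have "\<bar>z i / t\<bar> \<le> \<bar>z i\<bar>" using t1 mult_left_mono[of 1 t "\<bar>z i\<bar>"] by (simp add: field_simps)
          ultimately have "\<bar>Z i w\<bar> \<le> K + 1" using Zw[OF i] \<delta> by linarith
          then have "\<bar>S w - t\<bar> * \<bar>Z i w\<bar> \<le> h * (K + 1)" using Sw h by (intro mult_mono) auto
          moreover have "t * \<bar>Z i w - z i / t\<bar> \<le> U * \<delta>" using t1 Zw[OF i] by (intro mult_mono) auto
          moreover have "S w * Z i w - z i = (S w - t) * Z i w + t * (Z i w - z i / t)"
            using t1 by (simp add: algebra_simps)
          then have "\<bar>S w * Z i w - z i\<bar> \<le> \<bar>S w - t\<bar> * \<bar>Z i w\<bar> + t * \<bar>Z i w - z i / t\<bar>"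
            using abs_triangle_ineq[of "(S w - t) * Z i w" "t * (Z i w - z i / t)"] t1 by (simp add: abs_mult)
          moreover have "h * (K + 1) = \<rho> / 2" "U * \<delta> = \<rho> / 2" using K U by (auto simp: h_def \<delta>_def field_simps)
          ultimately show ?thesis by linarith
        qed
        have "\<bar>random_series Z R S w x - b0 x\<bar> \<le> (real r + 2) * \<rho> + \<tau> * 2 powr (- \<beta> * real r)" for x
        proof -
          have "random_series Z R S w x - b0 x = schauder_sum r (\<lambda>i. S w * Z i w - z i) x - (b0 x - schauder_sum r z x)"
            unfolding random_series_eq Rw schauder_sum_diff[symmetric] by simp
          moreover have "\<bar>schauder_sum r (\<lambda>i. S w * Z i w - z i) x\<bar> \<le> (real r + 2) * \<rho>"
            using coeff \<rho> by (intro abs_schauder_sum_le) auto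
          moreover have "\<bar>b0 x - schauder_sum r z x\<bar> \<le> \<tau> * 2 powr (- \<beta> * real r)"
            unfolding \<tau>_def by (rule schauder_tail[OF z K \<beta> sums])
          ultimately show ?thesis by linarith
        qed
        then have "sup_norm (\<lambda>x. random_series Z R S w x - b0 x) \<le> ereal ((real r + 2) * \<rho> + \<tau> * 2 powr (- \<beta> * real r))"
          unfolding sup_norm_def by (intro SUP_least) auto
        also have "\<dots> < ereal ((\<tau> + 1) * 2 powr (- \<beta> * real r))"
        proof -
          have "(real r + 2) * \<rho> < 4 ^ r * \<rho>" using add_2_lt_4_power[OF r] \<rho> by simp
          also have "4 ^ r = 2 powr (2 * real r)" by (simp add: powr_realpow[symmetric] powr_powr[symmetric])
          also have "2 powr (2 * real r) * \<rho> = 2 powr (- \<beta> * real r)"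
            unfolding \<rho>_def powr_add[symmetric] by (simp add: algebra_simps)
          finally show ?thesis by (simp add: algebra_simps)
        qed
        finally show "w \<in> {w\<in>space M. sup_norm (\<lambda>x. random_series Z R S w x - b0 x) < ereal ((\<tau> + 1) * 2 powr (- \<beta> * real r))}"
          using w by simp
      qed
    qed
    finally show ?thesis .
  qed
  then show ?thesis using D0 unfolding \<tau>_def by blast
qed

section \<open>Choice of the resolution level\<close>

text \<open>Here \<open>r n\<close> is the smallest level with \<open>2 ^ r n \<ge> \<kappa> * \<epsilon> n powr (- 1 / \<beta>)\<close>. With
  \<open>X = \<bar>ln (\<epsilon> n)\<bar> / (\<beta> * ln 2)\<close> it is \<open>X + log 2 \<kappa>\<close> up to rounding, hence between \<open>X / 2\<close> and \<open>3 / 2 * X\<close> as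
  soon as \<open>\<epsilon> n\<close> is small.\<close>

lemma eventually_resolution_level:
  fixes \<epsilon> :: "nat \<Rightarrow> real"
  assumes pos: "\<forall>n\<ge>1. 0 < \<epsilon> n" and lim: "\<epsilon> \<longlonglongrightarrow> 0" and \<beta>: "0 < \<beta>" and \<kappa>: "0 < \<kappa>"
    and r: "\<And>n. r n = nat \<lceil>log 2 (\<kappa> * \<epsilon> n powr (- 1 / \<beta>))\<rceil>"
  shows "\<forall>\<^sub>F n in sequentially. 1 \<le> r n \<and> 0 < \<epsilon> n \<and> \<epsilon> n \<le> 1 \<and>
     \<kappa> * \<epsilon> n powr (- 1 / \<beta>) \<le> 2 ^ r n \<and>
     \<kappa> / (2 * \<beta> * ln 2) * (\<epsilon> n powr (- 1 / \<beta>) * \<bar>ln (\<epsilon> n)\<bar>) \<le> 2 ^ r n * real (r n) \<and>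
     2 ^ r n * real (r n) \<le> 3 * \<kappa> / (\<beta> * ln 2) * (\<epsilon> n powr (- 1 / \<beta>) * \<bar>ln (\<epsilon> n)\<bar>)"
proof -
  define B where "B = 2 * (\<bar>log 2 \<kappa>\<bar> + 1)"
  have B: "2 \<le> B" by (simp add: B_def)
  have "\<forall>\<^sub>F n in sequentially. \<epsilon> n < exp (- (B * (\<beta> * ln 2)))"
    using lim by (rule order_tendstoD(2)) simp
  moreover have "\<forall>\<^sub>F n in sequentially. 1 \<le> (n::nat)" by (rule eventually_ge_at_top)
  ultimately show ?thesis
  proof eventually_elim
    case (elim n)
    define X where "X = - ln (\<epsilon> n) / (\<beta> * ln 2)"
    have e0: "0 < \<epsilon> n" using pos elim by simp
    have b: "0 < \<beta> * ln 2" using \<beta> by simp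
    have "ln (\<epsilon> n) < - (B * (\<beta> * ln 2))" using elim(1) e0 by (metis exp_gt_zero ln_exp ln_less_cancel_iff)
    then have XB: "B \<le> X" unfolding X_def pos_le_divide_eq[OF b] by simp
    have lneg: "\<bar>ln (\<epsilon> n)\<bar> = \<beta> * ln 2 * X"
    proof -
      have "- ln (\<epsilon> n) = \<beta> * ln 2 * X" unfolding X_def using \<beta> by simp
      moreover have "0 \<le> \<beta> * ln 2 * X" using \<beta> XB B by (intro mult_nonneg_nonneg) auto
      ultimately show ?thesis by linarith
    qed
    have e1: "\<epsilon> n \<le> 1"
    proof -
      have "0 \<le> B * (\<beta> * ln 2)" using \<beta> B by (intro mult_nonneg_nonneg) auto
      then have "exp (- (B * (\<beta> * ln 2))) \<le> 1" by simp
      then show ?thesis using elim(1) by linarith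
    qed
    define y where "y = \<kappa> * \<epsilon> n powr (- 1 / \<beta>)"
    have y0: "0 < y" using \<kappa> e0 by (simp add: y_def)
    have ly: "log 2 y = log 2 \<kappa> + X"
    proof -
      have "log 2 y = log 2 \<kappa> + log 2 (\<epsilon> n powr (- 1 / \<beta>))"
        unfolding y_def using \<kappa> e0 by (simp add: log_mult_pos)
      also have "log 2 (\<epsilon> n powr (- 1 / \<beta>)) = X"
        using e0 \<beta> by (simp add: log_def ln_powr X_def field_simps)
      finally show ?thesis .
    qed
    have lyb: "X / 2 + 1 \<le> log 2 y" "log 2 y + 1 \<le> 3 / 2 * X"
      unfolding ly using XB by (auto simp: B_def)
    have rn: "log 2 y \<le> real (r n)" "real (r n) \<le> log 2 y + 1"
      using lyb XB B unfolding r y_def[symmetric] by linarith+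
    have "y = 2 powr (log 2 y)" using y0 by simp
    also have "\<dots> \<le> 2 powr real (r n)" using rn by (intro powr_mono) auto
    finally have low: "y \<le> 2 ^ r n" by (simp add: powr_realpow)
    have "(2::real) ^ r n = 2 powr real (r n)" by (simp add: powr_realpow)
    also have "\<dots> \<le> 2 powr (log 2 y + 1)" using rn by (intro powr_mono) auto
    also have "\<dots> = 2 * y" using y0 by (simp add: powr_add)
    finally have up: "2 ^ r n \<le> 2 * y" .
    have r1: "1 \<le> real (r n)" using rn lyb XB B by linarith
    have "y * (X / 2) \<le> 2 ^ r n * real (r n)" using low rn lyb y0 XB B by (intro mult_mono) auto
    moreover have "\<kappa> / (2 * \<beta> * ln 2) * (\<epsilon> n powr (- 1 / \<beta>) * \<bar>ln (\<epsilon> n)\<bar>) = y * (X / 2)"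
      unfolding lneg y_def using \<beta> by (simp add: field_simps)
    ultimately have lower: "\<kappa> / (2 * \<beta> * ln 2) * (\<epsilon> n powr (- 1 / \<beta>) * \<bar>ln (\<epsilon> n)\<bar>) \<le> 2 ^ r n * real (r n)"
      by (simp only:)
    have "2 ^ r n * real (r n) \<le> 2 * y * (3 / 2 * X)" using up rn lyb y0 XB B by (intro mult_mono) auto
    moreover have "3 * \<kappa> / (\<beta> * ln 2) * (\<epsilon> n powr (- 1 / \<beta>) * \<bar>ln (\<epsilon> n)\<bar>) = 2 * y * (3 / 2 * X)"
      unfolding lneg y_def using \<beta> by (simp add: field_simps)
    ultimately have upper: "2 ^ r n * real (r n) \<le> 3 * \<kappa> / (\<beta> * ln 2) * (\<epsilon> n powr (- 1 / \<beta>) * \<bar>ln (\<epsilon> n)\<bar>)"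
      by (simp only:)
    have "1 \<le> r n" using r1 by simp
    then show ?case using e0 e1 low[unfolded y_def] lower upper by blast
  qed
qed

lemma powr_resolution_le:
  assumes \<kappa>: "0 < \<kappa>" and e: "0 < e" and \<beta>: "0 < \<beta>" and le: "\<kappa> * e powr (- 1 / \<beta>) \<le> 2 ^ r"
  shows "\<kappa> powr \<beta> * 2 powr (- \<beta> * real r) \<le> e"
proof -
  have "(\<kappa> * e powr (- 1 / \<beta>)) powr \<beta> \<le> (2 powr real r) powr \<beta>"
    using le \<kappa> \<beta> by (intro powr_mono2) (auto simp: powr_realpow)
  then have "\<kappa> powr \<beta> * (1 / e) \<le> 2 powr (\<beta> * real r)"
  proof -
    have "(e powr (- 1 / \<beta>)) powr \<beta> = e powr (- 1)" using \<beta> by (simp only: powr_powr) simp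
    also have "\<dots> = 1 / e" using e by (simp add: powr_minus_divide)
    finally have "(\<kappa> * e powr (- 1 / \<beta>)) powr \<beta> = \<kappa> powr \<beta> * (1 / e)"
      using \<kappa> by (subst powr_mult) auto
    moreover have "(2 powr real r) powr \<beta> = 2 powr (\<beta> * real r)" by (simp add: powr_powr mult.commute)
    ultimately show ?thesis using \<open>(\<kappa> * e powr (- 1 / \<beta>)) powr \<beta> \<le> (2 powr real r) powr \<beta>\<close> by simp
  qed
  then have "\<kappa> powr \<beta> \<le> e * 2 powr (\<beta> * real r)" using e by (simp add: field_simps)
  then show ?thesis by (simp add: powr_minus_divide field_simps)
qed

text \<open>Two resolution levels are used: \<open>r1\<close>, for which the tail of \<open>b0\<close> is below \<open>\<epsilon> n\<close>, gives the small ball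
  probability and a constant \<open>C1\<close> that depends only on the model; \<open>r2\<close>, which defines the sieve, has
  \<open>2 ^ r2\<close> proportional to \<open>C2\<close>, so that the tail of \<open>R\<close> beyond it is small enough.\<close>

theorem theorem8:
  fixes M :: "'w measure"
    and Z :: "nat \<Rightarrow> 'w \<Rightarrow> real" and R :: "'w \<Rightarrow> nat" and S :: "'w \<Rightarrow> real"
    and A :: "nat \<Rightarrow> nat \<Rightarrow> real"
    and b0 :: "real \<Rightarrow> real" and z :: "nat \<Rightarrow> real"
    and \<alpha> \<beta> c1' c2' p1 p2 q C :: real and \<epsilon> :: "nat \<Rightarrow> real"
  assumes "prob_space M"
    and "\<forall>x. b0 (x + 1) = b0 x"
    and "\<forall>x. (\<lambda>i. z (i + 1) * schauder (i + 1) x) sums b0 x"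
    and "0 < \<beta>" and "coeff_sup \<beta> z < \<infinity>"
    and "centred_gaussian_seq M Z A"
    and "\<forall>w\<in>space M. 0 < S w"
    and "indep_vars3 M (PiM {1..} (\<lambda>_. borel)) (\<lambda>w. \<lambda>i\<in>{1..}. Z i w)
           (count_space UNIV) R borel S"
    and "(0 < \<alpha> \<and>
          (\<forall>i\<ge>1. A i i = 2 powr (- 2 * \<alpha> * real (level i))) \<and>
          (\<forall>i\<ge>1. \<forall>i'\<ge>1. i \<noteq> i' \<longrightarrow> A i i' = 0))
       \<or> (\<alpha> = 1/2 \<and>
          (\<exists>c1 c2 c3. 0 < c1 \<and> c1 < c2 \<and> 0 < c3 \<and> 3 * c3 < c1 \<and>
            (\<forall>i\<ge>1. c1 * 2 powr (- real (level i)) \<le> A i i \<and>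
                   A i i \<le> c2 * 2 powr (- real (level i))) \<and>
            (\<forall>i\<ge>1. \<forall>i'\<ge>1. i \<noteq> i' \<longrightarrow>
               \<bar>A i i'\<bar> \<le> c3 * 2 powr (- 1.5 * (real (level i) + real (level i'))))))"
    and "0 < c1'" and "0 < c2'"
    and "\<forall>r\<ge>1. \<P>(w in M. R w > r) \<le> exp (- c1' * 2 ^ r * real r)"
    and "\<forall>r\<ge>1. \<P>(w in M. R w = r) \<ge> exp (- c2' * 2 ^ r * real r)"
    and "0 < p1" and "p1 < p2" and "0 < q" and "1 < C" and "p1 > q * \<bar>\<alpha> - \<beta>\<bar>"
    and "\<forall>x\<ge>C. \<P>(w in M. S w \<in> {x powr p1..x powr p2}) \<ge> exp (- (x powr q))"
    and "\<forall>n\<ge>1. 0 < \<epsilon> n" and "\<epsilon> \<longlonglongrightarrow> 0"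
  shows "\<exists>C1>0. \<forall>C2>0. \<exists>B :: nat \<Rightarrow> (real \<Rightarrow> real) set.
           (\<forall>n\<ge>1. B n \<in> sets L2T_borel) \<and>
           (\<forall>a>0. \<exists>C3>0. \<forall>\<^sub>F n in sequentially.
              elog \<P>(w in M. sup_norm (\<lambda>x. random_series Z R S w x - b0 x) < \<epsilon> n)
                \<ge> ereal (- C1 * \<epsilon> n powr (- 1 / \<beta>) * \<bar>ln (\<epsilon> n)\<bar>) \<and>
              elog \<P>(w in M. random_series Z R S w \<notin> B n)
                \<le> ereal (- C2 * \<epsilon> n powr (- 1 / \<beta>) * \<bar>ln (\<epsilon> n)\<bar>) \<and>
              elog (ereal_of_enat (covering_number L2T (\<lambda>b b'. L2T_sup_norm (\<lambda>x. b x - b' x))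
                      (a * \<epsilon> n) {b \<in> B n. norm2 (\<lambda>x. b x - b0 x) \<le> \<epsilon> n}))
                \<le> ereal (C3 * \<epsilon> n powr (- 1 / \<beta>) * \<bar>ln (\<epsilon> n)\<bar>))"
proof -
  interpret prob_space M by fact
  note G = assms(6) and ind = assms(8)
  have b0: "\<And>x. b0 (x + 1) = b0 x" and sums: "\<And>x. (\<lambda>i. z (i + 1) * schauder (i + 1) x) sums b0 x"
    and \<beta>: "0 < \<beta>" using assms(2-4) by auto
  note c1' = assms(10) and c2' = assms(11) and Rtail = assms(12)
  obtain K where K: "0 < K" and z: "\<And>i. 1 \<le> i \<Longrightarrow> \<bar>z i\<bar> \<le> K * 2 powr (- \<beta> * real (level i))"
    using coeff_sup_bound[OF assms(5)] by metis
  obtain \<kappa> V where lb: "covariance_bounds M Z \<alpha> \<kappa> V"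
    using covariance_bounds_cases[OF G assms(9)] by auto
  have Sm: "S \<in> borel_measurable M" and Rm: "R \<in> measurable M (count_space UNIV)"
    using ind by (auto simp: indep_vars3_def)
  have b0_cont: "continuous_on UNIV b0" by (rule schauder_series_continuous[OF z K \<beta> sums])
  have b0_L2T: "b0 \<in> L2T" by (rule continuous_periodic_in_L2T[OF b0_cont b0])
  define \<tau> where "\<tau> = K / (2 powr \<beta> - 1) + 1"
  have "1 \<le> 2 powr \<beta>" using \<beta> by (intro ge_one_powr_ge_zero) auto
  then have \<tau>: "0 < \<tau>" unfolding \<tau>_def using K by (intro add_nonneg_pos divide_nonneg_nonneg) auto
  obtain D where D: "0 < D" and ball: "\<And>r. 1 \<le> r \<Longrightarrow> exp (- (D * 2 ^ r * real r)) \<le>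
    prob {w\<in>space M. sup_norm (\<lambda>x. random_series Z R S w x - b0 x) < ereal (\<tau> * 2 powr (- \<beta> * real r))}"
    using small_ball[OF G lb z K \<beta> sums ind assms(13) c2' assms(14-18) assms(19)] unfolding \<tau>_def by blast
  define W where "W n = \<epsilon> n powr (- 1 / \<beta>) * \<bar>ln (\<epsilon> n)\<bar>" for n
  \<comment> \<open>With this constant, \<open>\<tau> * 2 powr (- \<beta> * r1 n) \<le> \<epsilon> n\<close>.\<close>
  define \<kappa>1 where "\<kappa>1 = \<tau> powr (1 / \<beta>)"
  have \<kappa>1: "0 < \<kappa>1" "\<kappa>1 powr \<beta> = \<tau>" using \<tau> \<beta> by (auto simp: \<kappa>1_def powr_powr)
  define r1 where "r1 n = nat \<lceil>log 2 (\<kappa>1 * \<epsilon> n powr (- 1 / \<beta>))\<rceil>" for n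
  note ev1 = eventually_resolution_level[OF assms(20,21) \<beta> \<kappa>1(1) r1_def]
  define C1 where "C1 = D * (3 * \<kappa>1 / (\<beta> * ln 2))"
  have C1: "0 < C1" using D \<kappa>1 \<beta> by (simp add: C1_def)
  have part1: "\<forall>\<^sub>F n in sequentially. ereal (- C1 * \<epsilon> n powr (- 1 / \<beta>) * \<bar>ln (\<epsilon> n)\<bar>) \<le>
      elog (prob {w\<in>space M. sup_norm (\<lambda>x. random_series Z R S w x - b0 x) < \<epsilon> n})"
    using ev1
  proof eventually_elim
    case (elim n)
    then have e0: "0 < \<epsilon> n" and lvl: "1 \<le> r1 n" "\<kappa>1 * \<epsilon> n powr (- 1 / \<beta>) \<le> 2 ^ r1 n"
       "2 ^ r1 n * real (r1 n) \<le> 3 * \<kappa>1 / (\<beta> * ln 2) * W n" by (auto simp: W_def)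
    have le: "\<tau> * 2 powr (- \<beta> * real (r1 n)) \<le> \<epsilon> n"
      using powr_resolution_le[OF \<kappa>1(1) e0 \<beta> lvl(2)] unfolding \<kappa>1(2) .
    have "exp (- (C1 * W n)) \<le> exp (- (D * 2 ^ r1 n * real (r1 n)))"
      using mult_left_mono[OF lvl(3), of D] D by (simp add: C1_def mult.assoc)
    also note ball[OF lvl(1)]
    also have "prob {w\<in>space M. sup_norm (\<lambda>x. random_series Z R S w x - b0 x) < ereal (\<tau> * 2 powr (- \<beta> * real (r1 n)))}
      \<le> prob {w\<in>space M. sup_norm (\<lambda>x. random_series Z R S w x - b0 x) < \<epsilon> n}"
    proof (rule finite_measure_mono)
      show "{w\<in>space M. sup_norm (\<lambda>x. random_series Z R S w x - b0 x) < \<epsilon> n} \<in> sets M"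
        by (rule sup_norm_event_measurable[OF centred_gaussian_seq_measurable[OF G] Rm Sm b0_cont])
      have "ereal (\<tau> * 2 powr (- \<beta> * real (r1 n))) \<le> ereal (\<epsilon> n)" using le by simp
      then show "{w\<in>space M. sup_norm (\<lambda>x. random_series Z R S w x - b0 x) < ereal (\<tau> * 2 powr (- \<beta> * real (r1 n)))}
        \<subseteq> {w\<in>space M. sup_norm (\<lambda>x. random_series Z R S w x - b0 x) < \<epsilon> n}"
        using less_le_trans by blast
    qed
    finally have "ereal (ln (exp (- (C1 * W n)))) \<le>
        elog (prob {w\<in>space M. sup_norm (\<lambda>x. random_series Z R S w x - b0 x) < \<epsilon> n})"
      by (intro elog_ge) auto
    then show ?case by (simp add: W_def mult.assoc)
  qed
  show ?thesis
  proof (intro exI[of _ C1] conjI C1 allI impI)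
    fix C2 :: real assume C2: "0 < C2"
    \<comment> \<open>With this constant, \<open>c1' * 2 ^ r2 n * r2 n \<ge> C2 * W n\<close>.\<close>
    define \<kappa>2 where "\<kappa>2 = C2 * (2 * \<beta> * ln 2) / c1'"
    have \<kappa>2: "0 < \<kappa>2" using C2 \<beta> c1' by (simp add: \<kappa>2_def)
    define r2 where "r2 n = nat \<lceil>log 2 (\<kappa>2 * \<epsilon> n powr (- 1 / \<beta>))\<rceil>" for n
    note ev2 = eventually_resolution_level[OF assms(20,21) \<beta> \<kappa>2 r2_def]
    have part2: "\<forall>\<^sub>F n in sequentially. elog (prob {w\<in>space M. random_series Z R S w \<notin> schauder_space (r2 n)})
        \<le> ereal (- C2 * \<epsilon> n powr (- 1 / \<beta>) * \<bar>ln (\<epsilon> n)\<bar>)"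
      using ev2
    proof eventually_elim
      case (elim n)
      then have lvl: "1 \<le> r2 n" "\<kappa>2 / (2 * \<beta> * ln 2) * W n \<le> 2 ^ r2 n * real (r2 n)" by (auto simp: W_def)
      have "prob {w\<in>space M. random_series Z R S w \<notin> schauder_space (r2 n)} \<le> prob {w\<in>space M. R w > r2 n}"
      proof (rule finite_measure_mono)
        show "{w\<in>space M. random_series Z R S w \<notin> schauder_space (r2 n)} \<subseteq> {w\<in>space M. R w > r2 n}"
        proof safe
          fix w assume w: "random_series Z R S w \<notin> schauder_space (r2 n)"
          show "r2 n < R w"
          proof (rule ccontr)
            assume "\<not> r2 n < R w"
            then obtain c where "schauder_sum (R w) (\<lambda>i. S w * Z i w) = schauder_sum (r2 n) c"
              using schauder_sum_mono_level[of "R w" "r2 n"] by (meson not_less)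
            then have "random_series Z R S w = schauder_sum (r2 n) c" by (simp add: fun_eq_iff random_series_eq)
            then show False using w schauder_sum_in_schauder_space by simp
          qed
        qed
        have "R -` {r2 n<..} \<inter> space M \<in> sets M" using Rm by (rule measurable_sets) simp
        also have "R -` {r2 n<..} \<inter> space M = {w\<in>space M. R w > r2 n}" by auto
        finally show "{w\<in>space M. R w > r2 n} \<in> sets M" .
      qed
      also have "\<dots> \<le> exp (- c1' * 2 ^ r2 n * real (r2 n))" using Rtail lvl(1) by blast
      also have "\<dots> \<le> exp (- (C2 * W n))"
      proof -
        have "c1' * (\<kappa>2 / (2 * \<beta> * ln 2) * W n) \<le> c1' * (2 ^ r2 n * real (r2 n))"
          using lvl(2) c1' by (intro mult_left_mono) auto
        moreover have "c1' * (\<kappa>2 / (2 * \<beta> * ln 2) * W n) = C2 * W n"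
          using c1' \<beta> by (simp add: \<kappa>2_def)
        ultimately show ?thesis by (simp add: mult.assoc)
      qed
      finally have "elog (prob {w\<in>space M. random_series Z R S w \<notin> schauder_space (r2 n)}) \<le> ereal (ln (exp (- (C2 * W n))))"
        by (intro elog_le) auto
      then show ?case by (simp add: W_def mult.assoc)
    qed
    have part3: "\<exists>C3>0. \<forall>\<^sub>F n in sequentially.
        elog (ereal_of_enat (covering_number L2T (\<lambda>b b'. L2T_sup_norm (\<lambda>x. b x - b' x))
            (ereal (a * \<epsilon> n)) {b \<in> schauder_space (r2 n). norm2 (\<lambda>x. b x - b0 x) \<le> \<epsilon> n}))
        \<le> ereal (C3 * \<epsilon> n powr (- 1 / \<beta>) * \<bar>ln (\<epsilon> n)\<bar>)" if a: "0 < a" for a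
    proof -
      define Kb where "Kb = 12 * (2 + 2 * norm2 b0)"
      have Kb: "0 < Kb" using norm2_nonneg[of b0] by (simp add: Kb_def)
      define c where "c = 4 * Kb / (a * \<kappa>2 powr \<beta>) + 3"
      have c1: "1 \<le> c" using Kb a by (simp add: c_def)
      define L where "L = ln c + (4 + \<beta>) * ln 2"
      have L: "0 < L" unfolding L_def using c1 \<beta> by (intro add_nonneg_pos) auto
      define C3 where "C3 = 2 * L * (3 * \<kappa>2 / (\<beta> * ln 2))"
      have "0 < C3" using L \<kappa>2 \<beta> by (simp add: C3_def)
      moreover have "\<forall>\<^sub>F n in sequentially.
        elog (ereal_of_enat (covering_number L2T (\<lambda>b b'. L2T_sup_norm (\<lambda>x. b x - b' x))
            (ereal (a * \<epsilon> n)) {b \<in> schauder_space (r2 n). norm2 (\<lambda>x. b x - b0 x) \<le> \<epsilon> n}))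
        \<le> ereal (C3 * \<epsilon> n powr (- 1 / \<beta>) * \<bar>ln (\<epsilon> n)\<bar>)"
        using ev2
      proof eventually_elim
        case (elim n)
        then have e: "0 < \<epsilon> n" "\<epsilon> n \<le> 1" and lvl: "1 \<le> r2 n" "\<kappa>2 * \<epsilon> n powr (- 1 / \<beta>) \<le> 2 ^ r2 n"
          "2 ^ r2 n * real (r2 n) \<le> 3 * \<kappa>2 / (\<beta> * ln 2) * W n" by (auto simp: W_def)
        define r where "r = r2 n"
        define \<theta> where "\<theta> = a * \<epsilon> n / (2 * (real r + 2))"
        have \<theta>: "0 < \<theta>" using a e by (simp add: \<theta>_def)
        have "(real r + 2) * \<theta> = a * \<epsilon> n / 2" by (simp add: \<theta>_def field_simps)
        moreover have "0 < a * \<epsilon> n" using a e by simp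
        ultimately have "(real r + 2) * \<theta> < a * \<epsilon> n" by linarith
        from covering_number_schauder_space[OF b0_L2T e(2) \<theta> this] obtain N where
          N: "covering_number L2T (\<lambda>b b'. L2T_sup_norm (\<lambda>x. b x - b' x)) (ereal (a * \<epsilon> n))
              {b\<in>schauder_space r. norm2 (\<lambda>x. b x - b0 x) \<le> \<epsilon> n} \<le> enat N"
            "real N \<le> (2 * (12 * 4 ^ r * (2 + 2 * norm2 b0)) / \<theta> + 3) ^ 2 ^ (r + 1)"
          by blast
        have "2 * (12 * 4 ^ r * (2 + 2 * norm2 b0)) / \<theta> + 3 \<le> exp (L * real r)"
        proof -
          have r4: "real r + 2 \<le> 4 ^ r" using add_2_lt_4_power[of r] lvl(1) by (simp add: r_def)
          have p4: "(4::real) ^ r = 2 powr (2 * real r)" by (simp add: powr_realpow[symmetric] powr_powr[symmetric])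
          have "\<kappa>2 powr \<beta> * 2 powr (- \<beta> * real r) \<le> \<epsilon> n"
            unfolding r_def by (rule powr_resolution_le[OF \<kappa>2 e(1) \<beta> lvl(2)])
          then have ie: "1 / \<epsilon> n \<le> 2 powr (\<beta> * real r) / \<kappa>2 powr \<beta>"
            using e(1) \<kappa>2 by (simp add: powr_minus_divide field_simps)
          have "2 * (12 * 4 ^ r * (2 + 2 * norm2 b0)) / \<theta> = 4 * Kb / a * (4 ^ r * (real r + 2) * (1 / \<epsilon> n))"
            using a e by (simp add: Kb_def \<theta>_def field_simps)
          also have "\<dots> \<le> 4 * Kb / a * (4 ^ r * 4 ^ r * (2 powr (\<beta> * real r) / \<kappa>2 powr \<beta>))"
            using Kb a r4 ie e by (intro mult_left_mono mult_mono) auto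
          also have "\<dots> = 4 * Kb / (a * \<kappa>2 powr \<beta>) * (2 powr (2 * real r) * 2 powr (2 * real r) * 2 powr (\<beta> * real r))"
            unfolding p4 by simp
          also have "2 powr (2 * real r) * 2 powr (2 * real r) * 2 powr (\<beta> * real r) = 2 powr ((4 + \<beta>) * real r)"
            unfolding powr_add[symmetric] by (simp add: algebra_simps)
          finally have "2 * (12 * 4 ^ r * (2 + 2 * norm2 b0)) / \<theta> + 3 \<le> 4 * Kb / (a * \<kappa>2 powr \<beta>) * 2 powr ((4 + \<beta>) * real r) + 3" by simp
          also have "\<dots> \<le> c * 2 powr ((4 + \<beta>) * real r)"
          proof -
            have "1 \<le> 2 powr ((4 + \<beta>) * real r)" using \<beta> by (intro ge_one_powr_ge_zero) auto
            then show ?thesis by (simp add: c_def algebra_simps)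
          qed
          also have "\<dots> \<le> exp (L * real r)"
            unfolding L_def using lvl(1) by (intro mult_powr_le_exp c1) (simp add: r_def)
          finally show ?thesis .
        qed
        then have "(2 * (12 * 4 ^ r * (2 + 2 * norm2 b0)) / \<theta> + 3) ^ 2 ^ (r + 1) \<le> exp (L * real r) ^ 2 ^ (r + 1)"
          using \<theta> norm2_nonneg[of b0] by (intro power_mono) auto
        also have "\<dots> = exp (2 * L * (2 ^ r * real r))"
          unfolding exp_of_nat_mult[symmetric] by (simp add: mult_ac)
        also have "\<dots> \<le> exp (C3 * W n)"
          using mult_left_mono[OF lvl(3), of "2 * L"] L by (simp add: C3_def r_def mult.assoc)
        finally have "real N \<le> exp (C3 * W n)" using N(2) by linarith
        moreover have "ereal_of_enat (covering_number L2T (\<lambda>b b'. L2T_sup_norm (\<lambda>x. b x - b' x)) (ereal (a * \<epsilon> n))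
              {b\<in>schauder_space r. norm2 (\<lambda>x. b x - b0 x) \<le> \<epsilon> n}) \<le> ereal (real N)"
          unfolding ereal_of_enat_simps(1)[symmetric] ereal_of_enat_le_iff by (rule N(1))
        ultimately have "elog (ereal_of_enat (covering_number L2T (\<lambda>b b'. L2T_sup_norm (\<lambda>x. b x - b' x)) (ereal (a * \<epsilon> n))
              {b\<in>schauder_space r. norm2 (\<lambda>x. b x - b0 x) \<le> \<epsilon> n})) \<le> ereal (ln (exp (C3 * W n)))"
          by (intro elog_le) (auto intro: order_trans)
        then show ?case by (simp add: W_def r_def mult.assoc)
      qed
      ultimately show ?thesis by blast
    qed
    show "\<exists>B :: nat \<Rightarrow> (real \<Rightarrow> real) set.
           (\<forall>n\<ge>1. B n \<in> sets L2T_borel) \<and>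
           (\<forall>a>0. \<exists>C3>0. \<forall>\<^sub>F n in sequentially.
              elog \<P>(w in M. sup_norm (\<lambda>x. random_series Z R S w x - b0 x) < \<epsilon> n)
                \<ge> ereal (- C1 * \<epsilon> n powr (- 1 / \<beta>) * \<bar>ln (\<epsilon> n)\<bar>) \<and>
              elog \<P>(w in M. random_series Z R S w \<notin> B n)
                \<le> ereal (- C2 * \<epsilon> n powr (- 1 / \<beta>) * \<bar>ln (\<epsilon> n)\<bar>) \<and>
              elog (ereal_of_enat (covering_number L2T (\<lambda>b b'. L2T_sup_norm (\<lambda>x. b x - b' x))
                      (a * \<epsilon> n) {b \<in> B n. norm2 (\<lambda>x. b x - b0 x) \<le> \<epsilon> n}))
                \<le> ereal (C3 * \<epsilon> n powr (- 1 / \<beta>) * \<bar>ln (\<epsilon> n)\<bar>))"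
    proof (intro exI[of _ "\<lambda>n. schauder_space (r2 n)"] conjI allI impI schauder_space_measurable)
      fix a :: real assume "0 < a"
      from part3[OF this] obtain C3 where C3: "0 < C3" "\<forall>\<^sub>F n in sequentially.
        elog (ereal_of_enat (covering_number L2T (\<lambda>b b'. L2T_sup_norm (\<lambda>x. b x - b' x))
            (ereal (a * \<epsilon> n)) {b \<in> schauder_space (r2 n). norm2 (\<lambda>x. b x - b0 x) \<le> \<epsilon> n}))
        \<le> ereal (C3 * \<epsilon> n powr (- 1 / \<beta>) * \<bar>ln (\<epsilon> n)\<bar>)" by blast
      show "\<exists>C3>0. \<forall>\<^sub>F n in sequentially.
              elog \<P>(w in M. sup_norm (\<lambda>x. random_series Z R S w x - b0 x) < \<epsilon> n)
                \<ge> ereal (- C1 * \<epsilon> n powr (- 1 / \<beta>) * \<bar>ln (\<epsilon> n)\<bar>) \<and>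
              elog \<P>(w in M. random_series Z R S w \<notin> schauder_space (r2 n))
                \<le> ereal (- C2 * \<epsilon> n powr (- 1 / \<beta>) * \<bar>ln (\<epsilon> n)\<bar>) \<and>
              elog (ereal_of_enat (covering_number L2T (\<lambda>b b'. L2T_sup_norm (\<lambda>x. b x - b' x))
                      (a * \<epsilon> n) {b \<in> schauder_space (r2 n). norm2 (\<lambda>x. b x - b0 x) \<le> \<epsilon> n}))
                \<le> ereal (C3 * \<epsilon> n powr (- 1 / \<beta>) * \<bar>ln (\<epsilon> n)\<bar>)"
        using C3(1) eventually_conj[OF part1 eventually_conj[OF part2 C3(2)]] by blast
    qed
  qed
qed

end
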